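(* Let $M$ be a non-orientable Riemannian surface with orientation double cover $\pi:\widetilde M\to M$. The phase space $\mathcal O_{\boldsymbol\lambda}=\{\phi^*\boldsymbol\lambda\mid\phi\in\mathrm{SDiff}(M)\}$ for a system of $N$ point vortices on $M$ with vorticity 2-form $\boldsymbol\lambda$ can be parametrized by $$\underbrace{\widetilde M\times\dots\times\widetilde M}_{N}\setminus\widetilde\Delta,$$ where $\widetilde\Delta$ is the "very big diagonal" consisting of the points $(\tilde x_1,\dots,\tilde x_N)\in\widetilde M^N$ for which $\pi(\tilde x_i)=\pi(\tilde x_j)$ for some $i\neq j$.
   Context: The orientation double cover $\widetilde M$ consists of pairs (point $p$ of $M$, orientation of $M$ at $p$), $\pi$ forgets the orientation, and $\tau:\widetilde M\to\widetilde M$ is the involution swapping the two points of each fibre. $\widetilde M$ carries a tautological orientation and hence, with the lifted metric, a symplectic (area) form $\sigma$, with $\tau^*\sigma=-\sigma$. $\mathrm{SDiff}(M)$ is the group of volume-preserving diffeomorphisms of $M$. The vorticity of a system of $N$ point vortices on $M$ is a 2-form (2-current) $\boldsymbol\lambda=\sum_j\lambda_{x_j}$, where $\lambda_{x_j}$ is a delta-function 2-form supported at $x_j\in M$, the points $x_1,\dots,x_N$ being distinct; it does not depend on any orientation. The parametrization is as follows. For each point $x_j$ of the support, $\pi^{-1}(x_j)=\{\tilde x_j,\tau(\tilde x_j)\}$. The pull-back of $\boldsymbol\lambda$ to $\widetilde M$, compared with $\sigma$, defines a vortex strength $\Gamma_j$ at $\tilde x_j$ and $-\Gamma_j$ at $\tau(\tilde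 x_j)$ (the sign of $\Gamma_j$ is not prescribed). The system is parametrized by $(\tilde x_1,\dots,\tilde x_N)$ and the associated strengths $(\Gamma_1,\dots,\Gamma_N)$. Points of $\widetilde M$ rather than of $M$ are needed because transporting a vortex around an orientation-reversing loop in $M$ reverses its contribution to the vorticity 2-form, so $\mathcal O_{\boldsymbol\lambda}$ also contains $\sum_j(\pm\lambda_{x_j})$ for all choices of signs. *)

theory Defs
  imports "HOL-Analysis.Analysis"
begin

section \<open>Smooth surfaces\<close>

text \<open>Only used on open sets \<open>S\<close>, where it is the usual notion of a \<open>k\<close> times continuously
  differentiable map.\<close>

primrec C_k_on ::
  "nat \<Rightarrow> 'a::real_normed_vector set \<Rightarrow> ('a \<Rightarrow> 'b::real_normed_vector) \<Rightarrow> bool" where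
  "C_k_on 0 S f \<longleftrightarrow> continuous_on S f"
| "C_k_on (Suc k) S f \<longleftrightarrow>
     f differentiable_on S \<and> (\<forall>v. C_k_on k S (\<lambda>x. frechet_derivative f (at x) v))"

definition smooth_on ::
  "'a::real_normed_vector set \<Rightarrow> ('a \<Rightarrow> 'b::real_normed_vector) \<Rightarrow> bool" where
  "smooth_on S f \<longleftrightarrow> (\<forall>k. C_k_on k S f)"

text \<open>A chart is a domain together with a coordinate map. A surface is given by a topology and a
  smooth atlas; the atlas need not be maximal.\<close>

type_synonym 'a chart = "'a set \<times> ('a \<Rightarrow> real^2)"

abbreviation chart_dom :: "'a chart \<Rightarrow> 'a set" where
  "chart_dom c \<equiv> fst c"

abbreviation coord :: "'a chart \<Rightarrow> 'a \<Rightarrow> real^2" where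
  "coord c \<equiv> snd c"

definition chart_inv :: "'a chart \<Rightarrow> real^2 \<Rightarrow> 'a" where
  "chart_inv c = inv_into (chart_dom c) (coord c)"

definition is_chart :: "'a topology \<Rightarrow> 'a chart \<Rightarrow> bool" where
  "is_chart X c \<longleftrightarrow>
     openin X (chart_dom c) \<and> open (coord c ` chart_dom c) \<and>
     homeomorphic_map (subtopology X (chart_dom c)) (top_of_set (coord c ` chart_dom c)) (coord c)"

definition smooth_surface :: "'a topology \<Rightarrow> 'a chart set \<Rightarrow> bool" where
  "smooth_surface X A \<longleftrightarrow>
     Hausdorff_space X \<and> second_countable X \<and>
     (\<forall>c\<in>A. is_chart X c) \<and> (\<Union>c\<in>A. chart_dom c) = topspace X \<and>
     (\<forall>c\<in>A. \<forall>c'\<in>A.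
        smooth_on (coord c ` (chart_dom c \<inter> chart_dom c')) (coord c' \<circ> chart_inv c))"

definition smooth_map ::
  "'a topology \<Rightarrow> 'a chart set \<Rightarrow> 'b topology \<Rightarrow> 'b chart set \<Rightarrow> ('a \<Rightarrow> 'b) \<Rightarrow> bool" where
  "smooth_map X A Y B F \<longleftrightarrow>
     continuous_map X Y F \<and>
     (\<forall>c\<in>A. \<forall>c'\<in>B.
        smooth_on (coord c ` {p \<in> chart_dom c. F p \<in> chart_dom c'}) (coord c' \<circ> F \<circ> chart_inv c))"

definition diffeomorphism :: "'a topology \<Rightarrow> 'a chart set \<Rightarrow> ('a \<Rightarrow> 'a) \<Rightarrow> bool" where
  "diffeomorphism X A F \<longleftrightarrow>
     bij_betw F (topspace X) (topspace X) \<and>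
     smooth_map X A X A F \<and> smooth_map X A X A (inv_into (topspace X) F)"

text \<open>The matrix at \<open>p\<close> of the tangent map of \<open>F\<close> in the coordinates \<open>c\<close> (around \<open>p\<close>) and \<open>c'\<close>
  (around \<open>F p\<close>).\<close>

definition chart_jacobian ::
  "'a chart \<Rightarrow> 'b chart \<Rightarrow> ('a \<Rightarrow> 'b) \<Rightarrow> 'a \<Rightarrow> real^2^2" where
  "chart_jacobian c c' F p = jacobian (coord c' \<circ> F \<circ> chart_inv c) (at (coord c p))"

abbreviation transition_jacobian :: "'a chart \<Rightarrow> 'a chart \<Rightarrow> 'a \<Rightarrow> real^2^2" where
  "transition_jacobian c c' p \<equiv> chart_jacobian c c' (\<lambda>q. q) p"

section \<open>Riemannian metrics and volume-preserving diffeomorphisms\<close>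

text \<open>\<open>g c p\<close> is the Gram matrix of the metric at \<open>p\<close> in the coordinate frame of \<open>c\<close>.\<close>

definition riemannian_metric :: "'a chart set \<Rightarrow> ('a chart \<Rightarrow> 'a \<Rightarrow> real^2^2) \<Rightarrow> bool" where
  "riemannian_metric A g \<longleftrightarrow>
     (\<forall>c\<in>A. smooth_on (coord c ` chart_dom c) (g c \<circ> chart_inv c)) \<and>
     (\<forall>c\<in>A. \<forall>p\<in>chart_dom c.
        transpose (g c p) = g c p \<and> (\<forall>v. v \<noteq> 0 \<longrightarrow> 0 < v \<bullet> (g c p *v v))) \<and>
     (\<forall>c\<in>A. \<forall>c'\<in>A. \<forall>p \<in> chart_dom c \<inter> chart_dom c'.
        g c p = transpose (transition_jacobian c c' p) ** g c' p ** transition_jacobian c c' p)"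

definition area_density :: "('a chart \<Rightarrow> 'a \<Rightarrow> real^2^2) \<Rightarrow> 'a chart \<Rightarrow> 'a \<Rightarrow> real" where
  "area_density g c p = sqrt (det (g c p))"

text \<open>On a non-orientable surface there is no area form, only the Riemannian area density;
  hence the absolute value of the Jacobian determinant.\<close>

definition SDiff ::
  "'a topology \<Rightarrow> 'a chart set \<Rightarrow> ('a chart \<Rightarrow> 'a \<Rightarrow> real^2^2) \<Rightarrow> ('a \<Rightarrow> 'a) set" where
  "SDiff X A g =
     {F. diffeomorphism X A F \<and>
         (\<forall>c\<in>A. \<forall>c'\<in>A. \<forall>p\<in>chart_dom c. F p \<in> chart_dom c' \<longrightarrow>
            area_density g c' (F p) * \<bar>det (chart_jacobian c c' F p)\<bar> = area_density g c p)}"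

section \<open>Orientations and the orientation double cover\<close>

text \<open>An orientation \<open>\<omega>\<close> of the tangent space at \<open>p\<close> is given by the signs \<open>\<omega> c\<close> it assigns to the
  coordinate frames of the charts \<open>c\<close> around \<open>p\<close>; the value 0 for all other \<open>c\<close> makes the
  representation unique.\<close>

definition orientations_at :: "'a chart set \<Rightarrow> 'a \<Rightarrow> ('a chart \<Rightarrow> real) set" where
  "orientations_at A p =
     {\<omega>. (\<forall>c. if c \<in> A \<and> p \<in> chart_dom c then \<omega> c \<in> {-1, 1} else \<omega> c = 0) \<and>
         (\<forall>c\<in>A. \<forall>c'\<in>A. p \<in> chart_dom c \<inter> chart_dom c' \<longrightarrow>
            \<omega> c' = sgn (det (transition_jacobian c c' p)) * \<omega> c)}"

definition orientable :: "'a topology \<Rightarrow> 'a chart set \<Rightarrow> bool" where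
  "orientable X A \<longleftrightarrow>
     (\<exists>\<Omega>. (\<forall>p\<in>topspace X. \<Omega> p \<in> orientations_at A p) \<and>
          (\<forall>c\<in>A. continuous_map (subtopology X (chart_dom c)) euclideanreal (\<lambda>p. \<Omega> p c)))"

definition nonorientable_riemannian_surface ::
  "'a topology \<Rightarrow> 'a chart set \<Rightarrow> ('a chart \<Rightarrow> 'a \<Rightarrow> real^2^2) \<Rightarrow> bool" where
  "nonorientable_riemannian_surface X A g \<longleftrightarrow>
     smooth_surface X A \<and> connected_space X \<and> riemannian_metric A g \<and> \<not> orientable X A"

type_synonym 'a oriented_point = "'a \<times> ('a chart \<Rightarrow> real)"

definition double_cover :: "'a topology \<Rightarrow> 'a chart set \<Rightarrow> 'a oriented_point set" where
  "double_cover X A = Sigma (topspace X) (orientations_at A)"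

definition cover_proj :: "'a oriented_point \<Rightarrow> 'a" where
  "cover_proj z = fst z"

definition deck_involution :: "'a oriented_point \<Rightarrow> 'a oriented_point" where
  "deck_involution z = (fst z, \<lambda>c. - snd z c)"

text \<open>The two sheets (\<open>s = 1\<close> and \<open>s = -1\<close>) over an open set inside a chart domain form a basis of
  the topology, and the sheets over the chart domains, with the lifted coordinates, form the
  lifted atlas.\<close>

definition sheet ::
  "'a topology \<Rightarrow> 'a chart set \<Rightarrow> 'a chart \<Rightarrow> real \<Rightarrow> 'a set \<Rightarrow> 'a oriented_point set" where
  "sheet X A c s V = {z \<in> double_cover X A. cover_proj z \<in> V \<and> snd z c = s}"

definition cover_topology :: "'a topology \<Rightarrow> 'a chart set \<Rightarrow> 'a oriented_point topology" where
  "cover_topology X A =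
     topology_generated_by
       {sheet X A c s V | c s V. c \<in> A \<and> s \<in> {-1, 1} \<and> openin X V \<and> V \<subseteq> chart_dom c}"

definition cover_atlas :: "'a topology \<Rightarrow> 'a chart set \<Rightarrow> 'a oriented_point chart set" where
  "cover_atlas X A =
     {(sheet X A c s (chart_dom c), coord c \<circ> cover_proj) | c s. c \<in> A \<and> s \<in> {-1, 1}}"

text \<open>The lift \<open>(p, \<omega>) \<mapsto> (F p, F\<^sub>* \<omega>)\<close> of a diffeomorphism \<open>F\<close>.\<close>

definition push_orientation ::
  "'a chart set \<Rightarrow> ('a \<Rightarrow> 'a) \<Rightarrow> 'a \<Rightarrow> ('a chart \<Rightarrow> real) \<Rightarrow> 'a chart \<Rightarrow> real" where
  "push_orientation A F p \<omega> =
     (\<lambda>c'. if c' \<in> A \<and> F p \<in> chart_dom c'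
           then THE s. \<forall>c\<in>A. p \<in> chart_dom c \<longrightarrow> s = sgn (det (chart_jacobian c c' F p)) * \<omega> c
           else 0)"

definition cover_lift ::
  "'a chart set \<Rightarrow> ('a \<Rightarrow> 'a) \<Rightarrow> 'a oriented_point \<Rightarrow> 'a oriented_point" where
  "cover_lift A F z = (F (fst z), push_orientation A F (fst z) (snd z))"

section \<open>Vorticity 2-forms as 2-currents\<close>

text \<open>Smooth compactly supported functions.\<close>

definition test_functions :: "'a topology \<Rightarrow> 'a chart set \<Rightarrow> ('a \<Rightarrow> real) set" where
  "test_functions X A =
     {f. (\<forall>c\<in>A. smooth_on (coord c ` chart_dom c) (f \<circ> chart_inv c)) \<and>
         compactin X (X closure_of {p \<in> topspace X. f p \<noteq> 0})}"

text \<open>An (untwisted) 2-form on a non-orientable surface \<open>M\<close> cannot be integrated against functions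
  on \<open>M\<close>, but against twisted functions, i.e. functions on the orientation double cover that are odd
  under the deck involution: at each point the local orientation needed to integrate the 2-form
  and the sign of the twisted function change together. So a 2-current on \<open>M\<close> acts on the odd test
  functions of the double cover.\<close>

definition twisted_test_functions ::
  "'a topology \<Rightarrow> 'a chart set \<Rightarrow> ('a oriented_point \<Rightarrow> real) set" where
  "twisted_test_functions X A =
     {f \<in> test_functions (cover_topology X A) (cover_atlas X A).
        \<forall>z \<in> double_cover X A. f (deck_involution z) = - f z}"

type_synonym 'a current = "('a oriented_point \<Rightarrow> real) \<Rightarrow> real"

text \<open>Currents are extensional on the test functions, so the product topology restricted to a set
  of currents is the weak-* topology.\<close>

definition weak_topology :: "'a topology \<Rightarrow> 'a chart set \<Rightarrow> 'a current topology" where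
  "weak_topology X A = product_topology (\<lambda>_. euclideanreal) (twisted_test_functions X A)"

text \<open>The 2-form \<open>\<Sum>\<^sub>j \<Gamma>\<^sub>j \<delta>\<^bsub>y\<^sub>j\<^esub>\<close> on the surface, where the delta function 2-form at the point
  \<open>cover_proj (y j)\<close> is normalised by means of the local orientation contained in \<open>y j\<close>.\<close>

definition vortex_current ::
  "'a topology \<Rightarrow> 'a chart set \<Rightarrow> nat \<Rightarrow> (nat \<Rightarrow> real) \<Rightarrow> (nat \<Rightarrow> 'a oriented_point) \<Rightarrow> 'a current"
  where
  "vortex_current X A N \<Gamma> y = (\<lambda>f \<in> twisted_test_functions X A. \<Sum>j<N. \<Gamma> j * f (y j))"

definition delta_two_form :: "'a topology \<Rightarrow> 'a chart set \<Rightarrow> 'a \<Rightarrow> 'a current \<Rightarrow> bool" where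
  "delta_two_form X A p T \<longleftrightarrow>
     (\<exists>z \<in> double_cover X A. \<exists>G. cover_proj z = p \<and> G \<noteq> 0 \<and>
        T = (\<lambda>f \<in> twisted_test_functions X A. G * f z))"

text \<open>Pull-back by a diffeomorphism \<open>F\<close>, characterised by the change of variables formula
  \<open>\<langle>F\<^sup>*T, f\<rangle> = \<langle>T, (F\<^sup>-\<^sup>1)\<^sup>* f\<rangle>\<close>, where a twisted function is pulled back by the lift of \<open>F\<^sup>-\<^sup>1\<close>.\<close>

definition pullback_current ::
  "'a topology \<Rightarrow> 'a chart set \<Rightarrow> ('a \<Rightarrow> 'a) \<Rightarrow> 'a current \<Rightarrow> 'a current" where
  "pullback_current X A F T =
     (\<lambda>f \<in> twisted_test_functions X A. T (f \<circ> cover_lift A (inv_into (topspace X) F)))"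

definition phase_space ::
  "'a topology \<Rightarrow> 'a chart set \<Rightarrow> ('a chart \<Rightarrow> 'a \<Rightarrow> real^2^2) \<Rightarrow> 'a current \<Rightarrow> 'a current set" where
  "phase_space X A g T = {pullback_current X A F T | F. F \<in> SDiff X A g}"

text \<open>Pull-back of a 2-current along the covering projection. The double cover carries its
  tautological orientation, so 2-currents on it act on functions, the delta function 2-form at \<open>z\<close>
  of strength \<open>G\<close> with respect to the area form \<open>\<sigma>\<close> being \<open>f \<mapsto> G f(z)\<close>. The projection turns a
  function \<open>f\<close> on the cover into a twisted function on the surface by summation over the fibres
  with both points counted with their orientation, i.e. into \<open>f - f \<circ> \<tau>\<close>.\<close>

definition pullback_to_cover :: "'a topology \<Rightarrow> 'a chart set \<Rightarrow> 'a current \<Rightarrow> 'a current" where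
  "pullback_to_cover X A T =
     (\<lambda>f \<in> test_functions (cover_topology X A) (cover_atlas X A). T (\<lambda>z. f z - f (deck_involution z)))"

text \<open>\<open>\<Gamma>\<close> are the vortex strengths of \<open>T\<close> at the points \<open>y\<close> of the double cover: the pull-back of \<open>T\<close>
  has strength \<open>\<Gamma> j\<close> at \<open>y j\<close>, strength \<open>- \<Gamma> j\<close> at the other point of the fibre, and no other
  vortices.\<close>

definition vortex_strengths ::
  "'a topology \<Rightarrow> 'a chart set \<Rightarrow> nat \<Rightarrow> 'a current \<Rightarrow> (nat \<Rightarrow> 'a oriented_point) \<Rightarrow>
   (nat \<Rightarrow> real) \<Rightarrow> bool" where
  "vortex_strengths X A N T y \<Gamma> \<longleftrightarrow>
     \<Gamma> \<in> extensional {..<N} \<and>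
     pullback_to_cover X A T =
       (\<lambda>f \<in> test_functions (cover_topology X A) (cover_atlas X A).
          \<Sum>j<N. \<Gamma> j * f (y j) + (- \<Gamma> j) * f (deck_involution (y j)))"

section \<open>The configuration space\<close>

definition very_big_diagonal ::
  "'a topology \<Rightarrow> 'a chart set \<Rightarrow> nat \<Rightarrow> (nat \<Rightarrow> 'a oriented_point) set" where
  "very_big_diagonal X A N =
     {y \<in> {..<N} \<rightarrow>\<^sub>E double_cover X A. \<exists>i<N. \<exists>j<N. i \<noteq> j \<and> cover_proj (y i) = cover_proj (y j)}"

definition configurations ::
  "'a topology \<Rightarrow> 'a chart set \<Rightarrow> nat \<Rightarrow> (nat \<Rightarrow> 'a oriented_point) set" where
  "configurations X A N = ({..<N} \<rightarrow>\<^sub>E double_cover X A) - very_big_diagonal X A N"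

definition configuration_topology ::
  "'a topology \<Rightarrow> 'a chart set \<Rightarrow> nat \<Rightarrow> (nat \<Rightarrow> 'a oriented_point) topology" where
  "configuration_topology X A N =
     subtopology (product_topology (\<lambda>_. cover_topology X A) {..<N}) (configurations X A N)"

text \<open>Two configurations describe the same vortices, with the strengths \<open>\<Gamma>\<close>, if they differ only in
  the numbering of the vortices and in the choice of the point above each vortex, which
  determines the sign of its strength.\<close>

definition same_vortices ::
  "nat \<Rightarrow> (nat \<Rightarrow> real) \<Rightarrow> (nat \<Rightarrow> 'a oriented_point) \<Rightarrow> (nat \<Rightarrow> 'a oriented_point) \<Rightarrow> bool" where
  "same_vortices N \<Gamma> y y' \<longleftrightarrow>
     (\<exists>s. bij_betw s {..<N} {..<N} \<and>
        (\<forall>j<N. (\<Gamma> (s j) = \<Gamma> j \<and> y' (s j) = y j) \<or>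
               (\<Gamma> (s j) = - \<Gamma> j \<and> y' (s j) = deck_involution (y j))))"

text \<open>With fixed strengths \<open>\<Gamma>\<close>, the configurations parametrize the set \<open>\<O>\<close> of 2-currents: each
  configuration \<open>y\<close> determines a current, with strengths \<open>\<Gamma>\<close> at \<open>y\<close>, this map is a topological
  quotient map onto \<open>\<O>\<close>, and it is one-to-one up to the relabelling of identical vortices.\<close>

definition parametrized_by_configurations ::
  "'a topology \<Rightarrow> 'a chart set \<Rightarrow> nat \<Rightarrow> (nat \<Rightarrow> real) \<Rightarrow> 'a current set \<Rightarrow> bool" where
  "parametrized_by_configurations X A N \<Gamma> \<O> \<longleftrightarrow>
     quotient_map (configuration_topology X A N) (subtopology (weak_topology X A) \<O>)
       (vortex_current X A N \<Gamma>) \<and>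
     (\<forall>y \<in> configurations X A N. vortex_strengths X A N (vortex_current X A N \<Gamma> y) y \<Gamma>) \<and>
     (\<forall>y \<in> configurations X A N. \<forall>y' \<in> configurations X A N.
        vortex_current X A N \<Gamma> y = vortex_current X A N \<Gamma> y' \<longleftrightarrow> same_vortices N \<Gamma> y y')"

end

theory Submission
  imports Defs
begin

text \<open>In Darboux coordinates the area density is constant, and a rotation by an angle that depends
  only on the distance to a centre and vanishes far from it preserves the area, is supported in a
  disc and moves a point to any nearby one. Hence, for finitely many fixed points of the orientation
  double cover, the orbits of the group of the lifts of volume-preserving diffeomorphisms that fix
  them are open in the complement of their fibres. As the surface is connected and
  non-orientable, the double cover is connected, and it remains so when finitely many points are
  removed; so the group is transitive on this complement, and, by induction on the number of points,
  on the configurations. The phase space therefore consists of the currents of all configurations.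
  That the parametrization is a quotient map, injective up to relabelling, is seen by testing with
  odd bump functions around the vortices.\<close>

section \<open>Calculus of \<open>C\<^sup>k\<close> maps\<close>

text \<open>Every map used must come with a smooth inverse and with control of its action on
  orientations. Flows would need differential equations; a twist simply has the twist by the
  opposite angle as inverse. Darboux coordinates are likewise taken in the triangular form (u1, H
  u), where injectivity is one-dimensional monotonicity. The local moves have positive Jacobian
  determinant at the moved point, so their lifts stay in its sheet and the orbits are open in the
  double cover, not merely in the surface. Reaching both points of a fibre is then a matter of
  connectedness, and this is where non-orientability enters. Several vortices may have strengths
  that agree up to sign; exchanging them, and passing to the other points of the fibres if the signs
  differ, does not change the current. So the parametrization is a quotient map and in general not a
  homeomorphism, and the weak topology has to recognise vortices without their numbering.\<close>

lemma C_k_on_subset: "C_k_on k S f \<Longrightarrow> T \<subseteq> S \<Longrightarrow> C_k_on k T f"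
  by (induction k arbitrary: f) (auto intro: continuous_on_subset differentiable_on_subset)

text \<open>The derivative in \<open>C_k_on\<close> is taken \<open>at x\<close>, not within S, so
  agreement on S carries over to derivatives only through a neighbourhood of x inside S.\<close>

lemma C_k_on_cong:
  assumes "open S" "\<And>x. x \<in> S \<Longrightarrow> f x = g x"
  shows "C_k_on k S f \<longleftrightarrow> C_k_on k S g"
proof -
  have *: "C_k_on k S g" if "C_k_on k S f" "\<And>x. x \<in> S \<Longrightarrow> f x = g x" for f g :: "'a \<Rightarrow> 'b"
    using that
  proof (induction k arbitrary: f g)
    case 0
    then show ?case by (simp cong: continuous_on_cong)
  next
    case (Suc k)
    have "g differentiable_on S"
      using Suc.prems differentiable_transform_within[of f _ S 1 g] by (auto simp: differentiable_on_def)
    moreover have "frechet_derivative f (at x) v = frechet_derivative g (at x) v" if "x \<in> S" for x v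
    proof -
      have "f differentiable at x"
        using Suc.prems(1) that assms(1) by (auto simp: differentiable_on_eq_differentiable_at)
      from frechet_derivative_transform_within_open[OF this assms(1) that Suc.prems(2)]
      show ?thesis by simp
    qed
    ultimately show ?case
      using Suc.prems(1) Suc.IH[of "\<lambda>x. frechet_derivative f (at x) _" "\<lambda>x. frechet_derivative g (at x) _"]
      by simp
  qed
  show ?thesis
    using *[of f g] *[of g f] assms(2) by auto
qed

text \<open>Hides \<open>frechet_derivative\<close>: by uniqueness of derivatives, the explicit one
  returned by the differentiation rules may be used in the inductions below.\<close>

lemma C_k_on_SucI:
  assumes "open S" "\<And>x. x \<in> S \<Longrightarrow> (f has_derivative f' x) (at x)" "\<And>v. C_k_on k S (\<lambda>x. f' x v)"
  shows "C_k_on (Suc k) S f"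
proof -
  have "C_k_on k S (\<lambda>x. frechet_derivative f (at x) v)" for v
    using C_k_on_cong[OF assms(1), of "\<lambda>x. f' x v" "\<lambda>x. frechet_derivative f (at x) v" k]
      assms(3)[of v] frechet_derivative_at[OF assms(2)] by auto
  moreover have "f differentiable_on S"
    using assms(2) by (meson differentiable_at_imp_differentiable_on differentiableI)
  ultimately show ?thesis by simp
qed

lemma C_k_on_Suc_has_derivative:
  assumes "open S" "C_k_on (Suc k) S f" "x \<in> S"
  shows "(f has_derivative frechet_derivative f (at x)) (at x)"
proof -
  have "f differentiable_on S" using assms(2) by simp
  then show ?thesis
    using assms(1,3) differentiable_on_eq_differentiable_at frechet_derivative_works by blast
qed

lemma C_k_on_Suc_imp:
  assumes "open S" shows "C_k_on (Suc k) S f \<Longrightarrow> C_k_on k S f"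
proof (induction k arbitrary: f)
  case 0
  then show ?case by (simp add: differentiable_imp_continuous_on)
next
  case (Suc k)
  then show ?case by (metis C_k_on.simps(2))
qed

text \<open>Since derivatives at a point do not refer to the set, smoothness can be checked near
  each point. Maps defined by cases on overlapping open sets and maps between surfaces are treated
  this way.\<close>

lemma C_k_on_local:
  assumes "\<And>x. x \<in> S \<Longrightarrow> \<exists>T. open T \<and> x \<in> T \<and> C_k_on k T f"
  shows "C_k_on k S f"
  using assms
proof (induction k arbitrary: f)
  case 0
  then show ?case
    by (metis C_k_on.simps(1) continuous_at_imp_continuous_on continuous_on_eq_continuous_at)
next
  case (Suc k)
  have "f differentiable_on S"
    using Suc.prems by (metis C_k_on.simps(2) at_within_open differentiable_at_imp_differentiable_on
        differentiable_on_def)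
  moreover have "C_k_on k S (\<lambda>x. frechet_derivative f (at x) v)" for v
    using Suc.IH Suc.prems by (metis C_k_on.simps(2))
  ultimately show ?case by simp
qed

lemma C_k_on_const: "C_k_on k S (\<lambda>x. c)"
proof (induction k arbitrary: c)
  case (Suc k)
  then show ?case by simp
qed auto

lemma C_k_on_bounded_linear:
  assumes "open S" "bounded_linear f"
  shows "C_k_on k S f"
proof (cases k)
  case 0
  then show ?thesis using assms by (simp add: linear_continuous_on)
next
  case (Suc n)
  show ?thesis unfolding Suc
    by (rule C_k_on_SucI[OF assms(1), of _ "\<lambda>_. f"])
      (simp_all add: bounded_linear_imp_has_derivative assms(2) C_k_on_const)
qed

lemma C_k_on_add:
  assumes "open S" shows "C_k_on k S f \<Longrightarrow> C_k_on k S g \<Longrightarrow> C_k_on k S (\<lambda>x. f x + g x)"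
proof (induction k arbitrary: f g)
  case 0
  then show ?case by (simp add: continuous_on_add)
next
  case (Suc k)
  show ?case
  proof (rule C_k_on_SucI[OF assms])
    show "((\<lambda>x. f x + g x) has_derivative
        (\<lambda>v. frechet_derivative f (at x) v + frechet_derivative g (at x) v)) (at x)" if "x \<in> S" for x
      by (rule has_derivative_add[OF C_k_on_Suc_has_derivative[OF assms Suc.prems(1) that]
            C_k_on_Suc_has_derivative[OF assms Suc.prems(2) that]])
    show "C_k_on k S (\<lambda>x. frechet_derivative f (at x) v + frechet_derivative g (at x) v)" for v
      by (rule Suc.IH) (use Suc.prems in simp_all)
  qed
qed

text \<open>The product rule yields two terms of the same bilinear shape, so one induction covers
  products, scalar multiples and inner products.\<close>

lemma C_k_on_bilinear:
  assumes "open S" "bounded_bilinear B"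
  shows "C_k_on k S f \<Longrightarrow> C_k_on k S g \<Longrightarrow> C_k_on k S (\<lambda>x. B (f x) (g x))"
proof (induction k arbitrary: f g)
  case 0
  then show ?case using assms by (simp add: bounded_bilinear.continuous_on)
next
  case (Suc k)
  show ?case
  proof (rule C_k_on_SucI[OF assms(1)])
    show "((\<lambda>x. B (f x) (g x)) has_derivative
        (\<lambda>v. B (f x) (frechet_derivative g (at x) v) + B (frechet_derivative f (at x) v) (g x))) (at x)"
      if "x \<in> S" for x
      by (rule bounded_bilinear.FDERIV[OF assms(2) C_k_on_Suc_has_derivative[OF assms(1) Suc.prems(1) that]
            C_k_on_Suc_has_derivative[OF assms(1) Suc.prems(2) that]])
    show "C_k_on k S
        (\<lambda>x. B (f x) (frechet_derivative g (at x) v) + B (frechet_derivative f (at x) v) (g x))" for v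
    proof (rule C_k_on_add[OF assms(1) Suc.IH Suc.IH])
      show "C_k_on k S f" "C_k_on k S g"
        using Suc.prems C_k_on_Suc_imp[OF assms(1)] by blast+
    qed (use Suc.prems in simp_all)
  qed
qed

lemmas C_k_on_scaleR = C_k_on_bilinear[OF _ bounded_bilinear_scaleR]
  and C_k_on_mult = C_k_on_bilinear[OF _ bounded_bilinear_mult]
  and C_k_on_inner = C_k_on_bilinear[OF _ bounded_bilinear_inner]

lemma C_k_on_sum:
  assumes "open S" "finite I" "\<And>i. i \<in> I \<Longrightarrow> C_k_on k S (f i)"
  shows "C_k_on k S (\<lambda>x. \<Sum>i\<in>I. f i x)"
  using assms(2,3) by (induction I rule: finite_induct) (simp_all add: C_k_on_const C_k_on_add[OF assms(1)])

lemma C_k_on_compose: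
  fixes f :: "'a::real_normed_vector \<Rightarrow> 'b::euclidean_space"
  assumes "open S" "open T"
  shows "C_k_on k S f \<Longrightarrow> C_k_on k T g \<Longrightarrow> f ` S \<subseteq> T \<Longrightarrow> C_k_on k S (\<lambda>x. g (f x))"
proof (induction k arbitrary: f g)
  case 0
  then show ?case by (auto intro: continuous_on_compose2)
next
  case (Suc k)
  let ?f' = "\<lambda>x. frechet_derivative f (at x)" and ?g' = "\<lambda>x. frechet_derivative g (at x)"
  have g': "(g has_derivative ?g' y) (at y)" if "y \<in> T" for y
    using C_k_on_Suc_has_derivative[OF assms(2) Suc.prems(2) that] .
  show ?case
  proof (rule C_k_on_SucI[OF assms(1)])
    show "((\<lambda>x. g (f x)) has_derivative (\<lambda>v. ?g' (f x) (?f' x v))) (at x)" if "x \<in> S" for x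
    proof -
      have "f x \<in> T" using Suc.prems(3) that by blast
      from has_derivative_compose[OF C_k_on_Suc_has_derivative[OF assms(1) Suc.prems(1) that] g'[OF this]]
      show ?thesis .
    qed
    show "C_k_on k S (\<lambda>x. ?g' (f x) (?f' x v))" for v
    proof -
      \<comment> \<open>In the chain rule the direction of differentiation of \<open>g\<close>
        varies with \<open>x\<close>, whereas \<open>C_k_on\<close> controls derivatives in fixed
        directions only. Expanding in the basis separates the two; hence the Euclidean type of the
        intermediate space.\<close>
      have "?g' (f x) (?f' x v) = (\<Sum>b\<in>Basis. (?f' x v \<bullet> b) *\<^sub>R ?g' (f x) b)" if "x \<in> S" for x
      proof -
        interpret bounded_linear "?g' (f x)"
          using g' that Suc.prems(3) has_derivative_bounded_linear by blast
        show ?thesis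
          by (subst euclidean_representation[of "?f' x v", symmetric]) (simp only: sum scale)
      qed
      moreover have "C_k_on k S (\<lambda>x. \<Sum>b\<in>Basis. (?f' x v \<bullet> b) *\<^sub>R ?g' (f x) b)"
      proof (rule C_k_on_sum[OF assms(1) finite_Basis], rule C_k_on_scaleR[OF assms(1)])
        fix b :: 'b
        show "C_k_on k S (\<lambda>x. ?f' x v \<bullet> b)"
          by (rule C_k_on_inner[OF assms(1) _ C_k_on_const]) (use Suc.prems in simp)
        show "C_k_on k S (\<lambda>x. ?g' (f x) b)"
          by (rule Suc.IH[OF C_k_on_Suc_imp[OF assms(1) Suc.prems(1)] _ Suc.prems(3)]) (use Suc.prems in simp)
      qed
      ultimately show ?thesis
        by (subst C_k_on_cong[OF assms(1)]) auto
    qed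
  qed
qed

section \<open>Closure properties of smooth maps\<close>

lemma smooth_on_subset: "smooth_on S f \<Longrightarrow> T \<subseteq> S \<Longrightarrow> smooth_on T f"
  unfolding smooth_on_def using C_k_on_subset by blast

lemma smooth_on_cong:
  "open S \<Longrightarrow> (\<And>x. x \<in> S \<Longrightarrow> f x = g x) \<Longrightarrow> smooth_on S f \<longleftrightarrow> smooth_on S g"
  unfolding smooth_on_def using C_k_on_cong[of S f g] by simp

lemma smooth_on_const: "smooth_on S (\<lambda>x. c)"
  unfolding smooth_on_def using C_k_on_const by blast

lemma smooth_on_bounded_linear: "open S \<Longrightarrow> bounded_linear f \<Longrightarrow> smooth_on S f"
  unfolding smooth_on_def using C_k_on_bounded_linear by blast

lemma smooth_on_add: "open S \<Longrightarrow> smooth_on S f \<Longrightarrow> smooth_on S g \<Longrightarrow> smooth_on S (\<lambda>x. f x + g x)"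
  unfolding smooth_on_def using C_k_on_add[of S _ f g] by simp

lemma smooth_on_bilinear:
  "open S \<Longrightarrow> bounded_bilinear B \<Longrightarrow> smooth_on S f \<Longrightarrow> smooth_on S g \<Longrightarrow> smooth_on S (\<lambda>x. B (f x) (g x))"
  unfolding smooth_on_def using C_k_on_bilinear[of S B _ f g] by simp

lemma smooth_on_local:
  assumes "\<And>x. x \<in> S \<Longrightarrow> \<exists>T. open T \<and> x \<in> T \<and> smooth_on T f"
  shows "smooth_on S f"
  using assms unfolding smooth_on_def by (metis C_k_on_local)

lemma smooth_on_compose:
  fixes f :: "'a::real_normed_vector \<Rightarrow> 'b::euclidean_space"
  assumes "open S" "open T" "smooth_on S f" "smooth_on T g" "f ` S \<subseteq> T"
  shows "smooth_on S (\<lambda>x. g (f x))"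
  using assms C_k_on_compose unfolding smooth_on_def by blast

lemma smooth_on_id: "open S \<Longrightarrow> smooth_on S (\<lambda>x. x)"
  by (simp add: smooth_on_bounded_linear bounded_linear_ident)

lemma smooth_on_bounded_linear_compose:
  fixes f :: "'a::real_normed_vector \<Rightarrow> 'b::euclidean_space"
  assumes "open S" "bounded_linear h" "smooth_on S f"
  shows "smooth_on S (\<lambda>x. h (f x))"
  using smooth_on_compose[OF assms(1) open_UNIV assms(3), of h] smooth_on_bounded_linear[of UNIV h] assms(2)
  by auto

lemmas smooth_on_mult = smooth_on_bilinear[OF _ bounded_bilinear_mult]
  and smooth_on_scaleR = smooth_on_bilinear[OF _ bounded_bilinear_scaleR]
  and smooth_on_inner = smooth_on_bilinear[OF _ bounded_bilinear_inner]

lemma smooth_on_minus: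
  assumes "open S" "smooth_on S f" shows "smooth_on S (\<lambda>x. - f x)"
  using smooth_on_scaleR[OF assms(1) smooth_on_const[of S "-1"] assms(2)] by simp

lemma smooth_on_diff:
  assumes "open S" "smooth_on S f" "smooth_on S g" shows "smooth_on S (\<lambda>x. f x - g x)"
  using smooth_on_add[OF assms(1,2) smooth_on_minus[OF assms(1,3)]] by simp

lemma smooth_on_imp_continuous_on: "smooth_on S f \<Longrightarrow> continuous_on S f"
  unfolding smooth_on_def using C_k_on.simps(1) by blast

lemma smooth_on_has_derivative:
  "open S \<Longrightarrow> smooth_on S f \<Longrightarrow> x \<in> S \<Longrightarrow> (f has_derivative frechet_derivative f (at x)) (at x)"
  unfolding smooth_on_def using C_k_on_Suc_has_derivative by blast

lemma smooth_on_frechet_derivative: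
  "smooth_on S f \<Longrightarrow> smooth_on S (\<lambda>x. frechet_derivative f (at x) v)"
  unfolding smooth_on_def by (metis C_k_on.simps(2))

lemma smooth_on_vec_nth:
  fixes f :: "'a::real_normed_vector \<Rightarrow> 'b::euclidean_space^'n"
  assumes "open S" "smooth_on S f" shows "smooth_on S (\<lambda>x. f x $ i)"
  by (rule smooth_on_bounded_linear_compose[OF assms(1) bounded_linear_vec_nth assms(2)])

lemma smooth_on_vector2:
  fixes f g :: "'a::real_normed_vector \<Rightarrow> real"
  assumes "open S" "smooth_on S f" "smooth_on S g"
  shows "smooth_on S (\<lambda>x. vector [f x, g x] :: real^2)"
proof -
  have "(\<lambda>x. vector [f x, g x] :: real^2) = (\<lambda>x. f x *\<^sub>R axis 1 1 + g x *\<^sub>R axis 2 1)"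
    by (auto simp: vec_eq_iff forall_2 axis_def)
  then show ?thesis
    using assms by (auto intro!: smooth_on_add smooth_on_scaleR smooth_on_const)
qed

section \<open>Smoothness of elementary real functions\<close>

lemma C_k_on_real_SucI:
  fixes f :: "real \<Rightarrow> real"
  assumes "open S" "\<And>x. x \<in> S \<Longrightarrow> (f has_real_derivative f' x) (at x)" "C_k_on k S f'"
  shows "C_k_on (Suc k) S f"
  by (rule C_k_on_SucI[OF assms(1), of f "\<lambda>x. (*) (f' x)"])
    (use assms in \<open>auto intro: C_k_on_mult C_k_on_const simp: has_field_derivative_def\<close>)

text \<open>The derivative of the reciprocal is minus its square, so each order of differentiability
  yields the next.\<close>

lemma smooth_on_inverse: "smooth_on (- {0}) (inverse :: real \<Rightarrow> real)"
proof -
  have "C_k_on k (- {0}) (inverse :: real \<Rightarrow> real)" for k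
  proof (induction k)
    case 0
    then show ?case by (auto intro: continuous_intros)
  next
    case (Suc k)
    show ?case
    proof (rule C_k_on_real_SucI)
      show "C_k_on k (- {0}) (\<lambda>x::real. -1 * (inverse x * inverse x))"
        by (intro C_k_on_mult C_k_on_const Suc) auto
    qed (auto intro!: derivative_eq_intros)
  qed
  then show ?thesis by (simp add: smooth_on_def)
qed

text \<open>Each function is up to sign the derivative of the other, hence the simultaneous
  induction.\<close>

lemma smooth_on_sin: "smooth_on UNIV (sin :: real \<Rightarrow> real)"
  and smooth_on_cos: "smooth_on UNIV (cos :: real \<Rightarrow> real)"
proof -
  have "C_k_on k UNIV (sin :: real \<Rightarrow> real) \<and> C_k_on k UNIV (cos :: real \<Rightarrow> real)" for k
  proof (induction k)
    case 0
    then show ?case by (auto intro: continuous_intros)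
  next
    case (Suc k)
    have "C_k_on k UNIV (\<lambda>x::real. -1 * sin x)"
      using Suc by (intro C_k_on_mult C_k_on_const) auto
    then show ?case
      using Suc C_k_on_real_SucI[of UNIV sin cos k] C_k_on_real_SucI[of UNIV cos "\<lambda>x. -1 * sin x" k]
      by (auto simp del: C_k_on.simps(2) intro!: derivative_eq_intros)
  qed
  then show "smooth_on UNIV (sin :: real \<Rightarrow> real)" "smooth_on UNIV (cos :: real \<Rightarrow> real)"
    by (simp_all add: smooth_on_def)
qed

lemma smooth_on_sqrt: "smooth_on {0<..} sqrt"
proof -
  have "C_k_on k {0<..} sqrt" for k
  proof (induction k)
    case 0
    then show ?case by (auto intro: continuous_intros)
  next
    case (Suc k)
    have "C_k_on k {0<..} (\<lambda>x. inverse (sqrt x))"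
      using C_k_on_compose[of "{0<..}" "- {0}" k sqrt inverse] Suc smooth_on_inverse
      by (force simp: smooth_on_def)
    then have "C_k_on k {0<..} (\<lambda>x. inverse (sqrt x) * (1 / 2))"
      by (intro C_k_on_mult C_k_on_const) auto
    then show ?case
      by (rule C_k_on_real_SucI[rotated 2]) (auto intro!: DERIV_real_sqrt[THEN DERIV_cong])
  qed
  then show ?thesis by (simp add: smooth_on_def)
qed

lemma smooth_on_inverse_compose:
  fixes f :: "'a::real_normed_vector \<Rightarrow> real"
  assumes "open S" "smooth_on S f" "\<And>x. x \<in> S \<Longrightarrow> f x \<noteq> 0"
  shows "smooth_on S (\<lambda>x. inverse (f x))"
  by (rule smooth_on_compose[OF assms(1) _ assms(2) smooth_on_inverse]) (use assms(3) in auto)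

lemma smooth_on_real_compose:
  fixes f :: "'a::real_normed_vector \<Rightarrow> real"
  assumes "open S" "smooth_on S f" "smooth_on UNIV h"
  shows "smooth_on S (\<lambda>x. h (f x))"
  using smooth_on_compose[OF assms(1) open_UNIV assms(2,3)] by auto

section \<open>Differentiation under the integral sign\<close>

lemma has_derivative_parametric_integral:
  fixes F :: "'a::euclidean_space \<times> real \<Rightarrow> real"
  assumes "open U" "open W" "{0..1} \<subseteq> W" "C_k_on (Suc 0) (U \<times> W) F" "u \<in> U"
  shows "((\<lambda>u. integral {0..1} (\<lambda>s. F (u, s))) has_derivative
    (\<lambda>v. integral {0..1} (\<lambda>s. frechet_derivative F (at (u, s)) (v, 0)))) (at u)"
proof -
  let ?F' = "\<lambda>z. frechet_derivative F (at z)"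
  have op: "open (U \<times> W)"
    using assms by (simp add: open_Times)
  note F' = C_k_on_Suc_has_derivative[OF op assms(4)]
  have cont: "continuous_on (U \<times> W) (\<lambda>z. ?F' z v)" for v
    using assms(4) unfolding C_k_on.simps by blast
  \<comment> \<open>Leibniz's rule asks for the partial derivative as a continuous map into the
    bounded linear functions. As the parameter space is Euclidean, its continuity can be checked on
    basis vectors. The open set W around the interval makes F differentiable at the end points as
    well.\<close>
  define D :: "'a \<Rightarrow> real \<Rightarrow> 'a \<Rightarrow>\<^sub>L real" where "D u s = Blinfun (\<lambda>v. ?F' (u, s) (v, 0))" for u s
  have D: "blinfun_apply (D u s) = (\<lambda>v. ?F' (u, s) (v, 0))" if "(u, s) \<in> U \<times> W" for u s
    unfolding D_def
    by (rule bounded_linear_Blinfun_apply,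
        rule bounded_linear_compose[OF has_derivative_bounded_linear[OF F'[OF that]]])
      (intro bounded_linear_Pair bounded_linear_ident bounded_linear_zero)
  have contD: "continuous_on (U \<times> {0..1}) (\<lambda>(u, s). D u s)"
  proof (rule continuous_on_blinfun_componentwise)
    fix i :: 'a assume "i \<in> Basis"
    have "continuous_on (U \<times> {0..1}) (\<lambda>z. ?F' z (i, 0))"
      using cont by (rule continuous_on_subset) (use assms in auto)
    then show "continuous_on (U \<times> {0..1}) (\<lambda>z. blinfun_apply (case z of (u, s) \<Rightarrow> D u s) i)"
      by (rule continuous_on_eq) (use D assms in auto)
  qed
  have contF: "continuous_on (U \<times> W) F"
    using F' by (meson continuous_at_imp_continuous_on has_derivative_continuous)
  have intF: "(\<lambda>s. F (u, s)) integrable_on {0..1}" if "u \<in> U" for u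
    by (rule integrable_continuous_interval, rule continuous_on_compose2[OF contF])
      (use that assms in \<open>auto intro!: continuous_intros\<close>)
  have contDs: "continuous_on {0..1} (D u)"
  proof -
    have "continuous_on {0..1} (\<lambda>s. (u, s))" by (intro continuous_intros)
    from continuous_on_compose2[OF contD this] show ?thesis using assms(5) by auto
  qed
  obtain e where e: "e > 0" "ball u e \<subseteq> U"
    using assms(1,5) open_contains_ball by blast
  have der: "((\<lambda>u. integral (cbox 0 1) (\<lambda>s. F (u, s))) has_derivative
      blinfun_apply (integral (cbox 0 1) (D u))) (at u within ball u e)"
  proof (rule leibniz_rule)
    fix x :: 'a and t :: real assume x: "x \<in> ball u e" and t: "t \<in> cbox 0 1"
    have xt: "(x, t) \<in> U \<times> W" using x t e assms(3) by auto
    have "((\<lambda>x. (x, t)) has_derivative (\<lambda>v. (v, 0))) (at x within ball u e)"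
      by (auto intro!: derivative_eq_intros)
    from has_derivative_compose[OF this F'[OF xt]]
    show "((\<lambda>x. F (x, t)) has_derivative blinfun_apply (D x t)) (at x within ball u e)"
      using D[OF xt] by simp
  next
    show "(\<lambda>s. F (x, s)) integrable_on cbox 0 1" if "x \<in> ball u e" for x
      using intF that e by auto
    show "continuous_on (ball u e \<times> cbox 0 1) (\<lambda>(x, t). D x t)"
      by (rule continuous_on_subset[OF contD]) (use e in auto)
  qed (use e in auto)
  have "blinfun_apply (integral {0..1} (D u)) v = integral {0..1} (\<lambda>s. ?F' (u, s) (v, 0))" for v
  proof -
    have "blinfun_apply (integral {0..1} (D u)) v = integral {0..1} (\<lambda>s. blinfun_apply (D u s) v)"
      using integral_linear[OF integrable_continuous_interval[OF contDs],
          of "\<lambda>f. blinfun_apply f v"] by (simp add: o_def blinfun.bounded_linear_left)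
    also have "\<dots> = integral {0..1} (\<lambda>s. ?F' (u, s) (v, 0))"
      by (rule integral_cong) (use D assms in auto)
    finally show ?thesis .
  qed
  then have "blinfun_apply (integral {0..1} (D u)) = (\<lambda>v. integral {0..1} (\<lambda>s. ?F' (u, s) (v, 0)))"
    by auto
  then show ?thesis
    using der e by (simp add: cbox_interval at_within_open[of u "ball u e"])
qed

text \<open>The derivative of a parametric integral is the parametric integral of a partial
  derivative, so the induction has to generalise over the integrand.\<close>

lemma C_k_on_parametric_integral:
  fixes F :: "'a::euclidean_space \<times> real \<Rightarrow> real"
  assumes "open U" "open W" "{0..1} \<subseteq> W"
  shows "C_k_on k (U \<times> W) F \<Longrightarrow> C_k_on k U (\<lambda>u. integral {0..1} (\<lambda>s. F (u, s)))"
proof (induction k arbitrary: F)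
  case 0
  have "continuous_on (U \<times> {0..1}) F"
    using 0 assms(3) continuous_on_subset[of "U \<times> W" F "U \<times> {0..1}"] by auto
  then have "continuous_on (U \<times> cbox 0 1) (\<lambda>(u, s). F (u, s))"
    by (simp add: cbox_interval)
  from integral_continuous_on_param[OF this]
  show ?case by (simp add: cbox_interval)
next
  case (Suc k)
  have op: "open (U \<times> W)"
    using assms by (simp add: open_Times)
  have c1: "C_k_on (Suc 0) (U \<times> W) F"
    using Suc.prems by (induction k) (simp, metis C_k_on_Suc_imp[OF op])
  show ?case
  proof (rule C_k_on_SucI[OF assms(1) has_derivative_parametric_integral[OF assms c1]])
    show "C_k_on k U (\<lambda>u. integral {0..1} (\<lambda>s. frechet_derivative F (at (u, s)) (v, 0)))" for v
      using Suc.prems unfolding C_k_on.simps by (intro Suc.IH) blast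
  qed
qed

lemma smooth_on_parametric_integral:
  fixes F :: "'a::euclidean_space \<times> real \<Rightarrow> real"
  assumes "open U" "open W" "{0..1} \<subseteq> W" "smooth_on (U \<times> W) F"
  shows "smooth_on U (\<lambda>u. integral {0..1} (\<lambda>s. F (u, s)))"
  using assms C_k_on_parametric_integral unfolding smooth_on_def by blast

text \<open>Bootstrapping: if the derivative of \<open>f\<close> is a smooth function of the value
  of \<open>f\<close>, then order k for \<open>f\<close> gives order k for its derivative. The
  derivative of an inverse map has exactly this form.\<close>

lemma smooth_on_autonomous:
  fixes f :: "'a::real_normed_vector \<Rightarrow> 'b::euclidean_space"
  assumes "open S" "open T" "f ` S \<subseteq> T"
    and der: "\<And>x. x \<in> S \<Longrightarrow> (f has_derivative (\<lambda>v. G v (f x))) (at x)"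
    and G: "\<And>v. smooth_on T (G v)"
  shows "smooth_on S f"
proof -
  have "C_k_on k S f" for k
  proof (induction k)
    case 0
    then show ?case
      using der by (auto intro!: continuous_at_imp_continuous_on dest: has_derivative_continuous)
  next
    case (Suc k)
    have "C_k_on k S (\<lambda>x. G v (f x))" for v
      by (rule C_k_on_compose[OF assms(1,2) Suc _ assms(3)]) (use G in \<open>simp add: smooth_on_def\<close>)
    show ?case
      by (rule C_k_on_SucI[OF assms(1) der \<open>\<And>v. C_k_on k S (\<lambda>x. G v (f x))\<close>])
  qed
  then show ?thesis by (simp add: smooth_on_def)
qed

section \<open>Local area-preserving maps of the plane\<close>

text \<open>The powers of \<open>inverse t\<close> make this family of flat functions closed under
  differentiation: the derivative of member n is a linear combination of members n + 1 and n +
  2.\<close>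

definition exp_inverse :: "nat \<Rightarrow> real \<Rightarrow> real" where
  "exp_inverse n t = (if t \<le> 0 then 0 else exp (- inverse t) * inverse t ^ n)"

lemma exp_inverse_tendsto_0: "(exp_inverse n \<longlongrightarrow> 0) (at 0)"
proof (subst filterlim_at_split, intro conjI)
  show "(exp_inverse n \<longlongrightarrow> 0) (at_left 0)"
    by (rule tendsto_eventually) (auto simp: exp_inverse_def eventually_at_left_field intro: exI[of _ "-1"])
  have "((\<lambda>t. inverse t ^ n / exp (inverse t)) \<longlongrightarrow> (0::real)) (at_right 0)"
    using filterlim_compose[OF tendsto_power_div_exp_0 filterlim_inverse_at_top_right] .
  then show "(exp_inverse n \<longlongrightarrow> 0) (at_right 0)"
    by (rule Lim_transform_eventually)
      (auto simp: exp_inverse_def eventually_at_right_field exp_minus field_simps intro: exI[of _ 1])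
qed

lemma exp_inverse_has_derivative:
  "(exp_inverse n has_real_derivative exp_inverse (n + 2) t + - real n * exp_inverse (n + 1) t) (at t)"
proof -
  consider "t < 0" | "t > 0" | "t = 0" by linarith
  then show ?thesis
  proof cases
    case 1
    have "((\<lambda>_. 0) has_real_derivative 0) (at t)" by simp
    from DERIV_cong[OF has_field_derivative_transform_within_open[OF this, of "{..<0}" "exp_inverse n"]]
    show ?thesis using 1 by (auto simp: exp_inverse_def)
  next
    case 2
    have "((\<lambda>t. exp (- inverse t) * inverse t ^ n) has_real_derivative
        exp_inverse (n + 2) t + - real n * exp_inverse (n + 1) t) (at t)"
    proof (cases n)
      case 0
      then show ?thesis using 2
        by (auto simp: exp_inverse_def power2_eq_square intro!: derivative_eq_intros)
    next
      case (Suc m)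
      have i: "(inverse has_real_derivative - (inverse t * inverse t)) (at t)"
        using 2 by (auto intro!: derivative_eq_intros)
      then have "((\<lambda>t. exp (- inverse t)) has_real_derivative exp (- inverse t) * (inverse t * inverse t)) (at t)"
        using 2 by (auto intro!: derivative_eq_intros)
      from DERIV_mult[OF this DERIV_power_Suc[OF i, of m]]
      show ?thesis unfolding Suc
        by (rule DERIV_cong) (use 2 in \<open>simp add: exp_inverse_def algebra_simps\<close>)
    qed
    from has_field_derivative_transform_within_open[OF this, of "{0<..}" "exp_inverse n"]
    show ?thesis using 2 by (auto simp: exp_inverse_def)
  next
    case 3
    \<comment> \<open>Away from 0 the difference quotient at 0 is the next member of the family, and
      this tends to 0.\<close>
    have "((\<lambda>y. (exp_inverse n y - exp_inverse n 0) / (y - 0)) \<longlongrightarrow> 0) (at 0)"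
      by (rule Lim_transform_eventually[OF exp_inverse_tendsto_0[of "n + 1"]])
        (auto simp: exp_inverse_def field_simps eventually_at_filter)
    then show ?thesis
      unfolding 3 has_field_derivative_iff by (simp add: exp_inverse_def)
  qed
qed

lemma smooth_on_exp_inverse: "smooth_on UNIV (exp_inverse n)"
proof -
  have "C_k_on k UNIV (exp_inverse n)" for k
  proof (induction k arbitrary: n)
    case 0
    show ?case
      using DERIV_isCont[OF exp_inverse_has_derivative] by (auto intro!: continuous_at_imp_continuous_on)
  next
    case (Suc k)
    show ?case
      by (rule C_k_on_real_SucI[OF open_UNIV exp_inverse_has_derivative])
        (intro C_k_on_add C_k_on_mult C_k_on_const Suc open_UNIV)
  qed
  then show ?thesis by (simp add: smooth_on_def)
qed

text \<open>The usual quotient of flat functions, descending from 1 to 0 between 1 and 2. It is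
  applied to squared distances, which are smooth at the centre too.\<close>

definition plateau :: "real \<Rightarrow> real" where
  "plateau t = exp_inverse 0 (2 - t) * inverse (exp_inverse 0 (2 - t) + exp_inverse 0 (t - 1))"

lemma plateau_eq_1: "t \<le> 1 \<Longrightarrow> plateau t = 1"
  and plateau_eq_0: "2 \<le> t \<Longrightarrow> plateau t = 0"
  by (auto simp: plateau_def exp_inverse_def)

lemma smooth_on_plateau: "smooth_on UNIV plateau"
proof -
  have lin: "smooth_on UNIV (\<lambda>t. 2 - t :: real)" "smooth_on UNIV (\<lambda>t. t - 1 :: real)"
    by (intro smooth_on_diff smooth_on_const smooth_on_id open_UNIV)+
  \<comment> \<open>For every t one of 2 - t and t - 1 is positive, so the denominator never
    vanishes.\<close>
  have *: "exp_inverse 0 (2 - t) + exp_inverse 0 (t - 1) \<noteq> 0" for t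
  proof -
    have "exp_inverse 0 t \<ge> 0" "t > 0 \<Longrightarrow> exp_inverse 0 t > 0" for t
      by (auto simp: exp_inverse_def)
    then show ?thesis
      by (cases "t < 2") (smt (verit))+
  qed
  show ?thesis
    unfolding plateau_def
    by (intro smooth_on_mult smooth_on_inverse_compose smooth_on_add open_UNIV * 
        smooth_on_real_compose[OF open_UNIV lin(1) smooth_on_exp_inverse]
        smooth_on_real_compose[OF open_UNIV lin(2) smooth_on_exp_inverse])
qed

section \<open>Area-preserving twists of the plane\<close>

lemma has_derivative_vector2:
  fixes f1 f2 :: "'a::real_normed_vector \<Rightarrow> real"
  assumes "(f1 has_derivative f1') (at u)" "(f2 has_derivative f2') (at u)"
  shows "((\<lambda>u. vector [f1 u, f2 u] :: real^2) has_derivative (\<lambda>v. vector [f1' v, f2' v])) (at u)"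
proof -
  have *: "(\<lambda>x. vector [f x, g x] :: real^2) = (\<lambda>x. f x *\<^sub>R axis 1 1 + g x *\<^sub>R axis 2 1)"
    for f g :: "'a \<Rightarrow> real"
    by (auto simp: vec_eq_iff forall_2 axis_def)
  show ?thesis
    unfolding * by (intro derivative_intros assms)
qed

lemma det_jacobian_vector2:
  fixes f1 f2 :: "real^2 \<Rightarrow> real"
  assumes "(f1 has_derivative (\<lambda>v. a * v$1 + b * v$2)) (at u)"
    and "(f2 has_derivative (\<lambda>v. c * v$1 + d * v$2)) (at u)"
  shows "det (jacobian (\<lambda>u. vector [f1 u, f2 u] :: real^2) (at u)) = a * d - b * c"
proof -
  have "frechet_derivative (\<lambda>u. vector [f1 u, f2 u] :: real^2) (at u) =
      (\<lambda>v. vector [a * v$1 + b * v$2, c * v$1 + d * v$2])"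
    using frechet_derivative_at[OF has_derivative_vector2[OF assms]] by simp
  then show ?thesis
    by (simp add: jacobian_def det_2 matrix_def axis_def)
qed

text \<open>A rotation about \<open>m\<close> which is rigid of angle \<open>\<sigma>\<close> up to
  distance d and trivial where the squared distance is at least twice the square of d. Cartesian
  coordinates avoid the singularity of polar ones at the centre.\<close>

definition twist :: "real \<Rightarrow> real \<Rightarrow> real^2 \<Rightarrow> real^2 \<Rightarrow> real^2" where
  "twist \<sigma> d m u =
    (let x = u$1 - m$1; y = u$2 - m$2; \<theta> = \<sigma> * plateau ((x\<^sup>2 + y\<^sup>2) / d\<^sup>2)
     in vector [m$1 + x * cos \<theta> - y * sin \<theta>, m$2 + x * sin \<theta> + y * cos \<theta>])"

lemma norm_real2: "(norm (u :: real^2))\<^sup>2 = (u$1)\<^sup>2 + (u$2)\<^sup>2"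
  by (simp add: norm_vec_def L2_set_def UNIV_2)

lemma rotation_norm: "(x * cos t - y * sin t)\<^sup>2 + (x * sin t + y * cos t)\<^sup>2 = x\<^sup>2 + (y::real)\<^sup>2"
proof -
  have "(x * cos t - y * sin t)\<^sup>2 + (x * sin t + y * cos t)\<^sup>2 = (x\<^sup>2 + y\<^sup>2) * ((sin t)\<^sup>2 + (cos t)\<^sup>2)"
    by algebra
  then show ?thesis by simp
qed

lemma norm_twist: "norm (twist \<sigma> d m u - m) = norm (u - m)"
proof -
  have "(norm (twist \<sigma> d m u - m))\<^sup>2 = (norm (u - m))\<^sup>2"
    unfolding norm_real2 twist_def Let_def using rotation_norm[of "u$1 - m$1" _ "u$2 - m$2"] by simp
  then show ?thesis by (simp add: power2_eq_iff_nonneg)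
qed

text \<open>The twist preserves the distance to the centre, hence the angle of rotation at the image
  point is the same and the opposite twist undoes it.\<close>

lemma twist_inverse: "twist (- \<sigma>) d m (twist \<sigma> d m u) = u"
proof -
  let ?x = "u$1 - m$1" and ?y = "u$2 - m$2"
  define t where "t = \<sigma> * plateau ((?x\<^sup>2 + ?y\<^sup>2) / d\<^sup>2)"
  have tw: "twist \<sigma> d m u $ 1 - m$1 = ?x * cos t - ?y * sin t"
    "twist \<sigma> d m u $ 2 - m$2 = ?x * sin t + ?y * cos t"
    by (simp_all add: twist_def Let_def t_def)
  have 1: "(?x * cos t - ?y * sin t) * cos t + (?x * sin t + ?y * cos t) * sin t = ?x"
    and 2: "(?x * sin t + ?y * cos t) * cos t - (?x * cos t - ?y * sin t) * sin t = ?y"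
    using sin_cos_squared_add[of t] by algebra+
  have "twist (- \<sigma>) d m (twist \<sigma> d m u) = vector [m$1 + ?x, m$2 + ?y]"
    unfolding twist_def[of "- \<sigma>"] Let_def tw rotation_norm
    using 1 2 by (simp add: t_def[symmetric] vec_eq_iff forall_2 algebra_simps)
  then show ?thesis by (simp add: vec_eq_iff forall_2)
qed

lemma twist_outside:
  assumes "2 * d\<^sup>2 \<le> (norm (u - m))\<^sup>2" "d \<noteq> 0"
  shows "twist \<sigma> d m u = u"
proof -
  have "plateau (((u$1 - m$1)\<^sup>2 + (u$2 - m$2)\<^sup>2) / d\<^sup>2) = 0"
    using assms by (intro plateau_eq_0) (simp add: norm_real2 field_simps)
  then show ?thesis by (simp add: twist_def vec_eq_iff forall_2)
qed

text \<open>The half turn is the reflection in the centre; it exchanges any two nearby points that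
  have the centre as midpoint. This is how a prescribed point is reached.\<close>

lemma twist_pi_inside:
  assumes "norm (u - m) \<le> d" "d \<noteq> 0"
  shows "twist pi d m u = 2 *\<^sub>R m - u"
proof -
  have "(norm (u - m))\<^sup>2 \<le> d\<^sup>2" using assms(1) by (simp add: power_mono)
  then have "plateau (((u$1 - m$1)\<^sup>2 + (u$2 - m$2)\<^sup>2) / d\<^sup>2) = 1"
    using assms by (intro plateau_eq_1) (simp add: norm_real2 field_simps)
  then show ?thesis by (simp add: twist_def vec_eq_iff forall_2)
qed

lemma smooth_on_component: "open S \<Longrightarrow> smooth_on S (\<lambda>u :: real^'n. u $ i)"
  by (intro smooth_on_bounded_linear bounded_linear_vec_nth)

lemma smooth_on_twist: "smooth_on UNIV (twist \<sigma> d m)"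
proof -
  have c: "smooth_on UNIV (\<lambda>u :: real^2. u $ i - m $ i)" for i
    by (intro smooth_on_diff smooth_on_component smooth_on_const open_UNIV)
  have "smooth_on UNIV (\<lambda>u :: real^2. ((u$1 - m$1) * (u$1 - m$1) + (u$2 - m$2) * (u$2 - m$2)) * inverse (d\<^sup>2))"
    by (intro smooth_on_mult smooth_on_add smooth_on_const c open_UNIV)
  from smooth_on_real_compose[OF open_UNIV this smooth_on_plateau]
  have "smooth_on UNIV (\<lambda>u :: real^2. \<sigma> * plateau (((u$1 - m$1)\<^sup>2 + (u$2 - m$2)\<^sup>2) / d\<^sup>2))"
    by (intro smooth_on_mult smooth_on_const open_UNIV) (simp add: power2_eq_square divide_inverse)
  note sc = smooth_on_real_compose[OF open_UNIV this smooth_on_sin]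
    smooth_on_real_compose[OF open_UNIV this smooth_on_cos]
  show ?thesis
    unfolding twist_def Let_def
    by (intro smooth_on_vector2 smooth_on_add smooth_on_diff smooth_on_mult smooth_on_const
        smooth_on_component sc open_UNIV)
qed

text \<open>In polar coordinates the twist is a shear of the angle by a function of the radius. The
  computation is Cartesian in order to include the centre.\<close>

lemma det_jacobian_twist: "det (jacobian (twist \<sigma> d m) (at u)) = 1"
proof -
  let ?x = "\<lambda>u :: real^2. u$1 - m$1" and ?y = "\<lambda>u :: real^2. u$2 - m$2"
  define t where "t = (\<lambda>u. \<sigma> * plateau (((?x u)\<^sup>2 + (?y u)\<^sup>2) / d\<^sup>2))"
  \<comment> \<open>(R1, R2) is the rotated vector and, below, k is the factor with dt = k (x dx + y
    dy). The terms with the square of k cancel directly, those linear in k because rotating (R1, R2)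
    back gives (x, y).\<close>
  define R1 where "R1 = ?x u * cos (t u) - ?y u * sin (t u)"
  define R2 where "R2 = ?x u * sin (t u) + ?y u * cos (t u)"
  obtain p where p: "(plateau has_real_derivative p) (at (((?x u)\<^sup>2 + (?y u)\<^sup>2) / d\<^sup>2))"
    using smooth_on_has_derivative[OF open_UNIV smooth_on_plateau UNIV_I]
      has_derivative_imp_has_field_derivative has_real_derivative by blast
  define k where "k = \<sigma> * p * 2 / d\<^sup>2"
  have dc: "((\<lambda>u. u $ i - m $ i) has_derivative (\<lambda>v. v $ i)) (at u)" for i
    by (auto intro!: derivative_eq_intros bounded_linear_imp_has_derivative bounded_linear_vec_nth)
  have "((\<lambda>u. (?x u)\<^sup>2 + (?y u)\<^sup>2) has_derivative (\<lambda>v. 2 * ?x u * v$1 + 2 * ?y u * v$2)) (at u)"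
    by (rule dc derivative_eq_intros refl)+ (auto simp: algebra_simps)
  from has_derivative_compose[OF bounded_linear.has_derivative[OF bounded_linear_divide this] p[unfolded has_field_derivative_def]]
  have "((\<lambda>u. plateau (((?x u)\<^sup>2 + (?y u)\<^sup>2) / d\<^sup>2)) has_derivative
      (\<lambda>v. p * ((2 * ?x u * v$1 + 2 * ?y u * v$2) / d\<^sup>2))) (at u)" .
  from has_derivative_mult_right[OF this, of \<sigma>]
  have dt: "(t has_derivative (\<lambda>v. k * (?x u * v$1 + ?y u * v$2))) (at u)"
    unfolding t_def k_def by (simp add: field_simps)
  have d1: "((\<lambda>u. m$1 + ?x u * cos (t u) - ?y u * sin (t u)) has_derivative
      (\<lambda>v. (cos (t u) - k * ?x u * R2) * v$1 + (- sin (t u) - k * ?y u * R2) * v$2)) (at u)"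
    by (rule dc dt derivative_eq_intros refl)+ (auto simp: R2_def algebra_simps)
  have d2: "((\<lambda>u. m$2 + ?x u * sin (t u) + ?y u * cos (t u)) has_derivative
      (\<lambda>v. (sin (t u) + k * ?x u * R1) * v$1 + (cos (t u) + k * ?y u * R1) * v$2)) (at u)"
    by (rule dc dt derivative_eq_intros refl)+ (auto simp: R1_def algebra_simps)
  have "twist \<sigma> d m = (\<lambda>u. vector [m$1 + ?x u * cos (t u) - ?y u * sin (t u),
      m$2 + ?x u * sin (t u) + ?y u * cos (t u)])"
    by (simp add: fun_eq_iff twist_def t_def Let_def)
  then have "det (jacobian (twist \<sigma> d m) (at u)) =
      (cos (t u) - k * ?x u * R2) * (cos (t u) + k * ?y u * R1) -
      (- sin (t u) - k * ?y u * R2) * (sin (t u) + k * ?x u * R1)"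
    using det_jacobian_vector2[OF d1 d2] by simp
  also have "\<dots> = 1"
    using sin_cos_squared_add[of "t u"] unfolding R1_def R2_def by algebra
  finally show ?thesis .
qed

section \<open>Darboux coordinates in the plane\<close>

lemma vector2_eta: "vector [u$1, u$2] = (u :: 'a::zero^2)"
  by (simp add: vec_eq_iff forall_2)

lemma has_derivative_vec2_lambda:
  fixes f' :: "real^2 \<Rightarrow> real"
  assumes "(f has_derivative f') (at u)"
  shows "f' v = f' (axis 1 1) * v$1 + f' (axis 2 1) * v$2"
proof -
  interpret bounded_linear f' by (rule has_derivative_bounded_linear[OF assms])
  have "v = v$1 *\<^sub>R axis 1 1 + v$2 *\<^sub>R axis 2 1"
    by (simp add: vec_eq_iff forall_2 axis_def)
  then have "f' v = f' (v$1 *\<^sub>R axis 1 1 + v$2 *\<^sub>R axis 2 1)" by simp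
  then show ?thesis by (simp add: add scale algebra_simps)
qed

text \<open>A primitive \<open>H\<close> of \<open>\<rho>\<close> in the second coordinate makes \<open>(u\<^sub>1, u\<^sub>2) \<mapsto> (u\<^sub>1, H u)\<close> a map with
  Jacobian determinant \<open>\<rho>\<close>, i.e. Darboux coordinates for the area form with density \<open>\<rho>\<close>. The
  integral runs over a fixed interval, so that \<open>H\<close> can be differentiated under the integral sign.\<close>

lemma smooth_primitive:
  fixes \<rho> :: "real^2 \<Rightarrow> real"
  assumes "open S" "smooth_on S \<rho>" "u0 \<in> S"
  obtains r H where "r > 0" "{u. \<bar>u$1 - u0$1\<bar> < r \<and> \<bar>u$2 - u0$2\<bar> < r} \<subseteq> S"
    and "smooth_on {u. \<bar>u$1 - u0$1\<bar> < r \<and> \<bar>u$2 - u0$2\<bar> < r} H"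
    and "\<And>u. \<bar>u$1 - u0$1\<bar> < r \<Longrightarrow> \<bar>u$2 - u0$2\<bar> < r \<Longrightarrow> frechet_derivative H (at u) (axis 2 1) = \<rho> u"
proof -
  obtain e where e: "e > 0" "ball u0 e \<subseteq> S"
    using assms(1,3) open_contains_ball by blast
  \<comment> \<open>For \<open>s\<close> of modulus at most 2 the point \<open>Z (u, s)\<close> has
    distance less than r + 2 * r from u0, hence less than e.\<close>
  define r where "r = e / 4"
  define B where "B = {u :: real^2. \<bar>u$1 - u0$1\<bar> < r \<and> \<bar>u$2 - u0$2\<bar> < r}"
  define W where "W = {-1<..<2::real}"
  \<comment> \<open>As s runs from 0 to 1, Z runs along the vertical segment from height
    \<open>u0$2\<close> to \<open>u\<close>. After this substitution
    \<open>(u$2 - u0$2) * K u\<close> is the integral of \<open>\<rho>\<close> along the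
    segment.\<close>
  define Z where "Z = (\<lambda>z :: (real^2) \<times> real. vector [fst z $ 1, u0$2 + snd z * (fst z $ 2 - u0$2)] :: real^2)"
  have opB: "open B"
    unfolding B_def by (intro open_Collect_conj open_Collect_less continuous_intros)
  have opW: "open W" "{0..1} \<subseteq> W"
    by (auto simp: W_def)
  have opBW: "open (B \<times> W)"
    using opB opW by (simp add: open_Times)
  have ZS: "Z z \<in> S" if "z \<in> B \<times> W" for z
  proof -
    obtain u s where z: "z = (u, s)" by (cases z)
    have "\<bar>u$1 - u0$1\<bar> < r" "\<bar>u$2 - u0$2\<bar> < r" "\<bar>s\<bar> \<le> 2"
      using that by (auto simp: z B_def W_def)
    moreover from this have "\<bar>s\<bar> * \<bar>u$2 - u0$2\<bar> \<le> 2 * r"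
      by (intro mult_mono) auto
    moreover have "norm (Z z - u0) \<le> \<bar>u$1 - u0$1\<bar> + \<bar>s\<bar> * \<bar>u$2 - u0$2\<bar>"
      using norm_le_l1_cart[of "Z z - u0"] by (simp add: Z_def z sum_2 abs_mult)
    ultimately have "norm (Z z - u0) < e"
      using e(1) by (simp add: r_def)
    then show ?thesis
      using e by (auto simp: dist_norm norm_minus_commute)
  qed
  have c: "smooth_on (B \<times> W) (\<lambda>z. fst z $ i)" for i
    by (intro smooth_on_bounded_linear opBW bounded_linear_compose[OF bounded_linear_vec_nth] bounded_linear_fst)
  have "smooth_on (B \<times> W) snd"
    by (intro smooth_on_bounded_linear opBW bounded_linear_snd)
  then have smZ: "smooth_on (B \<times> W) Z"
    unfolding Z_def by (intro smooth_on_vector2 smooth_on_add smooth_on_mult smooth_on_diff c smooth_on_const opBW)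
  define F where "F = (\<lambda>z. \<rho> (Z z))"
  have smF: "smooth_on (B \<times> W) F"
    unfolding F_def by (rule smooth_on_compose[OF opBW assms(1) smZ assms(2)]) (use ZS in auto)
  define K where "K = (\<lambda>u. integral {0..1} (\<lambda>s. F (u, s)))"
  have smK: "smooth_on B K"
    unfolding K_def by (rule smooth_on_parametric_integral[OF opB opW smF])
  define H where "H = (\<lambda>u. (u$2 - u0$2) * K u)"
  have smH: "smooth_on B H"
    unfolding H_def by (intro smooth_on_mult smooth_on_diff smooth_on_component smooth_on_const opB smK)
  have "frechet_derivative H (at u) (axis 2 1) = \<rho> u" if u: "u \<in> B" for u
  proof -
    let ?b = "u$2 - u0$2"
    define \<rho>' where "\<rho>' = (\<lambda>s. frechet_derivative \<rho> (at (Z (u, s))) (axis 2 1))"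
    have d\<rho>: "(\<rho> has_derivative frechet_derivative \<rho> (at (Z (u, s)))) (at (Z (u, s)))" if "s \<in> W" for s
      by (rule smooth_on_has_derivative[OF assms(1,2) ZS]) (use u that in auto)
    have lin: "frechet_derivative \<rho> (at (Z (u, s))) (vector [0, c]) = c * \<rho>' s" if "s \<in> W" for s c
      by (subst has_derivative_vec2_lambda[OF d\<rho>[OF that]]) (simp add: \<rho>'_def)
    have dF1: "frechet_derivative F (at (u, s)) (axis 2 1, 0) = s * \<rho>' s" if s: "s \<in> W" for s
    proof -
      have "(Z has_derivative (\<lambda>v. vector [fst v $ 1, s * fst v $ 2 + snd v * ?b])) (at (u, s))"
        unfolding Z_def
        by (rule has_derivative_vector2; (rule derivative_eq_intros bounded_linear_imp_has_derivative
              bounded_linear_compose[OF bounded_linear_vec_nth] bounded_linear_fst bounded_linear_snd refl)+)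
          (auto simp: algebra_simps)
      from has_derivative_compose[OF this d\<rho>[OF s]]
      have "frechet_derivative F (at (u, s)) =
          (\<lambda>v. frechet_derivative \<rho> (at (Z (u, s))) (vector [fst v $ 1, s * fst v $ 2 + snd v * ?b]))"
        unfolding F_def by (rule frechet_derivative_at[symmetric])
      then show ?thesis using lin[OF s] by (simp add: axis_def)
    qed
    have dF2: "((\<lambda>s. F (u, s)) has_real_derivative ?b * \<rho>' s) (at s)" if s: "s \<in> W" for s
    proof -
      have "((\<lambda>s. Z (u, s)) has_derivative (\<lambda>v. vector [0, v * ?b])) (at s)"
        unfolding Z_def by (rule has_derivative_vector2) (auto intro!: derivative_eq_intros)
      from has_derivative_compose[OF this d\<rho>[OF s]]
      have "((\<lambda>s. F (u, s)) has_derivative (\<lambda>v. v * ?b * \<rho>' s)) (at s)"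
        unfolding F_def using lin[OF s] by simp
      moreover have "(\<lambda>v. v * ?b * \<rho>' s) = (*) (?b * \<rho>' s)" by auto
      ultimately show ?thesis by (simp add: has_field_derivative_def)
    qed
    have contF: "continuous_on {0..1} (\<lambda>s. F (u, s))"
      using dF2 opW by (auto intro!: continuous_at_imp_continuous_on DERIV_isCont)
    have K': "(K has_derivative (\<lambda>v. integral {0..1} (\<lambda>s. frechet_derivative F (at (u, s)) (v, 0)))) (at u)"
      unfolding K_def by (rule has_derivative_parametric_integral[OF opB opW _ u])
        (use smF in \<open>unfold smooth_on_def, blast\<close>)
    have "((\<lambda>u. u$2 - u0$2) has_derivative (\<lambda>v. v$2)) (at u)"
      by (auto intro!: derivative_eq_intros bounded_linear_imp_has_derivative bounded_linear_vec_nth)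
    from has_derivative_mult[OF this K']
    have "(H has_derivative (\<lambda>v. ?b * integral {0..1} (\<lambda>s. frechet_derivative F (at (u, s)) (v, 0))
        + v$2 * K u)) (at u)"
      unfolding H_def .
    then have "frechet_derivative H (at u) (axis 2 1) =
        ?b * integral {0..1} (\<lambda>s. frechet_derivative F (at (u, s)) (axis 2 1, 0)) + K u"
      by (simp add: frechet_derivative_at[symmetric])
    also have "integral {0..1} (\<lambda>s. frechet_derivative F (at (u, s)) (axis 2 1, 0)) = integral {0..1} (\<lambda>s. s * \<rho>' s)"
      by (rule integral_cong) (use dF1 opW in auto)
    also have "?b * integral {0..1} (\<lambda>s. s * \<rho>' s) + K u = F (u, 1)"
    proof -
      \<comment> \<open>The integrand is the derivative of \<open>s * F (u, s)\<close> in s, so this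
        is an integration by parts; it turns the product rule for H into the boundary value at s =
        1.\<close>
      have "((\<lambda>s. F (u, s) + s * (?b * \<rho>' s)) has_integral (1 * F (u, 1) - 0 * F (u, 0))) {0..1}"
        by (rule fundamental_theorem_of_calculus)
          (use opW in \<open>auto intro!: derivative_eq_intros dF2[THEN DERIV_subset]
            simp: has_real_derivative_iff_has_vector_derivative[symmetric]\<close>)
      then have "((\<lambda>s. F (u, s) + s * (?b * \<rho>' s)) has_integral F (u, 1)) {0..1}" by simp
      moreover have "((\<lambda>s. F (u, s)) has_integral K u) {0..1}"
        unfolding K_def by (rule integrable_integral[OF integrable_continuous_interval[OF contF]])
      ultimately have "((\<lambda>s. F (u, s) + s * (?b * \<rho>' s) - F (u, s)) has_integral (F (u, 1) - K u)) {0..1}"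
        by (rule has_integral_diff)
      moreover have "(\<lambda>s. F (u, s) + s * (?b * \<rho>' s) - F (u, s)) = (\<lambda>s. ?b * (s * \<rho>' s))"
        by (simp add: fun_eq_iff mult_ac)
      ultimately have "integral {0..1} (\<lambda>s. ?b * (s * \<rho>' s)) = F (u, 1) - K u"
        by (simp only: integral_unique)
      then show ?thesis by simp
    qed
    also have "F (u, 1) = \<rho> u"
      by (simp add: F_def Z_def vector2_eta)
    finally show ?thesis .
  qed
  moreover have "B \<subseteq> S"
    using ZS[of "(_, 1)"] by (auto simp: W_def Z_def vector2_eta)
  moreover have "r > 0" using e by (simp add: r_def)
  ultimately show ?thesis
    using that[of r H] smH by (auto simp: B_def)
qed

text \<open>Since \<open>\<rho>\<close> is positive, H increases strictly along vertical segments,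
  and \<open>(u$1, H u)\<close> is injective on the whole square. Invariance of domain gives the
  open image, \<open>smooth_on_autonomous\<close> the smooth inverse.\<close>

lemma darboux_coordinates:
  fixes \<rho> :: "real^2 \<Rightarrow> real"
  assumes "open S" "smooth_on S \<rho>" "u0 \<in> S" and pos: "\<And>u. u \<in> S \<Longrightarrow> \<rho> u > 0"
  obtains B \<Phi> \<Psi> where "open B" "u0 \<in> B" "B \<subseteq> S" "open (\<Phi> ` B)"
    and "smooth_on B \<Phi>" "smooth_on (\<Phi> ` B) \<Psi>" "\<And>u. u \<in> B \<Longrightarrow> \<Psi> (\<Phi> u) = u"
    and "\<And>u. u \<in> B \<Longrightarrow> det (jacobian \<Phi> (at u)) = \<rho> u"
proof -
  obtain r H where r: "r > 0" "{u. \<bar>u$1 - u0$1\<bar> < r \<and> \<bar>u$2 - u0$2\<bar> < r} \<subseteq> S"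
    and smH: "smooth_on {u. \<bar>u$1 - u0$1\<bar> < r \<and> \<bar>u$2 - u0$2\<bar> < r} H"
    and H2: "\<And>u. \<bar>u$1 - u0$1\<bar> < r \<Longrightarrow> \<bar>u$2 - u0$2\<bar> < r \<Longrightarrow> frechet_derivative H (at u) (axis 2 1) = \<rho> u"
    by (rule smooth_primitive[OF assms(1-3)]) blast
  define B where "B = {u :: real^2. \<bar>u$1 - u0$1\<bar> < r \<and> \<bar>u$2 - u0$2\<bar> < r}"
  note smH = smH[folded B_def] and BS = r(2)[folded B_def]
  have opB: "open B"
    unfolding B_def by (intro open_Collect_conj open_Collect_less continuous_intros)
  define p where "p = (\<lambda>u. frechet_derivative H (at u) (axis 1 1))"
  have dH: "(H has_derivative (\<lambda>v. p u * v$1 + \<rho> u * v$2)) (at u)" if u: "u \<in> B" for u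
  proof -
    note d = smooth_on_has_derivative[OF opB smH u]
    have "frechet_derivative H (at u) = (\<lambda>v. p u * v$1 + \<rho> u * v$2)"
    proof
      fix v
      have "frechet_derivative H (at u) (axis 2 1) = \<rho> u" using H2 u by (simp add: B_def)
      then show "frechet_derivative H (at u) v = p u * v$1 + \<rho> u * v$2"
        by (subst has_derivative_vec2_lambda[OF d]) (simp add: p_def)
    qed
    then show ?thesis using d by simp
  qed
  define \<Phi> where "\<Phi> = (\<lambda>u. vector [u$1, H u] :: real^2)"
  have smPhi: "smooth_on B \<Phi>"
    unfolding \<Phi>_def by (intro smooth_on_vector2 smooth_on_component smH opB)
  \<comment> \<open>The square B contains the vertical segment between any two of its points with
    equal first coordinate, so the mean value argument stays inside B.\<close>
  have less: "H u < H w" if "u \<in> B" "w \<in> B" "u$1 = w$1" "u$2 < w$2" for u w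
  proof -
    have "\<exists>y. ((\<lambda>t. H (vector [u$1, t])) has_real_derivative y) (at t) \<and> y > 0"
      if "u$2 \<le> t" "t \<le> w$2" for t
    proof -
      have t: "vector [u$1, t] \<in> B"
        using \<open>u \<in> B\<close> \<open>w \<in> B\<close> that by (auto simp: B_def)
      have "((\<lambda>t. vector [u$1, t] :: real^2) has_derivative (\<lambda>v. vector [0, v])) (at t)"
        by (rule has_derivative_vector2) (auto intro!: derivative_eq_intros)
      from has_derivative_compose[OF this dH[OF t]]
      have "((\<lambda>t. H (vector [u$1, t])) has_real_derivative \<rho> (vector [u$1, t])) (at t)"
        by (simp add: has_field_derivative_def)
      then show ?thesis using pos t BS by blast
    qed
    from DERIV_pos_imp_increasing[OF that(4) this]
    show ?thesis using that(3) by (metis vector2_eta)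
  qed
  have inj: "inj_on \<Phi> B"
  proof (rule inj_onI)
    fix u w assume *: "u \<in> B" "w \<in> B" "\<Phi> u = \<Phi> w"
    then have eq: "u$1 = w$1" "H u = H w"
      by (auto simp: \<Phi>_def vec_eq_iff forall_2)
    then have "u$2 = w$2"
      using less[of u w] less[of w u] * by (metis less_irrefl linorder_less_linear)
    then show "u = w" using eq by (simp add: vec_eq_iff forall_2)
  qed
  note contPhi = smooth_on_imp_continuous_on[OF smPhi]
  have opT: "open (\<Phi> ` B)"
    by (rule invariance_of_domain[OF contPhi opB inj])
  define \<Psi> where "\<Psi> = inv_into B \<Phi>"
  have Psi: "\<Psi> (\<Phi> u) = u" if "u \<in> B" for u
    using inj that by (simp add: \<Psi>_def)
  have contPsi: "continuous_on (\<Phi> ` B) \<Psi>"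
    by (rule continuous_on_inverse_open[OF opB contPhi _ Psi]) simp_all
  \<comment> \<open>\<open>G v u\<close> is the inverse of the triangular derivative of
    \<open>\<Phi>\<close> at \<open>u\<close>, applied to v. Hence the derivative of
    \<open>\<Psi>\<close> at y depends on y through \<open>\<Psi> y\<close> alone.\<close>
  define G :: "real^2 \<Rightarrow> real^2 \<Rightarrow> real^2"
    where "G = (\<lambda>v u. vector [v$1, (v$2 - p u * v$1) * inverse (\<rho> u)])"
  have \<rho>0: "\<rho> u \<noteq> 0" if "u \<in> B" for u
    using pos[of u] BS that by auto
  have "smooth_on (\<Phi> ` B) \<Psi>"
  proof (rule smooth_on_autonomous[OF opT opB])
    show "\<Psi> ` \<Phi> ` B \<subseteq> B" using Psi by auto
    show "smooth_on B (G v)" for v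
      unfolding G_def p_def
      by (intro smooth_on_vector2 smooth_on_mult smooth_on_diff smooth_on_const opB
          smooth_on_frechet_derivative smH smooth_on_inverse_compose smooth_on_subset[OF assms(2) BS] \<rho>0)
    fix y assume y: "y \<in> \<Phi> ` B"
    then obtain u where u: "u \<in> B" "y = \<Phi> u" by auto
    have dPhi: "(\<Phi> has_derivative (\<lambda>v. vector [v$1, p u * v$1 + \<rho> u * v$2])) (at u)"
      unfolding \<Phi>_def
      by (intro has_derivative_vector2 dH u bounded_linear_imp_has_derivative bounded_linear_vec_nth)
    show "(\<Psi> has_derivative (\<lambda>v. G v (\<Psi> y))) (at y)"
    proof (rule has_derivative_inverse_basic)
      show "(\<Phi> has_derivative (\<lambda>v. vector [v$1, p u * v$1 + \<rho> u * v$2])) (at (\<Psi> y))"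
        using dPhi u Psi by simp
      have "(\<lambda>v. G v u) = (\<lambda>v. v$1 *\<^sub>R G (axis 1 1) u + v$2 *\<^sub>R G (axis 2 1) u)"
        by (simp add: G_def fun_eq_iff vec_eq_iff forall_2 algebra_simps axis_def)
      moreover have "bounded_linear (\<lambda>v. v$1 *\<^sub>R G (axis 1 1) u + v$2 *\<^sub>R G (axis 2 1) u)"
        by (intro bounded_linear_add bounded_linear_scaleR_const bounded_linear_vec_nth)
      ultimately show "bounded_linear (\<lambda>v. G v (\<Psi> y))" using u Psi by simp
      show "(\<lambda>v. G v (\<Psi> y)) \<circ> (\<lambda>v. vector [v$1, p u * v$1 + \<rho> u * v$2]) = id"
        unfolding u(2) Psi[OF u(1)] using \<rho>0[OF u(1)] by (simp add: G_def fun_eq_iff vec_eq_iff forall_2)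
      show "continuous (at y) \<Psi>"
        using contPsi opT y continuous_on_eq_continuous_at by blast
      show "open (\<Phi> ` B)" "y \<in> \<Phi> ` B" by fact+
      show "\<Phi> (\<Psi> z) = z" if "z \<in> \<Phi> ` B" for z
        using that Psi by auto
    qed
  qed
  moreover have "det (jacobian \<Phi> (at u)) = \<rho> u" if "u \<in> B" for u
    using det_jacobian_vector2[of "\<lambda>u. u$1" 1 0 u H, OF _ dH[OF that]]
    unfolding \<Phi>_def by (simp add: bounded_linear_imp_has_derivative bounded_linear_vec_nth)
  moreover have "u0 \<in> B" using r by (simp add: B_def)
  ultimately show ?thesis
    using that[OF opB _ BS opT smPhi _ Psi] by blast
qed

lemma jacobian_compose:
  fixes f :: "real^'m \<Rightarrow> real^'n" and g :: "real^'n \<Rightarrow> real^'k"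
  assumes "f differentiable at u" "g differentiable at (f u)"
  shows "jacobian (\<lambda>u. g (f u)) (at u) = jacobian g (at (f u)) ** jacobian f (at u)"
proof -
  have "(\<lambda>u. g (f u)) = g \<circ> f" by auto
  then have "frechet_derivative (\<lambda>u. g (f u)) (at u) = frechet_derivative g (at (f u)) \<circ> frechet_derivative f (at u)"
    using frechet_derivative_compose[OF assms] by simp
  then show ?thesis
    using assms by (simp add: jacobian_def matrix_compose frechet_derivative_works has_derivative_linear)
qed

text \<open>\<open>frechet_derivative\<close> is a choice among the derivatives at the point, and
  locally equal maps have the same ones; this covers non-differentiable maps too.\<close>

lemma jacobian_cong:
  assumes "open S" "u \<in> S" "\<And>w. w \<in> S \<Longrightarrow> f w = g w"
  shows "jacobian f (at u) = jacobian g (at u)"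
proof -
  have "(f has_derivative D) (at u) \<longleftrightarrow> (g has_derivative D) (at u)" for D
    using has_derivative_transform_within_open[of f D u UNIV S g]
      has_derivative_transform_within_open[of g D u UNIV S f] assms by auto
  then show ?thesis by (simp add: jacobian_def frechet_derivative_def)
qed

lemma jacobian_ident: "jacobian (\<lambda>u. u) (at u) = mat 1"
  by (simp add: jacobian_def matrix_id_mat_1[unfolded id_def])

lemma smooth_on_differentiable: "open S \<Longrightarrow> smooth_on S f \<Longrightarrow> x \<in> S \<Longrightarrow> f differentiable at x"
  using smooth_on_has_derivative differentiableI by blast

text \<open>A half-turn twist is conjugated by Darboux coordinates. As these have Jacobian
  determinant \<open>\<rho>\<close>, a map of determinant 1 in them preserves the area of density
  \<open>\<rho>\<close>. The compact support K permits extension by the identity.\<close>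

lemma local_area_preserving_move:
  fixes \<rho> :: "real^2 \<Rightarrow> real"
  assumes "open S" "smooth_on S \<rho>" "u0 \<in> S" and pos: "\<And>u. u \<in> S \<Longrightarrow> \<rho> u > 0"
  obtains V where "open V" "u0 \<in> V" "V \<subseteq> S"
    "\<And>w. w \<in> V \<Longrightarrow> \<exists>P Q K. compact K \<and> K \<subseteq> S \<and> smooth_on UNIV P \<and> smooth_on UNIV Q \<and>
       (\<forall>u. Q (P u) = u) \<and> (\<forall>u. P (Q u) = u) \<and> (\<forall>u. u \<notin> K \<longrightarrow> P u = u) \<and> P u0 = w \<and>
       (\<forall>u\<in>S. \<rho> (P u) * det (jacobian P (at u)) = \<rho> u)"
proof -
  obtain B \<Phi> \<Psi> where B: "open B" "u0 \<in> B" "B \<subseteq> S" "open (\<Phi> ` B)"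
    and sm: "smooth_on B \<Phi>" "smooth_on (\<Phi> ` B) \<Psi>" and Psi: "\<And>u. u \<in> B \<Longrightarrow> \<Psi> (\<Phi> u) = u"
    and det: "\<And>u. u \<in> B \<Longrightarrow> det (jacobian \<Phi> (at u)) = \<rho> u"
    using darboux_coordinates[OF assms] by metis
  obtain e where e: "e > 0" "ball (\<Phi> u0) e \<subseteq> \<Phi> ` B"
    using B open_contains_ball by blast
  \<comment> \<open>The centre of the twist will lie within d of \<open>\<Phi> u0\<close>, so its
    disc of radius 2 * d stays within 3 * d, below e.\<close>
  define d where "d = e / 4"
  have d: "d > 0" using e by (simp add: d_def)
  define V where "V = B \<inter> \<Phi> -` ball (\<Phi> u0) d"
  have "open V"
    unfolding V_def using smooth_on_imp_continuous_on[OF sm(1)] B(1)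
    by (metis Int_commute continuous_on_open_vimage open_ball)
  moreover have "u0 \<in> V" using B d by (simp add: V_def)
  moreover have "V \<subseteq> S" using B by (auto simp: V_def)
  moreover have "\<exists>P Q K. compact K \<and> K \<subseteq> S \<and> smooth_on UNIV P \<and> smooth_on UNIV Q \<and>
       (\<forall>u. Q (P u) = u) \<and> (\<forall>u. P (Q u) = u) \<and> (\<forall>u. u \<notin> K \<longrightarrow> P u = u) \<and> P u0 = w \<and>
       (\<forall>u\<in>S. \<rho> (P u) * det (jacobian P (at u)) = \<rho> u)" if w: "w \<in> V" for w
  proof -
    \<comment> \<open>With the midpoint as centre, the half turn takes the image of u0 to that of
      w.\<close>
    define m where "m = (1/2) *\<^sub>R (\<Phi> u0 + \<Phi> w)"
    have dist: "norm (\<Phi> u0 - \<Phi> w) < d" and wB: "w \<in> B"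
      using w by (auto simp: V_def dist_norm)
    have "\<Phi> u0 - m = (1/2) *\<^sub>R (\<Phi> u0 - \<Phi> w)"
      by (simp add: m_def vec_eq_iff field_simps)
    then have m: "norm (\<Phi> u0 - m) < d"
      using dist d by simp
    define C where "C = cball m (2 * d)"
    have C: "C \<subseteq> \<Phi> ` B"
    proof -
      have "C \<subseteq> ball (\<Phi> u0) e"
      proof
        fix z assume "z \<in> C"
        then have "norm (z - m) \<le> 2 * d" by (simp add: C_def dist_norm norm_minus_commute)
        moreover have "norm (z - \<Phi> u0) \<le> norm (z - m) + norm (\<Phi> u0 - m)"
          using norm_triangle_ineq4[of "z - m" "\<Phi> u0 - m"] by simp
        ultimately show "z \<in> ball (\<Phi> u0) e"
          using m d by (simp add: dist_norm norm_minus_commute d_def)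
      qed
      then show ?thesis using e by blast
    qed
    have out: "twist \<sigma> d m z = z" if "z \<notin> C" for z \<sigma>
    proof (rule twist_outside)
      have "(2 * d)\<^sup>2 \<le> (norm (z - m))\<^sup>2"
        using that d by (intro power_mono) (auto simp: C_def dist_norm norm_minus_commute)
      then show "2 * d\<^sup>2 \<le> (norm (z - m))\<^sup>2"
        by (simp add: power2_eq_square) (smt (verit) zero_le_square)
    qed (use d in simp)
    have inC: "twist \<sigma> d m z \<in> C \<longleftrightarrow> z \<in> C" for z \<sigma>
      using norm_twist[of \<sigma> d m z] by (simp add: C_def dist_norm norm_minus_commute)
    have inB: "twist \<sigma> d m z \<in> \<Phi> ` B" if "z \<in> \<Phi> ` B" for z \<sigma>
      using that C inC[of \<sigma> z] out[of z \<sigma>] by (cases "z \<in> C") auto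
    define K where "K = \<Psi> ` C"
    have K: "compact K" "K \<subseteq> B"
      unfolding K_def using smooth_on_imp_continuous_on[OF sm(2)] C Psi
      by (auto simp: C_def intro!: compact_continuous_image intro: continuous_on_subset)
    define P where "P = (\<lambda>\<sigma> u. if u \<in> B then \<Psi> (twist \<sigma> d m (\<Phi> u)) else u)"
    have PhiP: "P \<sigma> u \<in> B" "\<Phi> (P \<sigma> u) = twist \<sigma> d m (\<Phi> u)" if "u \<in> B" for \<sigma> u
      using inB[of "\<Phi> u" \<sigma>] that Psi by (auto simp: P_def)
    have Pout: "P \<sigma> u = u" if "u \<notin> K" for \<sigma> u
    proof (cases "u \<in> B")
      case True
      then have "\<Phi> u \<notin> C" using that Psi by (force simp: K_def)
      then show ?thesis using True out Psi by (simp add: P_def)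
    qed (simp add: P_def)
    have inv: "P (- \<sigma>) (P \<sigma> u) = u" for \<sigma> u
    proof (cases "u \<in> B")
      case True
      then show ?thesis
        using PhiP[OF True, of \<sigma>] Psi by (simp add: P_def twist_inverse)
    qed (simp add: P_def)
    \<comment> \<open>B and the complement of K are open and cover the plane. On B the map is a
      composite of smooth maps, off K it is the identity, and the two descriptions overlap.\<close>
    have smP: "smooth_on UNIV (P \<sigma>)" for \<sigma>
    proof (rule smooth_on_local)
      fix u
      show "\<exists>T. open T \<and> u \<in> T \<and> smooth_on T (P \<sigma>)"
      proof (cases "u \<in> B")
        case True
        have "smooth_on B (\<lambda>u. twist \<sigma> d m (\<Phi> u))"
          by (rule smooth_on_compose[OF B(1) open_UNIV sm(1) smooth_on_twist]) simp
        from smooth_on_compose[OF B(1,4) this sm(2)]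
        have "smooth_on B (\<lambda>u. \<Psi> (twist \<sigma> d m (\<Phi> u)))" using inB by blast
        then have "smooth_on B (P \<sigma>)"
          by (subst smooth_on_cong[OF B(1)]) (auto simp: P_def)
        then show ?thesis using B True by blast
      next
        case False
        have "open (- K)" using K by (simp add: compact_imp_closed open_Compl)
        moreover from this have "smooth_on (- K) (P \<sigma>)"
          by (subst smooth_on_cong[of _ _ "\<lambda>u. u"]) (auto simp: Pout smooth_on_id)
        ultimately show ?thesis using K False by blast
      qed
    qed
    have "P pi u0 = w"
    proof -
      have "twist pi d m (\<Phi> u0) = \<Phi> w"
        using m d by (subst twist_pi_inside) (auto simp: m_def scaleR_2)
      then show ?thesis using B(2) Psi[OF wB] by (simp add: P_def)
    qed
    moreover have "\<rho> (P pi u) * det (jacobian (P pi) (at u)) = \<rho> u" if "u \<in> S" for u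
    proof (cases "u \<in> B")
      case True
      have dP: "P pi differentiable at u" "\<Phi> differentiable at u" "\<Phi> differentiable at (P pi u)"
        and dT: "twist pi d m differentiable at (\<Phi> u)"
        using smooth_on_differentiable[OF _ smP] smooth_on_differentiable[OF B(1) sm(1)]
          smooth_on_differentiable[OF _ smooth_on_twist] True PhiP[OF True] by auto
      \<comment> \<open>Differentiating the conjugation equation avoids the derivative of
        \<open>\<Psi>\<close>: taking determinants leaves just the densities at the point and at its
        image.\<close>
      have "jacobian (\<lambda>u. \<Phi> (P pi u)) (at u) = jacobian (\<lambda>u. twist pi d m (\<Phi> u)) (at u)"
        by (rule jacobian_cong[OF B(1) True]) (simp add: PhiP)
      then have "jacobian \<Phi> (at (P pi u)) ** jacobian (P pi) (at u) =
          jacobian (twist pi d m) (at (\<Phi> u)) ** jacobian \<Phi> (at u)"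
        using jacobian_compose[OF dP(1,3)] jacobian_compose[OF dP(2) dT] by simp
      then have "det (jacobian \<Phi> (at (P pi u)) ** jacobian (P pi) (at u)) =
          det (jacobian (twist pi d m) (at (\<Phi> u)) ** jacobian \<Phi> (at u))" by simp
      then show ?thesis
        by (simp add: det_mul det_jacobian_twist det PhiP[OF True] True)
    next
      case False
      have "jacobian (P pi) (at u) = jacobian (\<lambda>u. u) (at u)"
        by (rule jacobian_cong[of "- K"])
          (use K False Pout in \<open>auto simp: compact_imp_closed open_Compl\<close>)
      then show ?thesis using False by (simp add: jacobian_ident P_def)
    qed
    moreover have "P (- pi) (P pi u) = u" "P pi (P (- pi) u) = u" for u
      using inv[of pi u] inv[of "- pi" u] by simp_all
    ultimately show ?thesis
      using K B(3) smP[of pi] smP[of "- pi"] Pout[of _ pi]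
      by (intro exI[of _ "P pi"] exI[of _ "P (- pi)"] exI[of _ K]) auto
  qed
  ultimately show ?thesis using that by blast
qed

section \<open>Smooth maps and functions on surfaces\<close>

lemma smooth_on_transform:
  "smooth_on S f \<Longrightarrow> (\<And>x. x \<in> S \<Longrightarrow> f x = g x) \<Longrightarrow> open S \<Longrightarrow> smooth_on S g"
  using smooth_on_cong[of S f g] by simp

lemma
  assumes "is_chart X c"
  shows chart_dom_open: "openin X (chart_dom c)"
    and coord_image_open: "open (coord c ` chart_dom c)"
    and coord_continuous: "continuous_map (subtopology X (chart_dom c)) euclidean (coord c)"
    and coord_inj: "inj_on (coord c) (chart_dom c)"
proof -
  have h: "homeomorphic_map (subtopology X (chart_dom c)) (top_of_set (coord c ` chart_dom c)) (coord c)"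
    and o: "openin X (chart_dom c)" "open (coord c ` chart_dom c)"
    using assms by (auto simp: is_chart_def)
  show "openin X (chart_dom c)" "open (coord c ` chart_dom c)" by fact+
  have t: "topspace (subtopology X (chart_dom c)) = chart_dom c"
    using openin_subset[OF o(1)] by auto
  show "continuous_map (subtopology X (chart_dom c)) euclidean (coord c)"
    using homeomorphic_imp_continuous_map[OF h] by (rule continuous_map_into_fulltopology)
  show "inj_on (coord c) (chart_dom c)"
    using homeomorphic_imp_injective_map[OF h] t by simp
qed

lemma coord_open_image:
  assumes "is_chart X c" "openin X W" "W \<subseteq> chart_dom c"
  shows "open (coord c ` W)"
proof -
  have h: "homeomorphic_map (subtopology X (chart_dom c)) (top_of_set (coord c ` chart_dom c)) (coord c)"
    using assms by (auto simp: is_chart_def)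
  have "openin (subtopology X (chart_dom c)) W"
    using assms chart_dom_open openin_open_subtopology by blast
  then have "openin (top_of_set (coord c ` chart_dom c)) (coord c ` W)"
    using homeomorphic_imp_open_map[OF h] by (simp add: open_map_def)
  then show ?thesis
    using coord_image_open[OF assms(1)] openin_open_eq by blast
qed

lemma chart_inv_coord: "is_chart X c \<Longrightarrow> p \<in> chart_dom c \<Longrightarrow> chart_inv c (coord c p) = p"
  unfolding chart_inv_def by (rule inv_into_f_f[OF coord_inj])

lemma coord_chart_inv: "u \<in> coord c ` chart_dom c \<Longrightarrow> coord c (chart_inv c u) = u"
  and chart_inv_in_dom: "u \<in> coord c ` chart_dom c \<Longrightarrow> chart_inv c u \<in> chart_dom c"
  unfolding chart_inv_def by (auto simp: f_inv_into_f inv_into_into)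

lemma coord_open_vimage:
  assumes "is_chart X c" "open T"
  shows "openin X {p \<in> chart_dom c. coord c p \<in> T}"
proof -
  have "openin (subtopology X (chart_dom c)) {p \<in> topspace (subtopology X (chart_dom c)). coord c p \<in> T}"
    by (rule openin_continuous_map_preimage[OF coord_continuous]) (use assms in auto)
  then show ?thesis
    using openin_trans_full[OF _ chart_dom_open[OF assms(1)]] openin_subset[OF chart_dom_open[OF assms(1)]]
    by (simp add: Int_absorb1)
qed

lemma chart_inv_image_eq:
  assumes "is_chart X c" "T \<subseteq> coord c ` chart_dom c"
  shows "chart_inv c ` T = {p \<in> chart_dom c. coord c p \<in> T}"
  using assms chart_inv_coord[OF assms(1)] coord_chart_inv[of _ c] chart_inv_in_dom[of _ c]
  by (fastforce simp: image_iff)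

lemma chart_inv_continuous:
  assumes "is_chart X c"
  shows "continuous_map (top_of_set (coord c ` chart_dom c)) X (chart_inv c)"
  unfolding continuous_map_def
proof (intro conjI allI impI)
  show "chart_inv c \<in> topspace (top_of_set (coord c ` chart_dom c)) \<rightarrow> topspace X"
    using chart_inv_in_dom[of _ c] openin_subset[OF chart_dom_open[OF assms]] by auto
  fix U assume "openin X U"
  then have "open (coord c ` (chart_dom c \<inter> U))"
    by (intro coord_open_image[OF assms] openin_Int chart_dom_open[OF assms]) auto
  moreover have "{u \<in> topspace (top_of_set (coord c ` chart_dom c)). chart_inv c u \<in> U} = coord c ` (chart_dom c \<inter> U)"
    by (auto simp: chart_inv_coord[OF assms])
  ultimately show "openin (top_of_set (coord c ` chart_dom c))
      {u \<in> topspace (top_of_set (coord c ` chart_dom c)). chart_inv c u \<in> U}"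
    unfolding openin_open_eq[OF coord_image_open[OF assms]] by auto
qed

lemma chart_inv_compact_image:
  assumes "is_chart X c" "compact K" "K \<subseteq> coord c ` chart_dom c"
  shows "compactin X (chart_inv c ` K)"
  by (rule image_compactin[OF _ chart_inv_continuous[OF assms(1)]])
    (use assms in \<open>simp add: compactin_subtopology\<close>)

lemma continuous_map_locally:
  assumes "\<And>p. p \<in> topspace X \<Longrightarrow> \<exists>W. openin X W \<and> p \<in> W \<and> continuous_map (subtopology X W) Y f"
  shows "continuous_map X Y f"
  unfolding continuous_map_def
proof (intro conjI allI impI)
  show "f \<in> topspace X \<rightarrow> topspace Y"
    using assms by (force simp: continuous_map_def)
  fix U assume U: "openin Y U"
  show "openin X {x \<in> topspace X. f x \<in> U}"
    unfolding openin_subopen[of _ "{x \<in> topspace X. f x \<in> U}"]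
  proof
    fix p assume p: "p \<in> {x \<in> topspace X. f x \<in> U}"
    then obtain W where W: "openin X W" "p \<in> W" "continuous_map (subtopology X W) Y f"
      using assms by blast
    have "openin X {x \<in> topspace (subtopology X W). f x \<in> U}"
      using openin_trans_full[OF openin_continuous_map_preimage[OF W(3) U] W(1)] .
    then show "\<exists>T. openin X T \<and> p \<in> T \<and> T \<subseteq> {x \<in> topspace X. f x \<in> U}"
      using p W by (intro exI[of _ "{x \<in> topspace (subtopology X W). f x \<in> U}"]) auto
  qed
qed

text \<open>\<open>smooth_map\<close> quantifies over all pairs of charts; here one pair is enough,
  on a neighbourhood that is mapped into the target chart.\<close>

definition smooth_near ::
  "'a topology \<Rightarrow> 'a chart set \<Rightarrow> 'b chart set \<Rightarrow> ('a \<Rightarrow> 'b) \<Rightarrow> 'a \<Rightarrow> bool" where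
  "smooth_near X A B F p \<longleftrightarrow>
    (\<exists>c\<in>A. \<exists>c'\<in>B. \<exists>W. openin X W \<and> p \<in> W \<and> W \<subseteq> chart_dom c \<and>
      F ` W \<subseteq> chart_dom c' \<and> smooth_on (coord c ` W) (coord c' \<circ> F \<circ> chart_inv c))"

lemma smooth_nearI:
  assumes "c \<in> A" "c' \<in> B" "openin X W" "p \<in> W" "W \<subseteq> chart_dom c" "F ` W \<subseteq> chart_dom c'"
    "smooth_on (coord c ` W) (coord c' \<circ> F \<circ> chart_inv c)"
  shows "smooth_near X A B F p"
  unfolding smooth_near_def using assms by blast

lemma smooth_nearE:
  assumes "smooth_near X A B F p"
  obtains c c' W where "c \<in> A" "c' \<in> B" "openin X W" "p \<in> W" "W \<subseteq> chart_dom c" "F ` W \<subseteq> chart_dom c'"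
    "smooth_on (coord c ` W) (coord c' \<circ> F \<circ> chart_inv c)"
  using assms unfolding smooth_near_def by blast

definition smooth_function_near :: "'a topology \<Rightarrow> 'a chart set \<Rightarrow> ('a \<Rightarrow> real) \<Rightarrow> 'a \<Rightarrow> bool" where
  "smooth_function_near X A f p \<longleftrightarrow>
    (\<exists>c\<in>A. \<exists>W. openin X W \<and> p \<in> W \<and> W \<subseteq> chart_dom c \<and> smooth_on (coord c ` W) (f \<circ> chart_inv c))"

lemma smooth_function_nearI:
  assumes "c \<in> A" "openin X W" "p \<in> W" "W \<subseteq> chart_dom c" "smooth_on (coord c ` W) (f \<circ> chart_inv c)"
  shows "smooth_function_near X A f p"
  unfolding smooth_function_near_def using assms by blast

text \<open>A common setting for the surface and its orientation double cover, so that bump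
  functions, smoothness tests and connectedness arguments apply to both.\<close>

locale smooth_atlas =
  fixes X :: "'a topology" and A :: "'a chart set"
  assumes hausdorff: "Hausdorff_space X"
    and charts: "\<And>c. c \<in> A \<Longrightarrow> is_chart X c"
    and chart_cover: "(\<Union>c\<in>A. chart_dom c) = topspace X"
    and transitions: "\<And>c c'. c \<in> A \<Longrightarrow> c' \<in> A \<Longrightarrow>
      smooth_on (coord c ` (chart_dom c \<inter> chart_dom c')) (coord c' \<circ> chart_inv c)"

lemma smooth_surface_imp_smooth_atlas: "smooth_surface X A \<Longrightarrow> smooth_atlas X A"
  by (simp add: smooth_surface_def smooth_atlas_def)

context smooth_atlas
begin

lemma obtain_chart:
  assumes "p \<in> topspace X" obtains c where "c \<in> A" "p \<in> chart_dom c"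
  using assms chart_cover by blast

lemma chart_dom_subset: "c \<in> A \<Longrightarrow> chart_dom c \<subseteq> topspace X"
  using chart_cover by blast

lemma compact_closed: "compactin X K \<Longrightarrow> closedin X K"
  using hausdorff by (rule compactin_imp_closedin)

text \<open>Smooth transitions carry the test from one pair of charts to every other. Continuity of
  \<open>F\<close> is shown first, since it makes the domains of the chart representations
  open.\<close>

lemma smooth_mapI:
  assumes Y: "smooth_atlas Y B"
    and loc: "\<And>p. p \<in> topspace X \<Longrightarrow> smooth_near X A B F p"
  shows "smooth_map X A Y B F"
proof -
  interpret Y: smooth_atlas Y B by fact
  have cont: "continuous_map X Y F"
  proof (rule continuous_map_locally)
    fix p assume "p \<in> topspace X"
    from loc[OF this] obtain c c' W where c: "c \<in> A" "c' \<in> B" and W: "openin X W" "p \<in> W" "W \<subseteq> chart_dom c"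
      "F ` W \<subseteq> chart_dom c'" and sm: "smooth_on (coord c ` W) (coord c' \<circ> F \<circ> chart_inv c)"
      by (rule smooth_nearE)
    have 1: "continuous_map (subtopology X W) (top_of_set (coord c ` W)) (coord c)"
      using continuous_map_from_subtopology_mono[OF coord_continuous[OF charts[OF c(1)]] W(3)]
      by (simp add: continuous_map_in_subtopology)
    have inv: "chart_inv c (coord c q) = q" "chart_inv c' (coord c' (F q)) = F q" if "q \<in> W" for q
      using W(3,4) that chart_inv_coord[OF charts[OF c(1)]] chart_inv_coord[OF Y.charts[OF c(2)]] by blast+
    then have 2: "continuous_map (top_of_set (coord c ` W)) (top_of_set (coord c' ` chart_dom c')) (coord c' \<circ> F \<circ> chart_inv c)"
      using smooth_on_imp_continuous_on[OF sm] W(4) by (auto simp: continuous_map_in_subtopology)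
    have "continuous_map (subtopology X W) Y (chart_inv c' \<circ> (coord c' \<circ> F \<circ> chart_inv c) \<circ> coord c)"
      using continuous_map_compose[OF 1 continuous_map_compose[OF 2 chart_inv_continuous[OF Y.charts[OF c(2)]]]]
      by (simp add: o_assoc)
    then have "continuous_map (subtopology X W) Y F"
      by (rule continuous_map_eq) (use inv in auto)
    then show "\<exists>W. openin X W \<and> p \<in> W \<and> continuous_map (subtopology X W) Y F"
      using W by blast
  qed
  have "smooth_on (coord c1 ` {p \<in> chart_dom c1. F p \<in> chart_dom c1'}) (coord c1' \<circ> F \<circ> chart_inv c1)"
    if c1: "c1 \<in> A" "c1' \<in> B" for c1 c1'
  proof (rule smooth_on_local)
    fix u assume "u \<in> coord c1 ` {p \<in> chart_dom c1. F p \<in> chart_dom c1'}"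
    then obtain p where p: "p \<in> chart_dom c1" "F p \<in> chart_dom c1'" "u = coord c1 p" by auto
    obtain c c' W where c: "c \<in> A" "c' \<in> B" and W: "openin X W" "p \<in> W" "W \<subseteq> chart_dom c"
      "F ` W \<subseteq> chart_dom c'" and sm: "smooth_on (coord c ` W) (coord c' \<circ> F \<circ> chart_inv c)"
      by (rule smooth_nearE[OF loc[OF subsetD[OF chart_dom_subset[OF c1(1)] p(1)]]])
    note ch = charts[OF c(1)] charts[OF c1(1)] Y.charts[OF c(2)] Y.charts[OF c1(2)]
    \<comment> \<open>The open region on which both the given pair of charts and the pair to be
      tested are available.\<close>
    define V where "V = {q \<in> W \<inter> chart_dom c1. F q \<in> chart_dom c1'}"
    have V: "openin X V"
      unfolding V_def
      by (rule openin_continuous_map_preimage_gen[OF cont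
            openin_Int[OF W(1) chart_dom_open[OF ch(2)]] chart_dom_open[OF ch(4)]])
    have op: "open (coord c1 ` V)" "open (coord c ` V)" "open (coord c' ` (chart_dom c' \<inter> chart_dom c1'))"
      by (rule coord_open_image[OF ch(2) V] coord_open_image[OF ch(1) V]
          coord_open_image[OF ch(3) openin_Int[OF chart_dom_open[OF ch(3)] chart_dom_open[OF ch(4)]]];
          use W in \<open>auto simp: V_def\<close>)+
    have 1: "smooth_on (coord c1 ` V) (coord c \<circ> chart_inv c1)"
      by (rule smooth_on_subset[OF transitions[OF c1(1) c(1)]]) (use W in \<open>auto simp: V_def\<close>)
    have 2: "smooth_on (coord c ` V) (coord c' \<circ> F \<circ> chart_inv c)"
      by (rule smooth_on_subset[OF sm]) (auto simp: V_def)
    have 3: "smooth_on (coord c1 ` V) (\<lambda>u. (coord c' \<circ> F \<circ> chart_inv c) ((coord c \<circ> chart_inv c1) u))"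
      by (rule smooth_on_compose[OF op(1,2) 1 2]) (auto simp: V_def chart_inv_coord[OF ch(2)])
    have 4: "smooth_on (coord c1 ` V) (\<lambda>u. (coord c1' \<circ> chart_inv c') ((coord c' \<circ> F \<circ> chart_inv c) ((coord c \<circ> chart_inv c1) u)))"
    proof (rule smooth_on_compose[OF op(1,3) 3 Y.transitions[OF c(2) c1(2)]])
      have "chart_inv c (coord c q) = q" "F q \<in> chart_dom c'" if "q \<in> W" for q
        using W(3,4) that chart_inv_coord[OF ch(1)] by blast+
      then show "(\<lambda>u. (coord c' \<circ> F \<circ> chart_inv c) ((coord c \<circ> chart_inv c1) u)) ` coord c1 ` V
          \<subseteq> coord c' ` (chart_dom c' \<inter> chart_dom c1')"
        by (auto simp: V_def chart_inv_coord[OF ch(2)])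
    qed
    have eq: "(coord c1' \<circ> chart_inv c') ((coord c' \<circ> F \<circ> chart_inv c) ((coord c \<circ> chart_inv c1) u)) =
        (coord c1' \<circ> F \<circ> chart_inv c1) u" if "u \<in> coord c1 ` V" for u
    proof -
      obtain q where q: "q \<in> V" "u = coord c1 q" using \<open>u \<in> coord c1 ` V\<close> by auto
      then have "q \<in> chart_dom c" "q \<in> chart_dom c1" "F q \<in> chart_dom c'"
        using W by (auto simp: V_def)
      then show ?thesis
        using q by (simp add: chart_inv_coord[OF ch(1)] chart_inv_coord[OF ch(2)] chart_inv_coord[OF ch(3)])
    qed
    have "smooth_on (coord c1 ` V) (coord c1' \<circ> F \<circ> chart_inv c1)"
      by (rule smooth_on_transform[OF 4 eq op(1)])
    then show "\<exists>T. open T \<and> u \<in> T \<and> smooth_on T (coord c1' \<circ> F \<circ> chart_inv c1)"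
      using op(1) p W by (intro exI[of _ "coord c1 ` V"]) (auto simp: V_def)
  qed
  then show ?thesis
    using cont by (simp add: smooth_map_def)
qed

lemma smooth_map_id: "smooth_map X A X A (\<lambda>p. p)"
proof (rule smooth_mapI[OF smooth_atlas_axioms])
  fix p assume "p \<in> topspace X"
  then obtain c where c: "c \<in> A" "p \<in> chart_dom c" using obtain_chart by blast
  have "smooth_on (coord c ` chart_dom c) (coord c \<circ> (\<lambda>p. p) \<circ> chart_inv c)"
    using transitions[OF c(1) c(1)] by (simp add: o_def)
  then show "smooth_near X A A (\<lambda>p. p) p"
    by (intro smooth_nearI[OF c(1) c(1) chart_dom_open[OF charts[OF c(1)]] c(2)]) auto
qed

end

section \<open>Composition and the chain rule in charts\<close>

lemma smooth_mapD:
  "smooth_map X A Y B F \<Longrightarrow> c \<in> A \<Longrightarrow> c' \<in> B \<Longrightarrow>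
    smooth_on (coord c ` {p \<in> chart_dom c. F p \<in> chart_dom c'}) (coord c' \<circ> F \<circ> chart_inv c)"
  unfolding smooth_map_def by blast

lemma smooth_map_continuous: "smooth_map X A Y B F \<Longrightarrow> continuous_map X Y F"
  by (simp add: smooth_map_def)

lemma smooth_map_topspace: "smooth_map X A Y B F \<Longrightarrow> p \<in> topspace X \<Longrightarrow> F p \<in> topspace Y"
  by (auto simp: smooth_map_def continuous_map_def)

lemma chart_rep_domain_open:
  assumes "smooth_atlas X A" "smooth_atlas Y B" "smooth_map X A Y B F" "c \<in> A" "c' \<in> B"
  shows "openin X {p \<in> chart_dom c. F p \<in> chart_dom c'}"
    and "open (coord c ` {p \<in> chart_dom c. F p \<in> chart_dom c'})"
proof -
  interpret X: smooth_atlas X A by fact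
  interpret Y: smooth_atlas Y B by fact
  show o: "openin X {p \<in> chart_dom c. F p \<in> chart_dom c'}"
    by (rule openin_continuous_map_preimage_gen[OF smooth_map_continuous[OF assms(3)]])
      (auto intro: chart_dom_open X.charts Y.charts assms)
  show "open (coord c ` {p \<in> chart_dom c. F p \<in> chart_dom c'})"
    by (rule coord_open_image[OF X.charts[OF assms(4)] o]) auto
qed

lemma smooth_map_compose:
  assumes X: "smooth_atlas X A" and Y: "smooth_atlas Y B" and Z: "smooth_atlas Z C"
    and F: "smooth_map X A Y B F" and G: "smooth_map Y B Z C G"
  shows "smooth_map X A Z C (G \<circ> F)"
proof (rule smooth_atlas.smooth_mapI[OF X Z])
  interpret X: smooth_atlas X A by fact
  interpret Y: smooth_atlas Y B by fact
  interpret Z: smooth_atlas Z C by fact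
  fix p assume p: "p \<in> topspace X"
  obtain c where c: "c \<in> A" "p \<in> chart_dom c" using X.obtain_chart p by blast
  obtain c' where c': "c' \<in> B" "F p \<in> chart_dom c'"
    using Y.obtain_chart smooth_map_topspace[OF F p] by blast
  obtain c'' where c'': "c'' \<in> C" "G (F p) \<in> chart_dom c''"
    using Z.obtain_chart smooth_map_topspace[OF G smooth_map_topspace[OF F p]] by blast
  let ?V = "{q \<in> chart_dom c'. G q \<in> chart_dom c''}"
  define W where "W = {p \<in> chart_dom c. F p \<in> ?V}"
  have W: "openin X W"
    unfolding W_def
    by (rule openin_continuous_map_preimage_gen[OF smooth_map_continuous[OF F]])
      (auto intro: chart_dom_open X.charts c chart_rep_domain_open[OF Y Z G c'(1) c''(1)])
  have op: "open (coord c ` W)" "open (coord c' ` ?V)"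
    using coord_open_image[OF X.charts[OF c(1)] W] chart_rep_domain_open(2)[OF Y Z G c'(1) c''(1)]
    by (auto simp: W_def)
  have 1: "smooth_on (coord c ` W) (coord c' \<circ> F \<circ> chart_inv c)"
    by (rule smooth_on_subset[OF smooth_mapD[OF F c(1) c'(1)]]) (auto simp: W_def)
  have 2: "smooth_on (coord c' ` ?V) (coord c'' \<circ> G \<circ> chart_inv c')"
    by (rule smooth_mapD[OF G c'(1) c''(1)])
  have "smooth_on (coord c ` W) (\<lambda>u. (coord c'' \<circ> G \<circ> chart_inv c') ((coord c' \<circ> F \<circ> chart_inv c) u))"
    by (rule smooth_on_compose[OF op 1 2]) (auto simp: W_def chart_inv_coord[OF X.charts[OF c(1)]])
  moreover have "(coord c'' \<circ> G \<circ> chart_inv c') ((coord c' \<circ> F \<circ> chart_inv c) u) =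
      (coord c'' \<circ> (G \<circ> F) \<circ> chart_inv c) u" if "u \<in> coord c ` W" for u
    using that by (auto simp: W_def chart_inv_coord[OF X.charts[OF c(1)]] chart_inv_coord[OF Y.charts[OF c'(1)]])
  ultimately have "smooth_on (coord c ` W) (coord c'' \<circ> (G \<circ> F) \<circ> chart_inv c)"
    by (rule smooth_on_transform[OF _ _ op(1)])
  then show "smooth_near X A C (G \<circ> F) p"
    using c(2) c'(2) c''(2) by (intro smooth_nearI[OF c(1) c''(1) W]) (auto simp: W_def)
qed

lemma chart_jacobian_cong:
  assumes "is_chart X c" "openin X W" "p \<in> W" "p \<in> chart_dom c" "\<And>q. q \<in> W \<Longrightarrow> F q = G q"
  shows "chart_jacobian c c' F p = chart_jacobian c c' G p"
  unfolding chart_jacobian_def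
proof (rule jacobian_cong)
  show "open (coord c ` (chart_dom c \<inter> W))"
    by (rule coord_open_image[OF assms(1) openin_Int[OF chart_dom_open[OF assms(1)] assms(2)]]) simp
qed (use assms chart_inv_coord[OF assms(1)] in auto)

text \<open>\<open>inv_into\<close> agrees with an explicit inverse only on the surface, so
  smoothness must be transferable between maps that agree there.\<close>

lemma smooth_map_cong:
  assumes "smooth_atlas X A" "smooth_atlas Y B" "smooth_map X A Y B F" "\<And>p. p \<in> topspace X \<Longrightarrow> F p = G p"
  shows "smooth_map X A Y B G"
proof (rule smooth_atlas.smooth_mapI[OF assms(1,2)])
  interpret X: smooth_atlas X A by fact
  interpret Y: smooth_atlas Y B by fact
  fix p assume p: "p \<in> topspace X"
  obtain c where c: "c \<in> A" "p \<in> chart_dom c" using X.obtain_chart p by blast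
  obtain c' where c': "c' \<in> B" "F p \<in> chart_dom c'"
    using Y.obtain_chart smooth_map_topspace[OF assms(3) p] by blast
  let ?W = "{p \<in> chart_dom c. F p \<in> chart_dom c'}"
  note op = chart_rep_domain_open[OF assms(1-3) c(1) c'(1)]
  have eq: "F q = G q" if "q \<in> ?W" for q
    using assms(4) that X.chart_dom_subset[OF c(1)] by auto
  have "smooth_on (coord c ` ?W) (coord c' \<circ> F \<circ> chart_inv c)"
    by (rule smooth_mapD[OF assms(3) c(1) c'(1)])
  moreover have "(coord c' \<circ> F \<circ> chart_inv c) u = (coord c' \<circ> G \<circ> chart_inv c) u" if u: "u \<in> coord c ` ?W" for u
  proof -
    obtain q where "q \<in> ?W" "u = coord c q" using u by auto
    then show ?thesis using eq[of q] by (simp add: chart_inv_coord[OF X.charts[OF c(1)]])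
  qed
  ultimately have "smooth_on (coord c ` ?W) (coord c' \<circ> G \<circ> chart_inv c)"
    by (rule smooth_on_transform[OF _ _ op(2)])
  moreover have "G q \<in> chart_dom c'" if "q \<in> ?W" for q
    using that eq[OF that] by simp
  ultimately show "smooth_near X A B G p"
    using c(2) c'(2) by (intro smooth_nearI[OF c(1) c'(1) op(1)]) auto
qed

lemma chart_rep_differentiable:
  assumes "smooth_atlas X A" "smooth_atlas Y B" "smooth_map X A Y B F" "c \<in> A" "c' \<in> B"
    "p \<in> chart_dom c" "F p \<in> chart_dom c'"
  shows "(coord c' \<circ> F \<circ> chart_inv c) differentiable at (coord c p)"
  by (rule smooth_on_differentiable[OF chart_rep_domain_open(2)[OF assms(1-5)] smooth_mapD[OF assms(3-5)]])
    (use assms(6,7) in simp)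

lemma chart_jacobian_compose:
  assumes X: "smooth_atlas X A" and Y: "smooth_atlas Y B" and Z: "smooth_atlas Z C"
    and F: "smooth_map X A Y B F" and G: "smooth_map Y B Z C G"
    and c: "c \<in> A" "c' \<in> B" "c'' \<in> C" and p: "p \<in> chart_dom c" "F p \<in> chart_dom c'" "G (F p) \<in> chart_dom c''"
  shows "chart_jacobian c c'' (\<lambda>q. G (F q)) p = chart_jacobian c' c'' G (F p) ** chart_jacobian c c' F p"
proof -
  interpret X: smooth_atlas X A by fact
  interpret Y: smooth_atlas Y B by fact
  let ?f = "coord c' \<circ> F \<circ> chart_inv c" and ?g = "coord c'' \<circ> G \<circ> chart_inv c'"
  let ?W = "{p \<in> chart_dom c. F p \<in> chart_dom c'}"
  have f: "?f (coord c p) = coord c' (F p)"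
    using p chart_inv_coord[OF X.charts[OF c(1)]] by simp
  have "jacobian (coord c'' \<circ> (\<lambda>q. G (F q)) \<circ> chart_inv c) (at (coord c p)) = jacobian (\<lambda>u. ?g (?f u)) (at (coord c p))"
    by (rule jacobian_cong[OF chart_rep_domain_open(2)[OF X Y F c(1,2)]])
      (use p chart_inv_coord[OF X.charts[OF c(1)]] chart_inv_coord[OF Y.charts[OF c(2)]] in auto)
  also have "\<dots> = jacobian ?g (at (?f (coord c p))) ** jacobian ?f (at (coord c p))"
    by (rule jacobian_compose[OF chart_rep_differentiable[OF X Y F c(1,2) p(1,2)]])
      (unfold f, rule chart_rep_differentiable[OF Y Z G c(2,3) p(2,3)])
  finally show ?thesis
    unfolding chart_jacobian_def f .
qed

context smooth_atlas
begin

lemma transition_jacobian_self: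
  assumes "c \<in> A" "p \<in> chart_dom c" shows "transition_jacobian c c p = mat 1"
proof -
  have "jacobian (coord c \<circ> (\<lambda>q. q) \<circ> chart_inv c) (at (coord c p)) = jacobian (\<lambda>u. u) (at (coord c p))"
    by (rule jacobian_cong[OF coord_image_open[OF charts[OF assms(1)]]]) (use assms coord_chart_inv[of _ c] in auto)
  then show ?thesis by (simp add: chart_jacobian_def jacobian_ident)
qed

lemma transition_jacobian_compose:
  assumes "c \<in> A" "c' \<in> A" "c'' \<in> A" "p \<in> chart_dom c" "p \<in> chart_dom c'" "p \<in> chart_dom c''"
  shows "transition_jacobian c c'' p = transition_jacobian c' c'' p ** transition_jacobian c c' p"
  using chart_jacobian_compose[OF smooth_atlas_axioms smooth_atlas_axioms smooth_atlas_axioms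
      smooth_map_id smooth_map_id] assms by blast

lemma det_transition_mult:
  assumes "c \<in> A" "c' \<in> A" "p \<in> chart_dom c" "p \<in> chart_dom c'"
  shows "det (transition_jacobian c c' p) * det (transition_jacobian c' c p) = 1"
  using transition_jacobian_compose[of c' c c' p] transition_jacobian_self[of c' p] assms
  by (metis det_I det_mul)

lemma det_transition_nonzero:
  assumes "c \<in> A" "c' \<in> A" "p \<in> chart_dom c" "p \<in> chart_dom c'"
  shows "det (transition_jacobian c c' p) \<noteq> 0"
  using det_transition_mult[OF assms] by auto

lemma chart_jacobian_change:
  assumes F: "smooth_map X A X A F"
    and c: "c \<in> A" "c1 \<in> A" "c' \<in> A" "c1' \<in> A"
    and p: "p \<in> chart_dom c" "p \<in> chart_dom c1" "F p \<in> chart_dom c'" "F p \<in> chart_dom c1'"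
  shows "chart_jacobian c1 c1' F p =
    transition_jacobian c' c1' (F p) ** chart_jacobian c c' F p ** transition_jacobian c1 c p"
proof -
  note ax = smooth_atlas_axioms
  have "chart_jacobian c1 c1' F p = transition_jacobian c' c1' (F p) ** chart_jacobian c1 c' F p"
    using chart_jacobian_compose[OF ax ax ax F smooth_map_id c(2,3,4) p(2,3)] p by simp
  moreover have "chart_jacobian c1 c' F p = chart_jacobian c c' F p ** transition_jacobian c1 c p"
    using chart_jacobian_compose[OF ax ax ax smooth_map_id F c(2,1,3) p(2,1)] p by simp
  ultimately show ?thesis by (simp add: matrix_mul_assoc)
qed

lemma diffeomorphismI:
  assumes F: "smooth_map X A X A F" and G: "smooth_map X A X A G"
    and GF: "\<And>p. p \<in> topspace X \<Longrightarrow> G (F p) = p" and FG: "\<And>p. p \<in> topspace X \<Longrightarrow> F (G p) = p"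
  shows "diffeomorphism X A F"
proof -
  have bij: "bij_betw F (topspace X) (topspace X)"
    by (rule bij_betw_byWitness[of _ G])
      (use GF FG smooth_map_topspace[OF F] smooth_map_topspace[OF G] in auto)
  have "G p = inv_into (topspace X) F p" if "p \<in> topspace X" for p
  proof -
    have "inv_into (topspace X) F (F (G p)) = G p"
      by (rule inv_into_f_f) (use bij that smooth_map_topspace[OF G] in \<open>auto simp: bij_betw_def\<close>)
    then show ?thesis using FG that by simp
  qed
  then have "smooth_map X A X A (inv_into (topspace X) F)"
    by (rule smooth_map_cong[OF smooth_atlas_axioms smooth_atlas_axioms G])
  then show ?thesis
    using bij F by (simp add: diffeomorphism_def)
qed

lemma diffeomorphism_inverse:
  assumes "diffeomorphism X A F"
  shows "smooth_map X A X A F" "smooth_map X A X A (inv_into (topspace X) F)"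
    "\<And>p. p \<in> topspace X \<Longrightarrow> F (inv_into (topspace X) F p) = p"
    "\<And>p. p \<in> topspace X \<Longrightarrow> inv_into (topspace X) F (F p) = p"
  using assms by (auto simp: diffeomorphism_def bij_betw_def f_inv_into_f)

lemma diffeomorphism_det_mult:
  assumes F: "diffeomorphism X A F" and c: "c \<in> A" "c' \<in> A" and p: "p \<in> chart_dom c" "F p \<in> chart_dom c'"
  shows "det (chart_jacobian c' c (inv_into (topspace X) F) (F p)) * det (chart_jacobian c c' F p) = 1"
proof -
  let ?G = "inv_into (topspace X) F"
  note ax = smooth_atlas_axioms and d = diffeomorphism_inverse[OF F]
  have pX: "p \<in> topspace X" using p chart_dom_subset[OF c(1)] by auto
  have "chart_jacobian c' c ?G (F p) ** chart_jacobian c c' F p = chart_jacobian c c (\<lambda>q. ?G (F q)) p"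
    using chart_jacobian_compose[OF ax ax ax d(1,2) c(1,2,1) p] d(4)[OF pX] p by simp
  also have "\<dots> = transition_jacobian c c p"
    by (rule chart_jacobian_cong[OF charts[OF c(1)] openin_topspace]) (use p pX d(4) in auto)
  finally show ?thesis
    using transition_jacobian_self[OF c(1) p(1)] by (metis det_I det_mul)
qed

lemma diffeomorphism_compose:
  assumes "diffeomorphism X A F" "diffeomorphism X A G"
  shows "diffeomorphism X A (\<lambda>p. G (F p))"
proof (rule diffeomorphismI[where G = "\<lambda>p. inv_into (topspace X) F (inv_into (topspace X) G p)"])
  note ax = smooth_atlas_axioms
  note F = diffeomorphism_inverse[OF assms(1)] and G = diffeomorphism_inverse[OF assms(2)]
  show "smooth_map X A X A (\<lambda>p. G (F p))"
    using smooth_map_compose[OF ax ax ax F(1) G(1)] by (simp add: o_def)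
  show "smooth_map X A X A (\<lambda>p. inv_into (topspace X) F (inv_into (topspace X) G p))"
    using smooth_map_compose[OF ax ax ax G(2) F(2)] by (simp add: o_def)
qed (simp_all add: diffeomorphism_inverse[OF assms(1)] diffeomorphism_inverse[OF assms(2)]
      smooth_map_topspace[OF diffeomorphism_inverse(1)[OF assms(1)]]
      smooth_map_topspace[OF diffeomorphism_inverse(2)[OF assms(2)]])

end

section \<open>Test functions, bumps and diffeomorphisms supported in a chart\<close>

definition smooth_function :: "'a chart set \<Rightarrow> ('a \<Rightarrow> real) \<Rightarrow> bool" where
  "smooth_function A f \<longleftrightarrow> (\<forall>c\<in>A. smooth_on (coord c ` chart_dom c) (f \<circ> chart_inv c))"

lemma smooth_functionD:
  "smooth_function A f \<Longrightarrow> c \<in> A \<Longrightarrow> smooth_on (coord c ` chart_dom c) (f \<circ> chart_inv c)"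
  unfolding smooth_function_def by blast

context smooth_atlas
begin

lemma smooth_functionI:
  assumes "\<And>p. p \<in> topspace X \<Longrightarrow> smooth_function_near X A f p"
  shows "smooth_function A f"
  unfolding smooth_function_def
proof (intro ballI smooth_on_local)
  fix c1 u assume c1: "c1 \<in> A" and "u \<in> coord c1 ` chart_dom c1"
  then obtain p where p: "p \<in> chart_dom c1" "u = coord c1 p" by auto
  then obtain c W where c: "c \<in> A" and W: "openin X W" "p \<in> W" "W \<subseteq> chart_dom c"
    and sm: "smooth_on (coord c ` W) (f \<circ> chart_inv c)"
    using assms[OF subsetD[OF chart_dom_subset[OF c1] p(1)]] unfolding smooth_function_near_def by blast
  note ch = charts[OF c] charts[OF c1]
  let ?V = "W \<inter> chart_dom c1"
  have V: "openin X ?V" using W chart_dom_open[OF ch(2)] by auto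
  have op: "open (coord c1 ` ?V)" "open (coord c ` W)"
    by (rule coord_open_image[OF ch(2) V] coord_open_image[OF ch(1) W(1)]; use W in auto)+
  have 1: "smooth_on (coord c1 ` ?V) (coord c \<circ> chart_inv c1)"
    by (rule smooth_on_subset[OF transitions[OF c1 c]]) (use W in auto)
  have "smooth_on (coord c1 ` ?V) (\<lambda>u. (f \<circ> chart_inv c) ((coord c \<circ> chart_inv c1) u))"
    by (rule smooth_on_compose[OF op 1 sm]) (auto simp: chart_inv_coord[OF ch(2)])
  moreover have "(f \<circ> chart_inv c) ((coord c \<circ> chart_inv c1) u) = (f \<circ> chart_inv c1) u" if u: "u \<in> coord c1 ` ?V" for u
  proof -
    obtain q where "q \<in> chart_dom c" "q \<in> chart_dom c1" "u = coord c1 q" using u W(3) by auto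
    then show ?thesis by (simp add: chart_inv_coord[OF ch(1)] chart_inv_coord[OF ch(2)])
  qed
  ultimately have "smooth_on (coord c1 ` ?V) (f \<circ> chart_inv c1)"
    by (rule smooth_on_transform[OF _ _ op(1)])
  then show "\<exists>T. open T \<and> u \<in> T \<and> smooth_on T (f \<circ> chart_inv c1)"
    using op(1) p W by (intro exI[of _ "coord c1 ` ?V"]) auto
qed

lemma smooth_function_continuous:
  assumes "smooth_function A f" shows "continuous_map X euclideanreal f"
proof (rule continuous_map_locally)
  fix p assume "p \<in> topspace X"
  then obtain c where c: "c \<in> A" "p \<in> chart_dom c" using obtain_chart by blast
  note ch = charts[OF c(1)]
  have 1: "continuous_map (subtopology X (chart_dom c)) (top_of_set (coord c ` chart_dom c)) (coord c)"
    using coord_continuous[OF ch] by (auto simp: continuous_map_in_subtopology)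
  have "continuous_on (coord c ` chart_dom c) (f \<circ> chart_inv c)"
    by (rule smooth_on_imp_continuous_on[OF smooth_functionD[OF assms c(1)]])
  then have 2: "continuous_map (top_of_set (coord c ` chart_dom c)) euclideanreal (f \<circ> chart_inv c)"
    by simp
  have "continuous_map (subtopology X (chart_dom c)) euclideanreal f"
    by (rule continuous_map_eq[OF continuous_map_compose[OF 1 2]]) (auto simp: chart_inv_coord[OF ch])
  then show "\<exists>W. openin X W \<and> p \<in> W \<and> continuous_map (subtopology X W) euclideanreal f"
    using c chart_dom_open[OF ch] by blast
qed

end

lemma smooth_function_compose:
  assumes X: "smooth_atlas X A" and Y: "smooth_atlas Y B" and F: "smooth_map X A Y B F" and f: "smooth_function B f"
  shows "smooth_function A (f \<circ> F)"
proof (rule smooth_atlas.smooth_functionI[OF X])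
  interpret X: smooth_atlas X A by fact
  interpret Y: smooth_atlas Y B by fact
  fix p assume p: "p \<in> topspace X"
  obtain c where c: "c \<in> A" "p \<in> chart_dom c" using X.obtain_chart p by blast
  obtain c' where c': "c' \<in> B" "F p \<in> chart_dom c'"
    using Y.obtain_chart smooth_map_topspace[OF F p] by blast
  let ?W = "{p \<in> chart_dom c. F p \<in> chart_dom c'}"
  note op = chart_rep_domain_open[OF X Y F c(1) c'(1)]
  have 1: "smooth_on (coord c ` ?W) (coord c' \<circ> F \<circ> chart_inv c)"
    by (rule smooth_mapD[OF F c(1) c'(1)])
  have 2: "smooth_on (coord c' ` chart_dom c') (f \<circ> chart_inv c')"
    by (rule smooth_functionD[OF f c'(1)])
  have "smooth_on (coord c ` ?W) (\<lambda>u. (f \<circ> chart_inv c') ((coord c' \<circ> F \<circ> chart_inv c) u))"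
    by (rule smooth_on_compose[OF op(2) coord_image_open[OF Y.charts[OF c'(1)]] 1 2])
      (auto simp: chart_inv_coord[OF X.charts[OF c(1)]])
  moreover have "(f \<circ> chart_inv c') ((coord c' \<circ> F \<circ> chart_inv c) u) = (f \<circ> F \<circ> chart_inv c) u" if "u \<in> coord c ` ?W" for u
    using that by (auto simp: chart_inv_coord[OF X.charts[OF c(1)]] chart_inv_coord[OF Y.charts[OF c'(1)]])
  ultimately have "smooth_on (coord c ` ?W) (f \<circ> F \<circ> chart_inv c)"
    by (rule smooth_on_transform[OF _ _ op(2)])
  then show "smooth_function_near X A (f \<circ> F) p"
    using c(2) c'(2) by (intro smooth_function_nearI[OF c(1) op(1)]) auto
qed

lemma test_functions_iff:
  "f \<in> test_functions X A \<longleftrightarrow> smooth_function A f \<and> compactin X (X closure_of {p \<in> topspace X. f p \<noteq> 0})"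
  by (simp add: test_functions_def smooth_function_def)

context smooth_atlas
begin

lemma test_functionI:
  assumes "smooth_function A f" "compactin X K" "\<And>p. p \<in> topspace X \<Longrightarrow> f p \<noteq> 0 \<Longrightarrow> p \<in> K"
  shows "f \<in> test_functions X A"
proof -
  have "X closure_of {p \<in> topspace X. f p \<noteq> 0} \<subseteq> K"
    by (rule closure_of_minimal) (use assms compact_closed in auto)
  then show ?thesis
    using assms closed_compactin[OF assms(2)] by (simp add: test_functions_iff)
qed

lemma test_function_diff:
  assumes "f \<in> test_functions X A" "h \<in> test_functions X A"
  shows "(\<lambda>p. f p - h p) \<in> test_functions X A"
proof (rule test_functionI)
  have "smooth_on (coord c ` chart_dom c) (\<lambda>u. (f \<circ> chart_inv c) u - (h \<circ> chart_inv c) u)" if "c \<in> A" for c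
    by (rule smooth_on_diff[OF coord_image_open[OF charts[OF that]]]; rule smooth_functionD[OF _ that])
      (use assms in \<open>simp_all add: test_functions_iff\<close>)
  then show "smooth_function A (\<lambda>p. f p - h p)"
    by (simp add: smooth_function_def o_def)
  show "compactin X (X closure_of {p \<in> topspace X. f p \<noteq> 0} \<union> X closure_of {p \<in> topspace X. h p \<noteq> 0})"
    using assms by (simp add: test_functions_iff compactin_Un)
  show "p \<in> X closure_of {p \<in> topspace X. f p \<noteq> 0} \<union> X closure_of {p \<in> topspace X. h p \<noteq> 0}"
    if "p \<in> topspace X" "f p - h p \<noteq> 0" for p
  proof -
    have "p \<in> {p \<in> topspace X. f p \<noteq> 0} \<or> p \<in> {p \<in> topspace X. h p \<noteq> 0}"
      using that by auto
    moreover have "{p \<in> topspace X. k p \<noteq> 0} \<subseteq> X closure_of {p \<in> topspace X. k p \<noteq> 0}" for k :: "'a \<Rightarrow> real"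
      by (rule closure_of_subset) auto
    ultimately show ?thesis by blast
  qed
qed

text \<open>The composite is supported in the image under the inverse \<open>G\<close> of the
  support of f, and continuous images of compact sets are compact.\<close>

lemma test_function_compose:
  assumes Y: "smooth_atlas Y B" and F: "smooth_map X A Y B F" and G: "smooth_map Y B X A G"
    and GF: "\<And>p. p \<in> topspace X \<Longrightarrow> G (F p) = p" and f: "f \<in> test_functions Y B"
  shows "f \<circ> F \<in> test_functions X A"
proof (rule test_functionI)
  show "smooth_function A (f \<circ> F)"
    using smooth_function_compose[OF smooth_atlas_axioms Y F] f by (simp add: test_functions_iff)
  show "compactin X (G ` (Y closure_of {p \<in> topspace Y. f p \<noteq> 0}))"
    using image_compactin[OF _ smooth_map_continuous[OF G]] f by (simp add: test_functions_iff)
  show "p \<in> G ` (Y closure_of {p \<in> topspace Y. f p \<noteq> 0})" if "p \<in> topspace X" "(f \<circ> F) p \<noteq> 0" for p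
  proof -
    have "F p \<in> {p \<in> topspace Y. f p \<noteq> 0}"
      using that smooth_map_topspace[OF F] by simp
    moreover have "{p \<in> topspace Y. f p \<noteq> 0} \<subseteq> Y closure_of {p \<in> topspace Y. f p \<noteq> 0}"
      by (rule closure_of_subset) auto
    ultimately have "F p \<in> Y closure_of {p \<in> topspace Y. f p \<noteq> 0}" by blast
    then have "G (F p) \<in> G ` (Y closure_of {p \<in> topspace Y. f p \<noteq> 0})" by (rule imageI)
    then show ?thesis by (simp only: GF[OF that(1)])
  qed
qed

lemma bump_function:
  assumes U: "openin X U" and p: "p \<in> U"
  obtains b W where "b \<in> test_functions X A" "openin X W" "p \<in> W" "W \<subseteq> U"
    "\<And>q. q \<in> W \<Longrightarrow> b q = 1" "\<And>q. b q \<noteq> 0 \<Longrightarrow> q \<in> U"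
proof -
  have "p \<in> topspace X" using openin_subset[OF U] p by auto
  then obtain c where c: "c \<in> A" "p \<in> chart_dom c" using obtain_chart by blast
  note ch = charts[OF c(1)]
  define u0 where "u0 = coord c p"
  have "open (coord c ` (chart_dom c \<inter> U))"
    by (rule coord_open_image[OF ch]) (use U chart_dom_open[OF ch] in auto)
  moreover have "u0 \<in> coord c ` (chart_dom c \<inter> U)" using c p by (auto simp: u0_def)
  ultimately obtain e where e: "e > 0" "cball u0 e \<subseteq> coord c ` (chart_dom c \<inter> U)"
    using open_contains_cball by metis
  \<comment> \<open>The plateau vanishes once the squared distance reaches twice the square of r,
    which is half the square of e; so the bump is supported in the closed ball of radius e.\<close>
  define r where "r = e / 2"
  have r: "r > 0" using e by (simp add: r_def)
  let ?n = "\<lambda>u. (u - u0) \<bullet> (u - u0) * inverse (r\<^sup>2)"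
  define b where "b = (\<lambda>q. if q \<in> chart_dom c then plateau (?n (coord c q)) else 0)"
  define K where "K = chart_inv c ` cball u0 e"
  have cb: "cball u0 e \<subseteq> coord c ` chart_dom c" using e by auto
  have K: "compactin X K"
    unfolding K_def by (rule chart_inv_compact_image[OF ch]) (use cb in auto)
  have KU: "K \<subseteq> U"
    unfolding K_def using e chart_inv_coord[OF ch] by force
  have bK: "q \<in> K" if "b q \<noteq> 0" for q
  proof -
    have q: "q \<in> chart_dom c" "plateau (?n (coord c q)) \<noteq> 0"
      using that by (auto simp: b_def split: if_splits)
    then have "?n (coord c q) < 2" using plateau_eq_0 by (meson linorder_not_less)
    then have "(norm (coord c q - u0))\<^sup>2 < 2 * r\<^sup>2"
      using r by (simp add: power2_norm_eq_inner field_simps)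
    also have "\<dots> \<le> e\<^sup>2" by (simp add: r_def power2_eq_square)
    finally have "norm (coord c q - u0) \<le> e" using e by (simp add: power2_less_imp_less less_imp_le)
    then have "coord c q \<in> cball u0 e" by (simp add: dist_norm norm_minus_commute)
    then show ?thesis
      unfolding K_def using chart_inv_coord[OF ch q(1)] by (metis image_eqI)
  qed
  then have b0: "b q = 0" if "q \<notin> K" for q using that by blast
  define W where "W = {q \<in> chart_dom c. coord c q \<in> ball u0 r}"
  have W: "openin X W" unfolding W_def by (rule coord_open_vimage[OF ch]) simp
  have bW: "b q = 1" if "q \<in> W" for q
  proof -
    have "(norm (coord c q - u0))\<^sup>2 \<le> r\<^sup>2"
      using that by (intro power_mono) (auto simp: W_def dist_norm norm_minus_commute)
    then have "?n (coord c q) \<le> 1" using r by (simp add: power2_norm_eq_inner field_simps)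
    then show ?thesis using that by (simp add: b_def W_def plateau_eq_1)
  qed
  have "smooth_function A b"
  proof (rule smooth_functionI)
    fix q assume q: "q \<in> topspace X"
    show "smooth_function_near X A b q"
    proof (cases "q \<in> chart_dom c")
      case True
      have op: "open (coord c ` chart_dom c)" by (rule coord_image_open[OF ch])
      have n: "smooth_on (coord c ` chart_dom c) ?n"
        by (intro smooth_on_mult smooth_on_inner smooth_on_diff smooth_on_id smooth_on_const op)
      have "smooth_on (coord c ` chart_dom c) (b \<circ> chart_inv c)"
        using smooth_on_real_compose[OF op n smooth_on_plateau]
        by (subst smooth_on_cong[OF op, of _ "\<lambda>u. plateau (?n u)"])
          (auto simp: b_def chart_inv_coord[OF ch])
      then show ?thesis
        by (rule smooth_function_nearI[OF c(1) chart_dom_open[OF ch] True order_refl])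
    next
      case False
      obtain c1 where c1: "c1 \<in> A" "q \<in> chart_dom c1" using obtain_chart q by blast
      \<comment> \<open>K is compact, hence closed in the Hausdorff space. A point outside the chart
        therefore has a neighbourhood on which the bump is 0.\<close>
      let ?W = "chart_dom c1 - K"
      have W: "openin X ?W"
        by (intro openin_diff chart_dom_open charts c1 compact_closed K)
      have op: "open (coord c1 ` ?W)" by (rule coord_open_image[OF charts[OF c1(1)] W]) auto
      have "smooth_on (coord c1 ` ?W) (b \<circ> chart_inv c1)"
        by (subst smooth_on_cong[OF op, of _ "\<lambda>u. 0"])
          (auto simp: b0 smooth_on_const chart_inv_coord[OF charts[OF c1(1)]])
      moreover have "q \<notin> K" using False chart_inv_in_dom[of _ c] cb unfolding K_def by blast
      ultimately show ?thesis
        using c1(2) by (intro smooth_function_nearI[OF c1(1) W]) auto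
    qed
  qed
  then have "b \<in> test_functions X A" using K bK by (rule test_functionI)
  moreover have "p \<in> W" using c r by (simp add: W_def u0_def)
  moreover have "W \<subseteq> U" using bW bK KU by force
  ultimately show ?thesis
    using that[of b W] W bW bK KU by blast
qed

text \<open>Extension by the identity. It is smooth at points outside the chart because the preimage
  of the compact set K is closed in the Hausdorff space, so that the extended map is the identity
  near such points.\<close>

lemma chart_supported_diffeomorphism:
  assumes c: "c \<in> A" and K: "compact K" "K \<subseteq> coord c ` chart_dom c"
    and P: "smooth_on UNIV P" "smooth_on UNIV Q" "\<And>u. Q (P u) = u" "\<And>u. P (Q u) = u" "\<forall>u. u \<notin> K \<longrightarrow> P u = u"
  obtains F where "diffeomorphism X A F"
    and "\<And>p. p \<in> chart_dom c \<Longrightarrow> F p \<in> chart_dom c \<and> coord c (F p) = P (coord c p)"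
    and "closedin X (chart_inv c ` K)"
    and "\<And>p. p \<notin> chart_inv c ` K \<Longrightarrow> F p = p"
    and "\<And>p. p \<in> chart_dom c \<Longrightarrow> chart_jacobian c c F p = jacobian P (at (coord c p))"
proof -
  note ch = charts[OF c]
  have op: "open (coord c ` chart_dom c)" by (rule coord_image_open[OF ch])
  define ext where "ext = (\<lambda>P p. if p \<in> chart_dom c then chart_inv c (P (coord c p)) else p)"
  have clK: "closedin X (chart_inv c ` K)"
    by (rule compact_closed[OF chart_inv_compact_image[OF ch K]])
  \<comment> \<open>Stated for arbitrary P and Q, since it is applied to the given map and again
    with the roles of the two maps exchanged.\<close>
  have *: "smooth_map X A X A (ext P) \<and> (\<forall>p\<in>chart_dom c. ext P p \<in> chart_dom c \<and> coord c (ext P p) = P (coord c p))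
      \<and> (\<forall>p. p \<notin> chart_inv c ` K \<longrightarrow> ext P p = p)"
    if P: "smooth_on UNIV P" "\<And>u. Q (P u) = u" "\<forall>u. u \<notin> K \<longrightarrow> P u = u" for P Q
  proof -
    \<comment> \<open>If P u were outside K, it would be fixed by P, and injectivity would give P u
      = u.\<close>
    have PK: "P u \<in> K" if "u \<in> K" for u
      using P(2,3) that by metis
    then have Pc: "P u \<in> coord c ` chart_dom c" if "u \<in> coord c ` chart_dom c" for u
      using K P(3) that by (cases "u \<in> K") (force, simp)
    have 1: "ext P p \<in> chart_dom c \<and> coord c (ext P p) = P (coord c p)" if "p \<in> chart_dom c" for p
      using that chart_inv_in_dom[OF Pc] coord_chart_inv[OF Pc] by (auto simp: ext_def)
    have 2: "ext P p = p" if "p \<notin> chart_inv c ` K" for p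
    proof (cases "p \<in> chart_dom c")
      case True
      then have "coord c p \<notin> K" using that chart_inv_coord[OF ch True] by (metis image_eqI)
      then show ?thesis using P(3) True chart_inv_coord[OF ch True] by (simp add: ext_def)
    qed (simp add: ext_def)
    have "smooth_map X A X A (ext P)"
    proof (rule smooth_mapI[OF smooth_atlas_axioms])
      fix p assume p: "p \<in> topspace X"
      show "smooth_near X A A (ext P) p"
      proof (cases "p \<in> chart_dom c")
        case True
        have "smooth_on (coord c ` chart_dom c) (coord c \<circ> ext P \<circ> chart_inv c)"
          using smooth_on_subset[OF P(1)]
          by (subst smooth_on_cong[OF op, of _ P]) (auto simp: 1 chart_inv_coord[OF ch])
        then show ?thesis
          using 1 by (intro smooth_nearI[OF c c chart_dom_open[OF ch] True]) auto
      next
        case False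
        obtain c1 where c1: "c1 \<in> A" "p \<in> chart_dom c1" using obtain_chart p by blast
        note ch1 = charts[OF c1(1)]
        let ?W = "chart_dom c1 - chart_inv c ` K"
        have W: "openin X ?W" by (intro openin_diff chart_dom_open ch1 clK)
        have op1: "open (coord c1 ` ?W)" by (rule coord_open_image[OF ch1 W]) auto
        have "smooth_on (coord c1 ` ?W) (coord c1 \<circ> ext P \<circ> chart_inv c1)"
          by (subst smooth_on_cong[OF op1, of _ "\<lambda>u. u"]) (use op1 in \<open>auto simp: 2 chart_inv_coord[OF ch1] smooth_on_id\<close>)
        moreover have "p \<notin> chart_inv c ` K" using False chart_inv_in_dom[of _ c] K by blast
        ultimately show ?thesis
          using c1(2) 2 by (intro smooth_nearI[OF c1(1) c1(1) W]) auto
      qed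
    qed
    then show ?thesis using 1 2 by blast
  qed
  have Q: "\<forall>u. u \<notin> K \<longrightarrow> Q u = u" using P(3,5) by metis
  note p = *[OF P(1,3,5)] and q = *[OF P(2,4) Q]
  have ext_in: "ext P p = chart_inv c (P (coord c p))" if "p \<in> chart_dom c" for P p
    using that by (simp add: ext_def)
  have inv: "ext Q (ext P r) = r" "ext P (ext Q r) = r" for r
  proof -
    show "ext Q (ext P r) = r"
    proof (cases "r \<in> chart_dom c")
      case True
      then show ?thesis using p P(3) chart_inv_coord[OF ch True] by (simp add: ext_in[of "ext P r"])
    qed (simp add: ext_def)
    show "ext P (ext Q r) = r"
    proof (cases "r \<in> chart_dom c")
      case True
      then show ?thesis using q P(4) chart_inv_coord[OF ch True] by (simp add: ext_in[of "ext Q r"])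
    qed (simp add: ext_def)
  qed
  show ?thesis
  proof (rule that[of "ext P"])
    show "diffeomorphism X A (ext P)"
      using p q inv by (intro diffeomorphismI[where G = "ext Q"]) auto
    show "chart_jacobian c c (ext P) r = jacobian P (at (coord c r))" if "r \<in> chart_dom c" for r
      unfolding chart_jacobian_def
      by (rule jacobian_cong[OF op]) (use that p in \<open>auto simp: chart_inv_coord[OF ch]\<close>)
  qed (use p clK in auto)
qed

end

section \<open>Volume-preserving diffeomorphisms\<close>

locale riemannian_atlas = smooth_atlas X A for X :: "'a topology" and A +
  fixes g :: "'a chart \<Rightarrow> 'a \<Rightarrow> real^2^2"
  assumes metric: "riemannian_metric A g"
begin

lemma det_metric_pos:
  assumes c: "c \<in> A" "p \<in> chart_dom c" shows "det (g c p) > 0"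
proof -
  let ?G = "g c p"
  have sym: "transpose ?G = ?G" and pos: "\<And>v. v \<noteq> 0 \<Longrightarrow> 0 < v \<bullet> (?G *v v)"
    using metric[unfolded riemannian_metric_def, THEN conjunct2, THEN conjunct1, rule_format, OF c] by simp_all
  have "transpose ?G $ 1 $ 2 = ?G $ 1 $ 2" using sym by simp
  then have 12: "?G$1$2 = ?G$2$1" by (simp add: transpose_def)
  have "axis 1 1 \<noteq> (0::real^2)" by (simp add: axis_eq_0_iff)
  from pos[OF this] have 11: "?G$1$1 > 0"
    by (simp add: inner_vec_def sum_2 matrix_vector_mult_def axis_def)
  \<comment> \<open>This vector is orthogonal to the first row of the Gram matrix, so its squared
    length is the first entry times the determinant.\<close>
  define w where "w = (vector [- ?G$1$2, ?G$1$1] :: real^2)"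
  have "w \<noteq> 0" using 11 by (auto simp: w_def vec_eq_iff forall_2)
  from pos[OF this] have "?G$1$1 * det ?G > 0"
    by (simp add: inner_vec_def sum_2 matrix_vector_mult_def w_def det_2 12 algebra_simps)
  then show ?thesis using 11 by (simp add: zero_less_mult_iff)
qed

lemma area_density_pos: "c \<in> A \<Longrightarrow> p \<in> chart_dom c \<Longrightarrow> area_density g c p > 0"
  using det_metric_pos by (simp add: area_density_def)

lemma area_density_transition:
  assumes "c \<in> A" "c' \<in> A" "p \<in> chart_dom c" "p \<in> chart_dom c'"
  shows "area_density g c p = \<bar>det (transition_jacobian c c' p)\<bar> * area_density g c' p"
proof -
  have "g c p = transpose (transition_jacobian c c' p) ** g c' p ** transition_jacobian c c' p"
    using metric assms unfolding riemannian_metric_def by blast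
  then have "det (g c p) = (det (transition_jacobian c c' p))\<^sup>2 * det (g c' p)"
    by (simp add: det_mul det_transpose power2_eq_square)
  then show ?thesis
    by (simp add: area_density_def real_sqrt_mult)
qed

lemma smooth_area_density:
  assumes c: "c \<in> A" shows "smooth_on (coord c ` chart_dom c) (area_density g c \<circ> chart_inv c)"
proof -
  note op = coord_image_open[OF charts[OF c]]
  have "smooth_on (coord c ` chart_dom c) (g c \<circ> chart_inv c)"
    using metric c by (auto simp: riemannian_metric_def)
  then have e: "smooth_on (coord c ` chart_dom c) (\<lambda>u. (g c (chart_inv c u)) $ i $ j)" for i j
    by (intro smooth_on_vec_nth op) (simp add: o_def)
  have d: "smooth_on (coord c ` chart_dom c) (\<lambda>u. det (g c (chart_inv c u)))"
    unfolding det_2 by (intro smooth_on_diff smooth_on_mult e op)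
  have "smooth_on (coord c ` chart_dom c) (\<lambda>u. sqrt (det (g c (chart_inv c u))))"
    by (rule smooth_on_compose[OF op _ d smooth_on_sqrt])
      (use det_metric_pos[OF c] chart_inv_in_dom[of _ c] in auto)
  then show ?thesis by (simp add: o_def area_density_def)
qed

text \<open>Volume preservation is independent of the charts: a change of chart at
  \<open>F p\<close> is absorbed by the density there, and one at p multiplies both sides by the
  same factor. So one pair of charts per point suffices.\<close>

lemma SDiffI:
  assumes F: "diffeomorphism X A F"
    and vol: "\<And>p. p \<in> topspace X \<Longrightarrow> \<exists>c\<in>A. \<exists>c'\<in>A. p \<in> chart_dom c \<and> F p \<in> chart_dom c' \<and>
      area_density g c' (F p) * \<bar>det (chart_jacobian c c' F p)\<bar> = area_density g c p"
  shows "F \<in> SDiff X A g"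
proof -
  have "area_density g c1' (F p) * \<bar>det (chart_jacobian c1 c1' F p)\<bar> = area_density g c1 p"
    if c1: "c1 \<in> A" "c1' \<in> A" "p \<in> chart_dom c1" "F p \<in> chart_dom c1'" for c1 c1' p
  proof -
    have "p \<in> topspace X" using subsetD[OF chart_dom_subset[OF c1(1)] c1(3)] .
    then obtain c c' where c: "c \<in> A" "c' \<in> A" "p \<in> chart_dom c" "F p \<in> chart_dom c'"
      and eq: "area_density g c' (F p) * \<bar>det (chart_jacobian c c' F p)\<bar> = area_density g c p"
      using vol by blast
    have "chart_jacobian c1 c1' F p =
        transition_jacobian c' c1' (F p) ** chart_jacobian c c' F p ** transition_jacobian c1 c p"
      using chart_jacobian_change[OF diffeomorphism_inverse(1)[OF F]] c c1 by blast
    then have "area_density g c1' (F p) * \<bar>det (chart_jacobian c1 c1' F p)\<bar> =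
        (\<bar>det (transition_jacobian c' c1' (F p))\<bar> * area_density g c1' (F p)) *
          \<bar>det (chart_jacobian c c' F p)\<bar> * \<bar>det (transition_jacobian c1 c p)\<bar>"
      by (simp add: det_mul abs_mult)
    also have "\<dots> = area_density g c' (F p) * \<bar>det (chart_jacobian c c' F p)\<bar> * \<bar>det (transition_jacobian c1 c p)\<bar>"
      using area_density_transition[of c' c1' "F p"] c c1 by simp
    also have "\<dots> = area_density g c1 p"
      using eq area_density_transition[of c1 c p] c c1 by simp
    finally show ?thesis .
  qed
  then show ?thesis using F by (auto simp: SDiff_def)
qed

lemma SDiffD:
  assumes "F \<in> SDiff X A g"
  shows "diffeomorphism X A F"
    and "c \<in> A \<Longrightarrow> c' \<in> A \<Longrightarrow> p \<in> chart_dom c \<Longrightarrow> F p \<in> chart_dom c' \<Longrightarrow>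
      area_density g c' (F p) * \<bar>det (chart_jacobian c c' F p)\<bar> = area_density g c p"
  using assms by (auto simp: SDiff_def)

lemma SDiff_id: "(\<lambda>p. p) \<in> SDiff X A g"
proof (rule SDiffI)
  show "diffeomorphism X A (\<lambda>p. p)"
    by (rule diffeomorphismI[OF smooth_map_id smooth_map_id]) auto
  show "\<exists>c\<in>A. \<exists>c'\<in>A. p \<in> chart_dom c \<and> p \<in> chart_dom c' \<and>
      area_density g c' p * \<bar>det (transition_jacobian c c' p)\<bar> = area_density g c p" if "p \<in> topspace X" for p
    using obtain_chart[OF that] area_density_transition by (metis mult.commute)
qed

lemma SDiff_compose:
  assumes F: "F \<in> SDiff X A g" and G: "G \<in> SDiff X A g" shows "(\<lambda>p. G (F p)) \<in> SDiff X A g"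
proof (rule SDiffI)
  note ax = smooth_atlas_axioms
  note F' = diffeomorphism_inverse[OF SDiffD(1)[OF F]] and G' = diffeomorphism_inverse[OF SDiffD(1)[OF G]]
  show "diffeomorphism X A (\<lambda>p. G (F p))"
    by (rule diffeomorphism_compose[OF SDiffD(1)[OF F] SDiffD(1)[OF G]])
  fix p assume p: "p \<in> topspace X"
  obtain c where c: "c \<in> A" "p \<in> chart_dom c" using obtain_chart p by blast
  obtain c' where c': "c' \<in> A" "F p \<in> chart_dom c'"
    using obtain_chart smooth_map_topspace[OF F'(1) p] by blast
  obtain c'' where c'': "c'' \<in> A" "G (F p) \<in> chart_dom c''"
    using obtain_chart smooth_map_topspace[OF G'(1) smooth_map_topspace[OF F'(1) p]] by blast
  have "chart_jacobian c c'' (\<lambda>q. G (F q)) p = chart_jacobian c' c'' G (F p) ** chart_jacobian c c' F p"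
    by (rule chart_jacobian_compose[OF ax ax ax F'(1) G'(1)]) fact+
  then have "area_density g c'' (G (F p)) * \<bar>det (chart_jacobian c c'' (\<lambda>q. G (F q)) p)\<bar> =
      (area_density g c'' (G (F p)) * \<bar>det (chart_jacobian c' c'' G (F p))\<bar>) * \<bar>det (chart_jacobian c c' F p)\<bar>"
    by (simp add: det_mul abs_mult)
  also have "\<dots> = area_density g c p"
    using SDiffD(2)[OF F c(1) c'(1) c(2) c'(2)] SDiffD(2)[OF G c'(1) c''(1) c'(2) c''(2)] by simp
  finally show "\<exists>c\<in>A. \<exists>c'\<in>A. p \<in> chart_dom c \<and> G (F p) \<in> chart_dom c' \<and>
      area_density g c' (G (F p)) * \<bar>det (chart_jacobian c c' (\<lambda>p. G (F p)) p)\<bar> = area_density g c p"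
    using c c'' by blast
qed

lemma SDiff_inverse:
  assumes F: "F \<in> SDiff X A g" shows "inv_into (topspace X) F \<in> SDiff X A g"
proof (rule SDiffI)
  let ?G = "inv_into (topspace X) F"
  note d = SDiffD(1)[OF F]
  note F' = diffeomorphism_inverse[OF d]
  show "diffeomorphism X A ?G"
    by (rule diffeomorphismI[where G = F]) (use F' in auto)
  fix q assume q: "q \<in> topspace X"
  define p where "p = ?G q"
  have p: "p \<in> topspace X" "F p = q" using F' q smooth_map_topspace[OF F'(2) q] by (auto simp: p_def)
  obtain c where c: "c \<in> A" "p \<in> chart_dom c" using obtain_chart p by blast
  obtain c' where c': "c' \<in> A" "q \<in> chart_dom c'" using obtain_chart q by blast
  have "\<bar>det (chart_jacobian c' c ?G q)\<bar> * \<bar>det (chart_jacobian c c' F p)\<bar> = 1"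
    using diffeomorphism_det_mult[OF d c(1) c'(1) c(2)] c'(2) p(2) by (simp add: abs_mult[symmetric])
  moreover have "area_density g c' q * \<bar>det (chart_jacobian c c' F p)\<bar> = area_density g c p"
    using SDiffD(2)[OF F c(1) c'(1) c(2)] c' p by simp
  ultimately have "area_density g c p * \<bar>det (chart_jacobian c' c ?G q)\<bar> = area_density g c' q"
    by algebra
  then show "\<exists>c\<in>A. \<exists>c'\<in>A. q \<in> chart_dom c \<and> ?G q \<in> chart_dom c' \<and>
      area_density g c' (?G q) * \<bar>det (chart_jacobian c c' ?G q)\<bar> = area_density g c q"
    using c c' by (intro bexI[of _ c'] bexI[of _ c]) (auto simp: p_def)
qed

text \<open>The support in U serves to keep other vortices fixed. The sign of the determinant is
  recorded because it decides on which sheet over the chart the lift takes the oriented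
  point.\<close>

lemma local_SDiff_move:
  assumes c: "c \<in> A" "p \<in> chart_dom c" and U: "openin X U" "p \<in> U"
  obtains V where "openin X V" "p \<in> V" "V \<subseteq> chart_dom c"
    "\<And>q. q \<in> V \<Longrightarrow> \<exists>F K. F \<in> SDiff X A g \<and> F p = q \<and> closedin X K \<and> K \<subseteq> U \<and> (\<forall>r. r \<notin> K \<longrightarrow> F r = r) \<and>
      det (chart_jacobian c c F p) > 0"
proof -
  note ch = charts[OF c(1)]
  define S where "S = coord c ` (chart_dom c \<inter> U)"
  have op: "open S"
    unfolding S_def by (rule coord_open_image[OF ch]) (use U chart_dom_open[OF ch] in auto)
  have Sd: "S \<subseteq> coord c ` chart_dom c" by (auto simp: S_def)
  define \<rho> where "\<rho> = area_density g c \<circ> chart_inv c"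
  have pos: "\<rho> u > 0" if "u \<in> S" for u
    using area_density_pos[OF c(1) chart_inv_in_dom[OF subsetD[OF Sd that]]] by (simp add: \<rho>_def)
  have sm: "smooth_on S \<rho>"
    unfolding \<rho>_def by (rule smooth_on_subset[OF smooth_area_density[OF c(1)] Sd])
  have u0: "coord c p \<in> S" using c U by (auto simp: S_def)
  obtain T where T: "open T" "coord c p \<in> T" "T \<subseteq> S"
    and mv: "\<And>w. w \<in> T \<Longrightarrow> \<exists>P Q K. compact K \<and> K \<subseteq> S \<and> smooth_on UNIV P \<and> smooth_on UNIV Q \<and>
       (\<forall>u. Q (P u) = u) \<and> (\<forall>u. P (Q u) = u) \<and> (\<forall>u. u \<notin> K \<longrightarrow> P u = u) \<and> P (coord c p) = w \<and>
       (\<forall>u\<in>S. \<rho> (P u) * det (jacobian P (at u)) = \<rho> u)"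
    by (rule local_area_preserving_move[OF op sm u0 pos]) blast+
  let ?V = "{q \<in> chart_dom c. coord c q \<in> T}"
  have "\<exists>F K. F \<in> SDiff X A g \<and> F p = q \<and> closedin X K \<and> K \<subseteq> U \<and> (\<forall>r. r \<notin> K \<longrightarrow> F r = r) \<and>
      det (chart_jacobian c c F p) > 0" if q: "q \<in> ?V" for q
  proof -
    obtain P Q K where K: "compact K" "K \<subseteq> S" and P: "smooth_on UNIV P" "smooth_on UNIV Q"
       "\<And>u. Q (P u) = u" "\<And>u. P (Q u) = u" "\<forall>u. u \<notin> K \<longrightarrow> P u = u" and Pp: "P (coord c p) = coord c q"
       and vol: "\<And>u. u \<in> S \<Longrightarrow> \<rho> (P u) * det (jacobian P (at u)) = \<rho> u"
      using mv[of "coord c q"] q by blast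
    have Kd: "K \<subseteq> coord c ` chart_dom c" using K Sd by blast
    obtain F where F: "diffeomorphism X A F"
      "\<And>p. p \<in> chart_dom c \<Longrightarrow> F p \<in> chart_dom c \<and> coord c (F p) = P (coord c p)"
      "closedin X (chart_inv c ` K)" "\<And>p. p \<notin> chart_inv c ` K \<Longrightarrow> F p = p"
      "\<And>p. p \<in> chart_dom c \<Longrightarrow> chart_jacobian c c F p = jacobian P (at (coord c p))"
      by (rule chart_supported_diffeomorphism[OF c(1) K(1) Kd P]) blast
    have KU: "chart_inv c ` K \<subseteq> U"
      using K chart_inv_coord[OF ch] by (force simp: S_def)
    have vol': "area_density g c (F r) * det (chart_jacobian c c F r) = area_density g c r"
      if r: "r \<in> chart_dom c" "coord c r \<in> S" for r
    proof -
      have Fr: "F r \<in> chart_dom c" "P (coord c r) = coord c (F r)" using F(2)[OF r(1)] by simp_all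
      show ?thesis
        using vol[OF r(2)] by (simp add: \<rho>_def Fr chart_inv_coord[OF ch] r(1) F(5)[OF r(1)])
    qed
    have "F \<in> SDiff X A g"
    proof (rule SDiffI[OF F(1)])
      fix r assume r: "r \<in> topspace X"
      show "\<exists>c\<in>A. \<exists>c'\<in>A. r \<in> chart_dom c \<and> F r \<in> chart_dom c' \<and>
          area_density g c' (F r) * \<bar>det (chart_jacobian c c' F r)\<bar> = area_density g c r"
      proof (cases "r \<in> chart_inv c ` K")
        case True
        then have rc: "r \<in> chart_dom c" "coord c r \<in> S"
          using K(2) Kd chart_inv_in_dom[of _ c] coord_chart_inv[of _ c] by (auto simp: subset_iff)
        have "area_density g c r > 0" "area_density g c (F r) > 0"
          using area_density_pos[OF c(1)] rc F(2) by auto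
        \<comment> \<open>The coordinate formula has no absolute value; with positive densities on
          both sides it forces a positive determinant, so the absolute value in \<open>SDiff\<close>
          may be inserted.\<close>
        then have "det (chart_jacobian c c F r) > 0"
          using vol'[OF rc] by (metis zero_less_mult_pos)
        then show ?thesis using vol'[OF rc] rc c F(2) by (intro bexI[of _ c]) auto
      next
        case False
        obtain c1 where c1: "c1 \<in> A" "r \<in> chart_dom c1" using obtain_chart r by blast
        have "chart_jacobian c1 c1 F r = transition_jacobian c1 c1 r"
          by (rule chart_jacobian_cong[OF charts[OF c1(1)] openin_diff[OF openin_topspace F(3)]])
            (use F(4) False r c1 in auto)
        then show ?thesis
          using c1 F(4)[OF False] transition_jacobian_self[OF c1] by (intro bexI[of _ c1]) auto
      qed
    qed
    moreover have "F p = q"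
      using Pp F(2)[OF c(2)] q inj_onD[OF coord_inj[OF ch]] by auto
    moreover have "det (chart_jacobian c c F p) > 0"
      using vol'[OF c(2) u0] area_density_pos[OF c(1)] F(2)[OF c(2)] c
      by (metis zero_less_mult_pos)
    ultimately show ?thesis using F(3,4) KU by blast
  qed
  moreover have "openin X ?V" by (rule coord_open_vimage[OF ch T(1)])
  ultimately show ?thesis using that[of ?V] c T by blast
qed

end

section \<open>The orientation double cover\<close>

definition cover_chart ::
  "'a topology \<Rightarrow> 'a chart set \<Rightarrow> 'a chart \<Rightarrow> real \<Rightarrow> 'a oriented_point chart" where
  "cover_chart X A c s = (sheet X A c s (chart_dom c), coord c \<circ> cover_proj)"

lemma cover_chart_simps [simp]:
  "chart_dom (cover_chart X A c s) = sheet X A c s (chart_dom c)"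
  "coord (cover_chart X A c s) = coord c \<circ> cover_proj"
  by (simp_all add: cover_chart_def)

lemma cover_atlas_eq: "cover_atlas X A = {cover_chart X A c s | c s. c \<in> A \<and> s \<in> {-1, 1}}"
  by (simp add: cover_atlas_def cover_chart_def)

lemma cover_atlasE:
  assumes "d \<in> cover_atlas X A"
  obtains c s where "c \<in> A" "s \<in> {-1, 1}" "d = cover_chart X A c s"
  using assms unfolding cover_atlas_eq by blast

lemma cover_chart_in_atlas: "c \<in> A \<Longrightarrow> s \<in> {-1, 1} \<Longrightarrow> cover_chart X A c s \<in> cover_atlas X A"
  unfolding cover_atlas_eq by blast

lemma mem_sheet: "z \<in> sheet X A c s V \<longleftrightarrow> z \<in> double_cover X A \<and> cover_proj z \<in> V \<and> snd z c = s"
  by (simp add: sheet_def)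

lemma mem_double_cover: "z \<in> double_cover X A \<longleftrightarrow> cover_proj z \<in> topspace X \<and> snd z \<in> orientations_at A (cover_proj z)"
  by (cases z) (simp add: double_cover_def cover_proj_def)

lemma oriented_point_eqI: "cover_proj z = cover_proj w \<Longrightarrow> snd z = snd w \<Longrightarrow> z = w"
  by (simp add: cover_proj_def prod_eq_iff)

lemma cover_proj_deck [simp]: "cover_proj (deck_involution z) = cover_proj z"
  and snd_deck [simp]: "snd (deck_involution z) c = - snd z c"
  and deck_deck [simp]: "deck_involution (deck_involution z) = z"
  by (simp_all add: cover_proj_def deck_involution_def)

lemma orientation_values:
  "\<omega> \<in> orientations_at A p \<Longrightarrow> c \<in> A \<Longrightarrow> p \<in> chart_dom c \<Longrightarrow> \<omega> c \<in> {-1, 1}"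
proof -
  assume *: "\<omega> \<in> orientations_at A p" "c \<in> A" "p \<in> chart_dom c"
  then have "if c \<in> A \<and> p \<in> chart_dom c then \<omega> c \<in> {-1, 1} else \<omega> c = 0"
    unfolding orientations_at_def by blast
  then show ?thesis by (simp only: *(2,3) if_True simp_thms)
qed

lemma orientation_outside:
  "\<omega> \<in> orientations_at A p \<Longrightarrow> \<not> (c \<in> A \<and> p \<in> chart_dom c) \<Longrightarrow> \<omega> c = 0"
proof -
  assume *: "\<omega> \<in> orientations_at A p" "\<not> (c \<in> A \<and> p \<in> chart_dom c)"
  then have "if c \<in> A \<and> p \<in> chart_dom c then \<omega> c \<in> {-1, 1} else \<omega> c = 0"
    unfolding orientations_at_def by blast
  then show ?thesis by (simp only: *(2) if_False)
qed

lemma orientation_transition: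
  "\<omega> \<in> orientations_at A p \<Longrightarrow> c \<in> A \<Longrightarrow> c' \<in> A \<Longrightarrow> p \<in> chart_dom c \<Longrightarrow> p \<in> chart_dom c' \<Longrightarrow>
    \<omega> c' = sgn (det (transition_jacobian c c' p)) * \<omega> c"
  unfolding orientations_at_def by blast

lemma orientations_atI:
  assumes "\<And>c. c \<in> A \<Longrightarrow> p \<in> chart_dom c \<Longrightarrow> \<omega> c \<in> {-1, 1}"
    and "\<And>c. \<not> (c \<in> A \<and> p \<in> chart_dom c) \<Longrightarrow> \<omega> c = 0"
    and "\<And>c c'. c \<in> A \<Longrightarrow> c' \<in> A \<Longrightarrow> p \<in> chart_dom c \<Longrightarrow> p \<in> chart_dom c' \<Longrightarrow>
      \<omega> c' = sgn (det (transition_jacobian c c' p)) * \<omega> c"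
  shows "\<omega> \<in> orientations_at A p"
  unfolding orientations_at_def
proof (intro CollectI conjI allI ballI impI)
  show "if c \<in> A \<and> p \<in> chart_dom c then \<omega> c \<in> {-1, 1} else \<omega> c = 0" for c
    using assms(1,2)[of c] by (cases "c \<in> A \<and> p \<in> chart_dom c") simp_all
  show "\<omega> c' = sgn (det (transition_jacobian c c' p)) * \<omega> c"
    if "c \<in> A" "c' \<in> A" "p \<in> chart_dom c \<inter> chart_dom c'" for c c'
    using assms(3) that by blast
qed

lemma orientation_unique:
  assumes "\<omega> \<in> orientations_at A p" "\<omega>' \<in> orientations_at A p" "c \<in> A" "p \<in> chart_dom c" "\<omega> c = \<omega>' c"
  shows "\<omega> = \<omega>'"
proof
  fix c'
  show "\<omega> c' = \<omega>' c'"
  proof (cases "c' \<in> A \<and> p \<in> chart_dom c'")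
    case True
    then show ?thesis
      using orientation_transition[OF assms(1,3) _ assms(4), of c']
        orientation_transition[OF assms(2,3) _ assms(4), of c'] assms(5) by simp
  next
    case False
    then show ?thesis using orientation_outside assms(1,2) by metis
  qed
qed

lemma orientation_minus:
  assumes "\<omega> \<in> orientations_at A p" shows "(\<lambda>c. - \<omega> c) \<in> orientations_at A p"
proof (rule orientations_atI)
  show "- \<omega> c \<in> {-1, 1}" if "c \<in> A" "p \<in> chart_dom c" for c
    using orientation_values[OF assms that] by auto
  show "- \<omega> c = 0" if "\<not> (c \<in> A \<and> p \<in> chart_dom c)" for c
    using orientation_outside[OF assms that] by simp
  show "- \<omega> c' = sgn (det (transition_jacobian c c' p)) * - \<omega> c"
    if "c \<in> A" "c' \<in> A" "p \<in> chart_dom c" "p \<in> chart_dom c'" for c c'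
    using orientation_transition[OF assms that] by simp
qed

lemma deck_in_double_cover: "z \<in> double_cover X A \<Longrightarrow> deck_involution z \<in> double_cover X A"
  using orientation_minus by (force simp: double_cover_def deck_involution_def)

text \<open>Signs of Jacobian determinants are locally constant; the continuity of the involution
  and of all lifts rests on this. Multiplication by the sign at p turns equality of signs into the
  open condition h > 0.\<close>

lemma jacobian_sign_open:
  assumes X: "smooth_atlas X A" and Y: "smooth_atlas Y B" and F: "smooth_map X A Y B F"
    and c: "c \<in> A" "c' \<in> B" and p: "det (chart_jacobian c c' F p) \<noteq> 0"
  shows "openin X {q \<in> chart_dom c. F q \<in> chart_dom c' \<and>
    sgn (det (chart_jacobian c c' F q)) = sgn (det (chart_jacobian c c' F p))}"
proof -
  interpret X: smooth_atlas X A by fact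
  let ?D = "{q \<in> chart_dom c. F q \<in> chart_dom c'}"
  let ?f = "coord c' \<circ> F \<circ> chart_inv c"
  define h where "h = (\<lambda>u. sgn (det (chart_jacobian c c' F p)) * det (jacobian ?f (at u)))"
  note op = chart_rep_domain_open[OF X Y F c]
  have e: "smooth_on (coord c ` ?D) (\<lambda>u. frechet_derivative ?f (at u) v $ i)" for v i
    by (rule smooth_on_vec_nth[OF op(2) smooth_on_frechet_derivative[OF smooth_mapD[OF F c]]])
  have "smooth_on (coord c ` ?D) h"
    unfolding h_def det_2 jacobian_def matrix_def
    by (simp, intro smooth_on_mult smooth_on_diff smooth_on_const op(2) e)
  then have cont: "continuous_on (coord c ` ?D) h"
    by (rule smooth_on_imp_continuous_on)
  have "open (h -` {0<..} \<inter> coord c ` ?D)"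
    using cont unfolding continuous_on_open_vimage[OF op(2)] by (rule allE) (erule mp, rule open_greaterThan)
  from coord_open_vimage[OF X.charts[OF c(1)] this]
  have "openin X {q \<in> chart_dom c. coord c q \<in> h -` {0<..} \<inter> coord c ` ?D}" .
  also have "{q \<in> chart_dom c. coord c q \<in> h -` {0<..} \<inter> coord c ` ?D} = {q \<in> chart_dom c. F q \<in> chart_dom c' \<and>
    sgn (det (chart_jacobian c c' F q)) = sgn (det (chart_jacobian c c' F p))}" (is "?L = ?R")
  proof -
    have h: "h (coord c q) > 0 \<longleftrightarrow> sgn (det (chart_jacobian c c' F q)) = sgn (det (chart_jacobian c c' F p))" for q
      using p by (auto simp: h_def chart_jacobian_def sgn_real_def zero_less_mult_iff)
    have "q \<in> ?D" if "q \<in> chart_dom c" "coord c q \<in> coord c ` ?D" for q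
    proof -
      obtain r where "r \<in> ?D" "coord c q = coord c r" using \<open>coord c q \<in> _\<close> by blast
      then show ?thesis using inj_onD[OF coord_inj[OF X.charts[OF c(1)]]] that(1) by blast
    qed
    then have "q \<in> ?L \<longleftrightarrow> q \<in> ?R" for q using h[of q] by blast
    then show ?thesis by blast
  qed
  finally show ?thesis .
qed

section \<open>Fibres, topology and smooth structure of the double cover\<close>

context smooth_atlas
begin

text \<open>The sign in one chart forces all others through the transition determinants; their
  multiplicativity is the consistency condition.\<close>

lemma orientation_exists:
  assumes c: "c \<in> A" "p \<in> chart_dom c" and s: "s \<in> {-1, 1}"
  obtains \<omega> where "\<omega> \<in> orientations_at A p" "\<omega> c = s"
proof -
  define \<omega> where "\<omega> = (\<lambda>c'. if c' \<in> A \<and> p \<in> chart_dom c' then sgn (det (transition_jacobian c c' p)) * s else 0)"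
  have "\<omega> \<in> orientations_at A p"
  proof (rule orientations_atI)
    fix c' assume c': "c' \<in> A" "p \<in> chart_dom c'"
    show "\<omega> c' \<in> {-1, 1}"
      using det_transition_nonzero[OF c(1) c'(1) c(2) c'(2)] s c' by (auto simp: \<omega>_def sgn_real_def)
  next
    fix c' c'' assume c': "c' \<in> A" "c'' \<in> A" "p \<in> chart_dom c'" "p \<in> chart_dom c''"
    show "\<omega> c'' = sgn (det (transition_jacobian c' c'' p)) * \<omega> c'"
      using transition_jacobian_compose[OF c(1) c'(1,2) c(2) c'(3,4)] c'
      by (simp add: \<omega>_def det_mul sgn_mult)
  qed (unfold \<omega>_def, rule if_not_P)
  moreover have "\<omega> c = s"
    using c transition_jacobian_self[OF c] by (simp add: \<omega>_def)
  ultimately show ?thesis using that by blast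
qed

lemma fibre_cases:
  assumes "z \<in> double_cover X A" "w \<in> double_cover X A" "cover_proj w = cover_proj z"
  shows "w = z \<or> w = deck_involution z"
proof -
  have z: "snd z \<in> orientations_at A (cover_proj z)" "snd w \<in> orientations_at A (cover_proj z)" "cover_proj z \<in> topspace X"
    using assms by (auto simp: mem_double_cover)
  obtain c where c: "c \<in> A" "cover_proj z \<in> chart_dom c" using obtain_chart[OF z(3)] by blast
  have "snd w c = snd z c \<or> snd w c = - snd z c"
    using orientation_values[OF z(1) c] orientation_values[OF z(2) c] by auto
  then show ?thesis
  proof
    assume "snd w c = snd z c"
    then show ?thesis using orientation_unique[OF z(2,1) c] oriented_point_eqI assms(3) by blast
  next
    assume "snd w c = - snd z c"
    then have "snd w = (\<lambda>c. - snd z c)" using orientation_unique[OF z(2) orientation_minus[OF z(1)] c] by simp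
    then have "w = deck_involution z" using assms(3) by (simp add: deck_involution_def cover_proj_def prod_eq_iff)
    then show ?thesis ..
  qed
qed

lemma deck_neq:
  assumes "z \<in> double_cover X A" shows "deck_involution z \<noteq> z"
proof -
  have z: "snd z \<in> orientations_at A (cover_proj z)" "cover_proj z \<in> topspace X"
    using assms by (auto simp: mem_double_cover)
  obtain c where c: "c \<in> A" "cover_proj z \<in> chart_dom c" using obtain_chart[OF z(2)] by blast
  have "snd z c \<noteq> - snd z c" using orientation_values[OF z(1) c] by auto
  then show ?thesis by (metis snd_deck)
qed

lemma sheet_proj_image:
  assumes "c \<in> A" "s \<in> {-1, 1}" "V \<subseteq> chart_dom c"
  shows "cover_proj ` sheet X A c s V = V"
proof
  show "cover_proj ` sheet X A c s V \<subseteq> V" by (auto simp: mem_sheet)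
  show "V \<subseteq> cover_proj ` sheet X A c s V"
  proof
    fix p assume p: "p \<in> V"
    then obtain \<omega> where "\<omega> \<in> orientations_at A p" "\<omega> c = s"
      using orientation_exists[OF assms(1) _ assms(2)] assms(3) by blast
    moreover have "p \<in> topspace X" using p assms chart_dom_subset by blast
    ultimately have "(p, \<omega>) \<in> sheet X A c s V" "cover_proj (p, \<omega>) = p"
      using p by (auto simp: mem_sheet mem_double_cover cover_proj_def)
    then show "p \<in> cover_proj ` sheet X A c s V" by (metis imageI)
  qed
qed

lemma sheet_inj: "c \<in> A \<Longrightarrow> V \<subseteq> chart_dom c \<Longrightarrow> inj_on cover_proj (sheet X A c s V)"
proof (rule inj_onI)
  fix z w assume c: "c \<in> A" "V \<subseteq> chart_dom c"
    and zw: "z \<in> sheet X A c s V" "w \<in> sheet X A c s V" "cover_proj z = cover_proj w"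
  then have "snd z = snd w"
    using orientation_unique[of "snd z" A "cover_proj z" "snd w" c] by (auto simp: mem_sheet mem_double_cover)
  then show "z = w" using zw oriented_point_eqI by blast
qed

text \<open>The generating sheets are in fact a basis. The only case with content is the
  intersection of sheets over two different charts.\<close>

lemma openin_cover_iff:
  "openin (cover_topology X A) W \<longleftrightarrow> W \<subseteq> double_cover X A \<and>
    (\<forall>z\<in>W. \<exists>c\<in>A. \<exists>V. openin X V \<and> V \<subseteq> chart_dom c \<and> cover_proj z \<in> V \<and> sheet X A c (snd z c) V \<subseteq> W)"
    (is "_ \<longleftrightarrow> ?R W")
proof
  let ?S = "{sheet X A c s V | c s V. c \<in> A \<and> s \<in> {-1, 1} \<and> openin X V \<and> V \<subseteq> chart_dom c}"
  assume "openin (cover_topology X A) W"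
  then have "generate_topology_on ?S W"
    by (simp add: cover_topology_def openin_topology_generated_by_iff)
  then show "?R W"
  proof induction
    case Empty
    then show ?case by simp
  next
    case (Int W1 W2)
    show ?case
    proof (intro conjI ballI)
      show "W1 \<inter> W2 \<subseteq> double_cover X A" using Int.IH(1) by blast
      fix z assume z: "z \<in> W1 \<inter> W2"
      obtain c1 V1 where 1: "c1 \<in> A" "openin X V1" "V1 \<subseteq> chart_dom c1" "cover_proj z \<in> V1"
        "sheet X A c1 (snd z c1) V1 \<subseteq> W1" using Int.IH(1) z by (meson IntD1)
      obtain c2 V2 where 2: "c2 \<in> A" "openin X V2" "V2 \<subseteq> chart_dom c2" "cover_proj z \<in> V2"
        "sheet X A c2 (snd z c2) V2 \<subseteq> W2" using Int.IH(2) z by (meson IntD2)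
      let ?d = "\<lambda>q. sgn (det (transition_jacobian c1 c2 q))"
      \<comment> \<open>On this set the transition sign is that at z, so a point in the sheet of z
        over c1 is also in the sheet of z over c2.\<close>
      define V where "V = V1 \<inter> V2 \<inter> {q \<in> chart_dom c1. q \<in> chart_dom c2 \<and> ?d q = ?d (cover_proj z)}"
      have zd: "cover_proj z \<in> chart_dom c1" "cover_proj z \<in> chart_dom c2" using 1 2 by auto
      have zo: "snd z \<in> orientations_at A (cover_proj z)"
        using Int.IH(1) z by (auto simp: mem_double_cover)
      have "openin X V"
        unfolding V_def by (intro openin_Int 1 2 jacobian_sign_open[OF smooth_atlas_axioms smooth_atlas_axioms smooth_map_id]
            det_transition_nonzero zd)
      moreover have "sheet X A c1 (snd z c1) V \<subseteq> W1 \<inter> W2"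
      proof
        fix w assume w: "w \<in> sheet X A c1 (snd z c1) V"
        then have w': "w \<in> double_cover X A" "cover_proj w \<in> V" "snd w c1 = snd z c1" by (auto simp: mem_sheet)
        have wd: "cover_proj w \<in> chart_dom c1" "cover_proj w \<in> chart_dom c2" "?d (cover_proj w) = ?d (cover_proj z)"
          using w' by (auto simp: V_def)
        have wo: "snd w \<in> orientations_at A (cover_proj w)" using w' by (simp add: mem_double_cover)
        have "snd w c2 = snd z c2"
          using orientation_transition[OF wo 1(1) 2(1) wd(1,2)] orientation_transition[OF zo 1(1) 2(1) zd] w'(3) wd(3)
          by simp
        then have "w \<in> sheet X A c1 (snd z c1) V1" "w \<in> sheet X A c2 (snd z c2) V2"
          using w' by (auto simp: mem_sheet V_def)
        then show "w \<in> W1 \<inter> W2" using 1 2 by blast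
      qed
      moreover have "V \<subseteq> chart_dom c1" "cover_proj z \<in> V" using 1 2 zd by (auto simp: V_def)
      ultimately show "\<exists>c\<in>A. \<exists>V. openin X V \<and> V \<subseteq> chart_dom c \<and> cover_proj z \<in> V \<and> sheet X A c (snd z c) V \<subseteq> W1 \<inter> W2"
        using 1(1) by blast
    qed
  next
    case (UN K)
    show ?case
    proof (intro conjI ballI)
      show "\<Union>K \<subseteq> double_cover X A" using UN.IH by blast
      fix z assume "z \<in> \<Union>K"
      then obtain W where W: "W \<in> K" "z \<in> W" by blast
      then obtain c V where "c \<in> A" "openin X V" "V \<subseteq> chart_dom c" "cover_proj z \<in> V" "sheet X A c (snd z c) V \<subseteq> W"
        using UN.IH[OF W(1)] by meson
      then show "\<exists>c\<in>A. \<exists>V. openin X V \<and> V \<subseteq> chart_dom c \<and> cover_proj z \<in> V \<and> sheet X A c (snd z c) V \<subseteq> \<Union>K"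
        using W by blast
    qed
  next
    case (Basis W)
    then obtain c s V where W: "W = sheet X A c s V" and c: "c \<in> A" "openin X V" "V \<subseteq> chart_dom c" by blast
    show ?case
    proof (intro conjI ballI)
      show "W \<subseteq> double_cover X A" unfolding W sheet_def by blast
      fix z assume "z \<in> W"
      then have "cover_proj z \<in> V" "snd z c = s" by (auto simp: W mem_sheet)
      then show "\<exists>c\<in>A. \<exists>V. openin X V \<and> V \<subseteq> chart_dom c \<and> cover_proj z \<in> V \<and> sheet X A c (snd z c) V \<subseteq> W"
        using c W by blast
    qed
  qed
next
  assume R: "?R W"
  show "openin (cover_topology X A) W"
    unfolding openin_subopen[of _ W]
  proof
    fix z assume z: "z \<in> W"
    then obtain c V where c: "c \<in> A" "openin X V" "V \<subseteq> chart_dom c" "cover_proj z \<in> V" "sheet X A c (snd z c) V \<subseteq> W"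
      using R by meson
    have zC: "z \<in> double_cover X A" using R z by blast
    then have "snd z c \<in> {-1, 1}"
      by (intro orientation_values[OF _ c(1) subsetD[OF c(3,4)]]) (simp add: mem_double_cover)
    then have "openin (cover_topology X A) (sheet X A c (snd z c) V)"
      unfolding cover_topology_def using c by (intro topology_generated_by_Basis) blast
    moreover have "z \<in> sheet X A c (snd z c) V" using zC c by (simp add: mem_sheet)
    ultimately show "\<exists>T. openin (cover_topology X A) T \<and> z \<in> T \<and> T \<subseteq> W" using c by blast
  qed
qed

lemma openin_sheet:
  assumes "c \<in> A" "openin X V" "V \<subseteq> chart_dom c"
  shows "openin (cover_topology X A) (sheet X A c s V)"
proof -
  have "\<exists>c\<in>A. \<exists>V'. openin X V' \<and> V' \<subseteq> chart_dom c \<and> cover_proj z \<in> V' \<and> sheet X A c (snd z c) V' \<subseteq> sheet X A c' s V"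
    if "c' = c" "z \<in> sheet X A c s V" for z c'
    using assms that by (intro bexI[of _ c] exI[of _ V]) (auto simp: mem_sheet)
  moreover have "sheet X A c s V \<subseteq> double_cover X A" by (auto simp: mem_sheet)
  ultimately show ?thesis unfolding openin_cover_iff by blast
qed

lemma topspace_cover: "topspace (cover_topology X A) = double_cover X A"
proof
  show "topspace (cover_topology X A) \<subseteq> double_cover X A"
    using openin_topspace[of "cover_topology X A"] unfolding openin_cover_iff by blast
  have "openin (cover_topology X A) (double_cover X A)"
    unfolding openin_cover_iff
  proof (intro conjI ballI)
    fix z assume "z \<in> double_cover X A"
    then obtain c where "c \<in> A" "cover_proj z \<in> chart_dom c" using obtain_chart by (auto simp: mem_double_cover)
    moreover have "sheet X A c (snd z c) (chart_dom c) \<subseteq> double_cover X A" by (auto simp: mem_sheet)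
    ultimately show "\<exists>c\<in>A. \<exists>V. openin X V \<and> V \<subseteq> chart_dom c \<and> cover_proj z \<in> V \<and> sheet X A c (snd z c) V \<subseteq> double_cover X A"
      using chart_dom_open[OF charts] by blast
  qed simp
  then show "double_cover X A \<subseteq> topspace (cover_topology X A)" by (rule openin_subset)
qed

lemma cover_proj_continuous: "continuous_map (cover_topology X A) X cover_proj"
  unfolding continuous_map_def
proof (intro conjI allI impI)
  show "cover_proj \<in> topspace (cover_topology X A) \<rightarrow> topspace X"
    by (auto simp: topspace_cover mem_double_cover)
  fix U assume U: "openin X U"
  show "openin (cover_topology X A) {z \<in> topspace (cover_topology X A). cover_proj z \<in> U}"
    unfolding openin_cover_iff topspace_cover
  proof (intro conjI ballI)
    fix z assume z: "z \<in> {z \<in> double_cover X A. cover_proj z \<in> U}"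
    then obtain c where c: "c \<in> A" "cover_proj z \<in> chart_dom c" using obtain_chart by (auto simp: mem_double_cover)
    have "openin X (U \<inter> chart_dom c)" using U chart_dom_open[OF charts[OF c(1)]] by (rule openin_Int)
    moreover have "sheet X A c (snd z c) (U \<inter> chart_dom c) \<subseteq> {z \<in> double_cover X A. cover_proj z \<in> U}"
      by (auto simp: mem_sheet)
    ultimately show "\<exists>c\<in>A. \<exists>V. openin X V \<and> V \<subseteq> chart_dom c \<and> cover_proj z \<in> V \<and>
        sheet X A c (snd z c) V \<subseteq> {z \<in> double_cover X A. cover_proj z \<in> U}"
      using c z by blast
  qed auto
qed

lemma cover_proj_open:
  assumes "openin (cover_topology X A) W" shows "openin X (cover_proj ` W)"
  unfolding openin_subopen[of _ "cover_proj ` W"]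
proof
  fix p assume "p \<in> cover_proj ` W"
  then obtain z where z: "z \<in> W" "p = cover_proj z" by blast
  have R: "W \<subseteq> double_cover X A" "\<forall>z\<in>W. \<exists>c\<in>A. \<exists>V. openin X V \<and> V \<subseteq> chart_dom c \<and> cover_proj z \<in> V \<and> sheet X A c (snd z c) V \<subseteq> W"
    using assms openin_cover_iff by blast+
  obtain c V where c: "c \<in> A" "openin X V" "V \<subseteq> chart_dom c" "cover_proj z \<in> V" "sheet X A c (snd z c) V \<subseteq> W"
    using R(2) z by meson
  have "snd z c \<in> {-1, 1}"
    using R(1) z by (intro orientation_values[OF _ c(1) subsetD[OF c(3,4)]]) (auto simp: mem_double_cover)
  then have "V \<subseteq> cover_proj ` W"
    using sheet_proj_image[OF c(1) _ c(3)] c(5) by blast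
  then show "\<exists>T. openin X T \<and> p \<in> T \<and> T \<subseteq> cover_proj ` W" using c z by blast
qed

lemma is_chart_cover_chart:
  assumes c: "c \<in> A" and s: "s \<in> {-1, 1}"
  shows "is_chart (cover_topology X A) (cover_chart X A c s)"
proof -
  let ?T = "cover_topology X A" and ?D = "sheet X A c s (chart_dom c)"
  note ch = charts[OF c]
  have D: "openin ?T ?D" by (rule openin_sheet[OF c chart_dom_open[OF ch] order_refl])
  have img: "cover_proj ` ?D = chart_dom c" by (rule sheet_proj_image[OF c s order_refl])
  have tD: "topspace (subtopology ?T ?D) = ?D" using openin_subset[OF D] by auto
  have 1: "continuous_map (subtopology ?T ?D) (subtopology X (chart_dom c)) cover_proj"
    unfolding continuous_map_in_subtopology
    using continuous_map_from_subtopology[OF cover_proj_continuous] img tD by auto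
  have "homeomorphic_map (subtopology ?T ?D) (top_of_set (coord c ` chart_dom c)) (coord c \<circ> cover_proj)"
  proof (rule bijective_open_imp_homeomorphic_map)
    show "continuous_map (subtopology ?T ?D) (top_of_set (coord c ` chart_dom c)) (coord c \<circ> cover_proj)"
      unfolding continuous_map_in_subtopology tD
    proof
      show "continuous_map (subtopology ?T ?D) euclidean (coord c \<circ> cover_proj)"
        by (rule continuous_map_compose[OF 1 coord_continuous[OF ch]])
      have "(coord c \<circ> cover_proj) ` ?D \<subseteq> coord c ` chart_dom c" unfolding image_comp[symmetric] img ..
      then show "coord c \<circ> cover_proj \<in> ?D \<rightarrow> coord c ` chart_dom c" by blast
    qed
    show "open_map (subtopology ?T ?D) (top_of_set (coord c ` chart_dom c)) (coord c \<circ> cover_proj)"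
      unfolding open_map_def
    proof (intro allI impI)
      fix W assume "openin (subtopology ?T ?D) W"
      then have W: "openin ?T W" "W \<subseteq> ?D" using openin_open_subtopology[OF D] by auto
      have sub: "cover_proj ` W \<subseteq> chart_dom c" using W(2) img by blast
      have "open (coord c ` cover_proj ` W)"
        by (rule coord_open_image[OF ch cover_proj_open[OF W(1)] sub])
      then show "openin (top_of_set (coord c ` chart_dom c)) ((coord c \<circ> cover_proj) ` W)"
        unfolding openin_open_eq[OF coord_image_open[OF ch]] using sub by (auto simp: image_comp)
    qed
    show "(coord c \<circ> cover_proj) ` topspace (subtopology ?T ?D) = topspace (top_of_set (coord c ` chart_dom c))"
      unfolding tD image_comp[symmetric] img by simp
    show "inj_on (coord c \<circ> cover_proj) (topspace (subtopology ?T ?D))"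
      unfolding tD by (rule comp_inj_on[OF sheet_inj[OF c order_refl]]) (simp add: img coord_inj[OF ch])
  qed
  moreover have "(coord c \<circ> cover_proj) ` ?D = coord c ` chart_dom c"
    by (simp only: image_comp[symmetric] img)
  ultimately show ?thesis
    unfolding is_chart_def using D coord_image_open[OF ch] by simp
qed

text \<open>Coordinate representations on the cover are thereby the same functions as on the
  surface, and smoothness above reduces to smoothness below.\<close>

lemma cover_proj_chart_inv:
  assumes c: "c \<in> A" and s: "s \<in> {-1, 1}" and u: "u \<in> coord c ` chart_dom c"
  shows "cover_proj (chart_inv (cover_chart X A c s) u) = chart_inv c u"
    and "chart_inv (cover_chart X A c s) u \<in> sheet X A c s (chart_dom c)"
proof -
  have "coord (cover_chart X A c s) ` chart_dom (cover_chart X A c s) = coord c ` chart_dom c"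
    using sheet_proj_image[OF c s order_refl] by (simp only: cover_chart_simps image_comp[symmetric])
  then have u': "u \<in> coord (cover_chart X A c s) ` chart_dom (cover_chart X A c s)" using u by simp
  show i: "chart_inv (cover_chart X A c s) u \<in> sheet X A c s (chart_dom c)"
    using chart_inv_in_dom[OF u'] by simp
  then have "cover_proj (chart_inv (cover_chart X A c s) u) \<in> chart_dom c" by (simp add: mem_sheet)
  moreover have "coord c (cover_proj (chart_inv (cover_chart X A c s) u)) = u"
    using coord_chart_inv[OF u'] by simp
  ultimately show "cover_proj (chart_inv (cover_chart X A c s) u) = chart_inv c u"
    using chart_inv_coord[OF charts[OF c]] by metis
qed

lemma cover_smooth_atlas: "smooth_atlas (cover_topology X A) (cover_atlas X A)"
proof
  let ?T = "cover_topology X A"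
  show "Hausdorff_space ?T"
    unfolding Hausdorff_space_def
  proof (intro allI impI, elim conjE)
    fix z w assume zw: "z \<in> topspace ?T" "w \<in> topspace ?T" "z \<noteq> w"
    then have C: "z \<in> double_cover X A" "w \<in> double_cover X A" by (auto simp: topspace_cover)
    show "\<exists>U V. openin ?T U \<and> openin ?T V \<and> z \<in> U \<and> w \<in> V \<and> disjnt U V"
    proof (cases "cover_proj z = cover_proj w")
      case False
      moreover have "cover_proj z \<in> topspace X" "cover_proj w \<in> topspace X" using C by (auto simp: mem_double_cover)
      ultimately obtain U V where UV: "openin X U" "openin X V" "cover_proj z \<in> U" "cover_proj w \<in> V" "disjnt U V"
        using hausdorff unfolding Hausdorff_space_def by metis
      have "openin ?T {z \<in> topspace ?T. cover_proj z \<in> U}" "openin ?T {z \<in> topspace ?T. cover_proj z \<in> V}"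
        using openin_continuous_map_preimage[OF cover_proj_continuous] UV by blast+
      moreover have "disjnt {z \<in> topspace ?T. cover_proj z \<in> U} {z \<in> topspace ?T. cover_proj z \<in> V}"
        using UV(5) by (auto simp: disjnt_iff)
      ultimately show ?thesis
        using UV zw by (intro exI[of _ "{z \<in> topspace ?T. cover_proj z \<in> U}"] exI[of _ "{z \<in> topspace ?T. cover_proj z \<in> V}"]) simp
    next
      case True
      \<comment> \<open>Distinct points of one fibre are separated by the two opposite sheets over a
        chart; their projections cannot separate them.\<close>
      then have w: "w = deck_involution z" using fibre_cases[OF C] zw by auto
      obtain c where c: "c \<in> A" "cover_proj z \<in> chart_dom c" using obtain_chart C by (auto simp: mem_double_cover)
      have v: "snd z c \<in> {-1, 1}"
        using orientation_values[of "snd z" A "cover_proj z" c] c C by (auto simp: mem_double_cover)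
      have "openin ?T (sheet X A c s (chart_dom c))" for s
        by (rule openin_sheet[OF c(1) chart_dom_open[OF charts[OF c(1)]] order_refl])
      moreover have "disjnt (sheet X A c (snd z c) (chart_dom c)) (sheet X A c (- snd z c) (chart_dom c))"
        using v by (auto simp: disjnt_iff mem_sheet)
      moreover have "z \<in> sheet X A c (snd z c) (chart_dom c)" "w \<in> sheet X A c (- snd z c) (chart_dom c)"
        using c C w by (auto simp: mem_sheet)
      ultimately show ?thesis by blast
    qed
  qed
  show "is_chart ?T d" if "d \<in> cover_atlas X A" for d
    using that is_chart_cover_chart by (metis cover_atlasE)
  show "(\<Union>d\<in>cover_atlas X A. chart_dom d) = topspace ?T"
    unfolding topspace_cover
  proof
    show "(\<Union>d\<in>cover_atlas X A. chart_dom d) \<subseteq> double_cover X A"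
      by (auto elim!: cover_atlasE simp: mem_sheet)
    show "double_cover X A \<subseteq> (\<Union>d\<in>cover_atlas X A. chart_dom d)"
    proof
      fix z assume z: "z \<in> double_cover X A"
      obtain c where c: "c \<in> A" "cover_proj z \<in> chart_dom c" using obtain_chart z by (auto simp: mem_double_cover)
      have v: "snd z c \<in> {-1, 1}"
        using orientation_values[of "snd z" A "cover_proj z" c] c z by (auto simp: mem_double_cover)
      have "z \<in> chart_dom (cover_chart X A c (snd z c))" using z c by (simp add: mem_sheet)
      then show "z \<in> (\<Union>d\<in>cover_atlas X A. chart_dom d)" using cover_chart_in_atlas[OF c(1) v] by blast
    qed
  qed
  fix d d' assume "d \<in> cover_atlas X A" "d' \<in> cover_atlas X A"
  then obtain c s c' s' where c: "c \<in> A" "s \<in> {-1, 1}" "c' \<in> A" "s' \<in> {-1, 1}"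
    and d: "d = cover_chart X A c s" "d' = cover_chart X A c' s'"
    by (metis cover_atlasE)
  note chd = is_chart_cover_chart[OF c(1,2), folded d] is_chart_cover_chart[OF c(3,4), folded d]
  have op: "open (coord d ` (chart_dom d \<inter> chart_dom d'))"
    by (rule coord_open_image[OF chd(1) openin_Int[OF chart_dom_open[OF chd(1)] chart_dom_open[OF chd(2)]]]) simp
  have sub: "coord d ` (chart_dom d \<inter> chart_dom d') \<subseteq> coord c ` (chart_dom c \<inter> chart_dom c')"
    by (auto simp: d mem_sheet)
  show "smooth_on (coord d ` (chart_dom d \<inter> chart_dom d')) (coord d' \<circ> chart_inv d)"
  proof (rule smooth_on_transform[OF smooth_on_subset[OF transitions[OF c(1,3)] sub] _ op])
    fix u assume "u \<in> coord d ` (chart_dom d \<inter> chart_dom d')"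
    then have "u \<in> coord c ` chart_dom c" using sub by blast
    then show "(coord c' \<circ> chart_inv c) u = (coord d' \<circ> chart_inv d) u"
      using cover_proj_chart_inv(1)[OF c(1,2)] by (simp add: d)
  qed
qed

text \<open>A map above a smooth map is smooth once it is locally compatible with sheets, which is
  what \<open>loc\<close> expresses. This serves for the involution, which lies above the identity,
  and for lifts of diffeomorphisms.\<close>

lemma smooth_map_cover:
  assumes lift: "\<And>z. z \<in> double_cover X A \<Longrightarrow> \<Phi> z \<in> double_cover X A"
    and proj: "\<And>z. z \<in> double_cover X A \<Longrightarrow> cover_proj (\<Phi> z) = F (cover_proj z)"
    and F: "smooth_map X A X A F"
    and loc: "\<And>z c c'. z \<in> double_cover X A \<Longrightarrow> c \<in> A \<Longrightarrow> c' \<in> A \<Longrightarrow> cover_proj z \<in> chart_dom c \<Longrightarrow>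
      F (cover_proj z) \<in> chart_dom c' \<Longrightarrow>
      \<exists>V. openin X V \<and> cover_proj z \<in> V \<and> (\<forall>w\<in>sheet X A c (snd z c) V. snd (\<Phi> w) c' = snd (\<Phi> z) c')"
  shows "smooth_map (cover_topology X A) (cover_atlas X A) (cover_topology X A) (cover_atlas X A) \<Phi>"
proof (rule smooth_atlas.smooth_mapI[OF cover_smooth_atlas cover_smooth_atlas])
  fix z assume "z \<in> topspace (cover_topology X A)"
  then have z: "z \<in> double_cover X A" by (simp add: topspace_cover)
  then have p: "cover_proj z \<in> topspace X" by (simp add: mem_double_cover)
  obtain c where c: "c \<in> A" "cover_proj z \<in> chart_dom c" using obtain_chart[OF p] by blast
  obtain c' where c': "c' \<in> A" "F (cover_proj z) \<in> chart_dom c'"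
    using obtain_chart[OF smooth_map_topspace[OF F p]] by blast
  obtain V where V: "openin X V" "cover_proj z \<in> V" "\<And>w. w \<in> sheet X A c (snd z c) V \<Longrightarrow> snd (\<Phi> w) c' = snd (\<Phi> z) c'"
    using loc[OF z c(1) c'(1) c(2) c'(2)] by blast
  define s s' where "s = snd z c" and "s' = snd (\<Phi> z) c'"
  have s: "s \<in> {-1, 1}" "s' \<in> {-1, 1}"
    using orientation_values[of "snd z" A "cover_proj z" c]
      orientation_values[of "snd (\<Phi> z)" A "cover_proj (\<Phi> z)" c'] z lift[OF z] c c' proj[OF z]
    by (auto simp: s_def s'_def mem_double_cover)
  define D where "D = {q \<in> chart_dom c. F q \<in> chart_dom c'}"
  define U where "U = V \<inter> D"
  have U: "openin X U" "U \<subseteq> chart_dom c"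
    unfolding U_def D_def
    using openin_Int[OF V(1) chart_rep_domain_open(1)[OF smooth_atlas_axioms smooth_atlas_axioms F c(1) c'(1)]] by auto
  let ?d = "cover_chart X A c s" and ?d' = "cover_chart X A c' s'"
  show "smooth_near (cover_topology X A) (cover_atlas X A) (cover_atlas X A) \<Phi> z"
  proof (rule smooth_nearI[OF cover_chart_in_atlas[OF c(1) s(1)] cover_chart_in_atlas[OF c'(1) s(2)] openin_sheet[OF c(1) U]])
    show "z \<in> sheet X A c s U" using z V(2) c(2) c'(2) by (auto simp: mem_sheet s_def U_def D_def)
    show "sheet X A c s U \<subseteq> chart_dom ?d" using U(2) by (auto simp: mem_sheet)
    show "\<Phi> ` sheet X A c s U \<subseteq> chart_dom ?d'"
    proof (rule image_subsetI)
      fix w assume w: "w \<in> sheet X A c s U"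
      then have "w \<in> double_cover X A" "cover_proj w \<in> V" "cover_proj w \<in> D" "snd w c = s"
        by (auto simp: mem_sheet U_def)
      then show "\<Phi> w \<in> chart_dom ?d'"
        using V(3)[of w] lift proj by (simp add: mem_sheet s_def s'_def D_def)
    qed
    have img: "coord ?d ` sheet X A c s U = coord c ` U"
      using sheet_proj_image[OF c(1) s(1) U(2)] by (simp only: cover_chart_simps image_comp[symmetric])
    have op: "open (coord c ` U)" by (rule coord_open_image[OF charts[OF c(1)] U])
    have sm: "smooth_on (coord c ` U) (coord c' \<circ> F \<circ> chart_inv c)"
      by (rule smooth_on_subset[OF smooth_mapD[OF F c(1) c'(1)]]) (auto simp: U_def D_def)
    show "smooth_on (coord ?d ` sheet X A c s U) (coord ?d' \<circ> \<Phi> \<circ> chart_inv ?d)"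
      unfolding img
    proof (rule smooth_on_transform[OF sm _ op])
      fix u assume "u \<in> coord c ` U"
      then have u: "u \<in> coord c ` chart_dom c" using U(2) by blast
      then show "(coord c' \<circ> F \<circ> chart_inv c) u = (coord ?d' \<circ> \<Phi> \<circ> chart_inv ?d) u"
        using cover_proj_chart_inv[OF c(1) s(1) u] proj by (simp add: mem_sheet)
    qed
  qed
qed

lemma deck_smooth:
  "smooth_map (cover_topology X A) (cover_atlas X A) (cover_topology X A) (cover_atlas X A) deck_involution"
proof (rule smooth_map_cover[OF deck_in_double_cover _ smooth_map_id])
  fix z c c' assume z: "z \<in> double_cover X A" and c: "c \<in> A" "c' \<in> A" "cover_proj z \<in> chart_dom c" "cover_proj z \<in> chart_dom c'"
  let ?d = "\<lambda>q. sgn (det (transition_jacobian c c' q))"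
  let ?V = "{q \<in> chart_dom c. q \<in> chart_dom c' \<and> ?d q = ?d (cover_proj z)}"
  have "openin X ?V"
    by (intro jacobian_sign_open[OF smooth_atlas_axioms smooth_atlas_axioms smooth_map_id] det_transition_nonzero c)
  moreover have "snd w c' = snd z c'" if "w \<in> sheet X A c (snd z c) ?V" for w
    using that orientation_transition[OF _ c(1,2), of "snd w" "cover_proj w"]
      orientation_transition[OF _ c, of "snd z"] z by (simp add: mem_sheet mem_double_cover)
  ultimately show "\<exists>V. openin X V \<and> cover_proj z \<in> V \<and>
      (\<forall>w\<in>sheet X A c (snd z c) V. snd (deck_involution w) c' = snd (deck_involution z) c')"
    using c by (intro exI[of _ ?V]) simp
qed simp_all

subsection \<open>Lifts of diffeomorphisms\<close>

lemma diffeomorphism_det_nonzero: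
  assumes "diffeomorphism X A F" "c \<in> A" "c' \<in> A" "p \<in> chart_dom c" "F p \<in> chart_dom c'"
  shows "det (chart_jacobian c c' F p) \<noteq> 0"
  using diffeomorphism_det_mult[OF assms] by auto

text \<open>Evaluates the \<open>THE\<close> in \<open>push_orientation\<close>. Passing to another
  chart around p, the same transition sign appears in the Jacobian and in the orientation, so the
  described value is unique.\<close>

lemma push_orientation_eq:
  assumes F: "diffeomorphism X A F" and \<omega>: "\<omega> \<in> orientations_at A p"
    and c: "c \<in> A" "c' \<in> A" and p: "p \<in> chart_dom c" "F p \<in> chart_dom c'"
  shows "push_orientation A F p \<omega> c' = sgn (det (chart_jacobian c c' F p)) * \<omega> c"
proof -
  note ax = smooth_atlas_axioms
  have *: "sgn (det (chart_jacobian c c' F p)) * \<omega> c = sgn (det (chart_jacobian c1 c' F p)) * \<omega> c1"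
    if c1: "c1 \<in> A" "p \<in> chart_dom c1" for c1
  proof -
    have "chart_jacobian c c' F p = chart_jacobian c1 c' F p ** transition_jacobian c c1 p"
      using chart_jacobian_compose[OF ax ax ax smooth_map_id diffeomorphism_inverse(1)[OF F] c(1) c1(1) c(2) p(1) c1(2) p(2)] .
    then show ?thesis
      using orientation_transition[OF \<omega> c(1) c1(1) p(1) c1(2)] by (simp add: det_mul sgn_mult)
  qed
  have "(THE s. \<forall>c\<in>A. p \<in> chart_dom c \<longrightarrow> s = sgn (det (chart_jacobian c c' F p)) * \<omega> c) =
      sgn (det (chart_jacobian c c' F p)) * \<omega> c"
    by (rule the_equality) (use * c p in blast)+
  then show ?thesis using c p by (simp add: push_orientation_def)
qed

lemma push_orientation_mem:
  assumes F: "diffeomorphism X A F" and \<omega>: "\<omega> \<in> orientations_at A p" and p: "p \<in> topspace X"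
  shows "push_orientation A F p \<omega> \<in> orientations_at A (F p)"
proof -
  note ax = smooth_atlas_axioms
  obtain c where c: "c \<in> A" "p \<in> chart_dom c" using obtain_chart[OF p] by blast
  note eq = push_orientation_eq[OF F \<omega> c(1) _ c(2)]
  show ?thesis
  proof (rule orientations_atI)
    fix c' assume c': "c' \<in> A" "F p \<in> chart_dom c'"
    show "push_orientation A F p \<omega> c' \<in> {-1, 1}"
      using eq[OF c'] orientation_values[OF \<omega> c] diffeomorphism_det_nonzero[OF F c(1) c'(1) c(2) c'(2)]
      by (auto simp: sgn_real_def)
  next
    fix c' c'' assume c': "c' \<in> A" "c'' \<in> A" "F p \<in> chart_dom c'" "F p \<in> chart_dom c''"
    have "chart_jacobian c c'' F p = transition_jacobian c' c'' (F p) ** chart_jacobian c c' F p"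
      using chart_jacobian_compose[OF ax ax ax diffeomorphism_inverse(1)[OF F] smooth_map_id c(1) c'(1,2) c(2) c'(3,4)] .
    then show "push_orientation A F p \<omega> c'' = sgn (det (transition_jacobian c' c'' (F p))) * push_orientation A F p \<omega> c'"
      using eq[OF c'(1,3)] eq[OF c'(2,4)] by (simp add: det_mul sgn_mult)
  qed (auto simp: push_orientation_def)
qed

lemma cover_lift_mem:
  assumes F: "diffeomorphism X A F" and z: "z \<in> double_cover X A"
  shows "cover_lift A F z \<in> double_cover X A" "cover_proj (cover_lift A F z) = F (cover_proj z)"
  using push_orientation_mem[OF F, of "snd z" "cover_proj z"] z
    smooth_map_topspace[OF diffeomorphism_inverse(1)[OF F], of "cover_proj z"]
  by (auto simp: mem_double_cover cover_lift_def cover_proj_def)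

lemma snd_cover_lift:
  assumes F: "diffeomorphism X A F" and z: "z \<in> double_cover X A"
    and c: "c \<in> A" "c' \<in> A" "cover_proj z \<in> chart_dom c" "F (cover_proj z) \<in> chart_dom c'"
  shows "snd (cover_lift A F z) c' = sgn (det (chart_jacobian c c' F (cover_proj z))) * snd z c"
  using push_orientation_eq[OF F, of "snd z" "cover_proj z"] z c
  by (simp add: mem_double_cover cover_lift_def cover_proj_def)

lemma cover_point_eqI:
  assumes "z \<in> double_cover X A" "w \<in> double_cover X A" "cover_proj z = cover_proj w"
    "c \<in> A" "cover_proj z \<in> chart_dom c" "snd z c = snd w c"
  shows "z = w"
  using orientation_unique[of "snd z" A "cover_proj z" "snd w" c] assms oriented_point_eqI
  by (simp add: mem_double_cover)

lemma cover_lift_compose: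
  assumes F: "diffeomorphism X A F" and G: "diffeomorphism X A G" and z: "z \<in> double_cover X A"
  shows "cover_lift A (\<lambda>p. G (F p)) z = cover_lift A G (cover_lift A F z)"
proof -
  note ax = smooth_atlas_axioms
  note GF = diffeomorphism_compose[OF F G] and Fz = cover_lift_mem[OF F z]
  let ?p = "cover_proj z"
  have p: "?p \<in> topspace X" using z by (simp add: mem_double_cover)
  obtain c where c: "c \<in> A" "?p \<in> chart_dom c" using obtain_chart[OF p] by blast
  obtain c' where c': "c' \<in> A" "F ?p \<in> chart_dom c'"
    using obtain_chart[OF smooth_map_topspace[OF diffeomorphism_inverse(1)[OF F] p]] by blast
  obtain c'' where c'': "c'' \<in> A" "G (F ?p) \<in> chart_dom c''"
    using obtain_chart[OF smooth_map_topspace[OF diffeomorphism_inverse(1)[OF GF] p]] by blast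
  have J: "chart_jacobian c c'' (\<lambda>q. G (F q)) ?p = chart_jacobian c' c'' G (F ?p) ** chart_jacobian c c' F ?p"
    by (rule chart_jacobian_compose[OF ax ax ax diffeomorphism_inverse(1)[OF F] diffeomorphism_inverse(1)[OF G]]) fact+
  show ?thesis
  proof (rule cover_point_eqI[OF cover_lift_mem(1)[OF GF z] cover_lift_mem(1)[OF G Fz(1)] _ c''(1)])
    show "cover_proj (cover_lift A (\<lambda>p. G (F p)) z) = cover_proj (cover_lift A G (cover_lift A F z))"
      by (simp add: cover_lift_mem(2)[OF GF z] cover_lift_mem(2)[OF G Fz(1)] Fz(2))
    show "cover_proj (cover_lift A (\<lambda>p. G (F p)) z) \<in> chart_dom c''"
      by (simp add: cover_lift_mem(2)[OF GF z] c'')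
    show "snd (cover_lift A (\<lambda>p. G (F p)) z) c'' = snd (cover_lift A G (cover_lift A F z)) c''"
      using snd_cover_lift[OF GF z c(1) c''(1) c(2) c''(2)] snd_cover_lift[OF F z c(1) c'(1) c(2) c'(2)]
        snd_cover_lift[OF G Fz(1) c'(1) c''(1)] Fz(2) c'(2) c''(2)
      by (simp add: J det_mul sgn_mult)
  qed
qed

text \<open>Fixing the point alone would not suffice: such a diffeomorphism may reverse the
  orientation there and exchange the two points of the fibre.\<close>

lemma cover_lift_locally_id:
  assumes F: "diffeomorphism X A F" and z: "z \<in> double_cover X A"
    and W: "openin X W" "cover_proj z \<in> W" "\<And>q. q \<in> W \<Longrightarrow> F q = q"
  shows "cover_lift A F z = z"
proof -
  have p: "cover_proj z \<in> topspace X" using z by (simp add: mem_double_cover)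
  obtain c where c: "c \<in> A" "cover_proj z \<in> chart_dom c" using obtain_chart[OF p] by blast
  have Fp: "F (cover_proj z) = cover_proj z" using W by simp
  have "chart_jacobian c c F (cover_proj z) = transition_jacobian c c (cover_proj z)"
    by (rule chart_jacobian_cong[OF charts[OF c(1)] W(1,2) c(2)]) (rule W(3))
  then show ?thesis
    using snd_cover_lift[OF F z c(1) c(1) c(2)] c Fp transition_jacobian_self[OF c] cover_lift_mem[OF F z] z
    by (intro cover_point_eqI[OF _ z _ c(1)]) simp_all
qed

lemma cover_lift_deck:
  assumes F: "diffeomorphism X A F" and z: "z \<in> double_cover X A"
  shows "cover_lift A F (deck_involution z) = deck_involution (cover_lift A F z)"
proof -
  note dz = deck_in_double_cover[OF z] and Fz = cover_lift_mem[OF F z]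
  have p: "cover_proj z \<in> topspace X" using z by (simp add: mem_double_cover)
  obtain c where c: "c \<in> A" "cover_proj z \<in> chart_dom c" using obtain_chart[OF p] by blast
  obtain c' where c': "c' \<in> A" "F (cover_proj z) \<in> chart_dom c'"
    using obtain_chart[OF smooth_map_topspace[OF diffeomorphism_inverse(1)[OF F] p]] by blast
  show ?thesis
    using snd_cover_lift[OF F z c(1) c'(1) c(2) c'(2)] snd_cover_lift[OF F dz c(1) c'(1)] c c' Fz cover_lift_mem[OF F dz]
    by (intro cover_point_eqI[OF _ deck_in_double_cover[OF Fz(1)] _ c'(1)]) simp_all
qed

text \<open>The composites are the identity on the open set \<open>topspace X\<close>, so
  functoriality of the lift and \<open>cover_lift_locally_id\<close> apply.\<close>

lemma cover_lift_inverse: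
  assumes F: "diffeomorphism X A F" and z: "z \<in> double_cover X A"
  shows "cover_lift A (inv_into (topspace X) F) (cover_lift A F z) = z"
    and "cover_lift A F (cover_lift A (inv_into (topspace X) F) z) = z"
proof -
  let ?G = "inv_into (topspace X) F"
  note F' = diffeomorphism_inverse[OF F]
  have G: "diffeomorphism X A ?G" by (rule diffeomorphismI[where G = F]) (use F' in auto)
  have p: "cover_proj z \<in> topspace X" using z by (simp add: mem_double_cover)
  have "cover_lift A (\<lambda>p. ?G (F p)) z = z"
    by (rule cover_lift_locally_id[OF diffeomorphism_compose[OF F G] z openin_topspace p]) (rule F'(4))
  then show "cover_lift A ?G (cover_lift A F z) = z" using cover_lift_compose[OF F G z] by simp
  have "cover_lift A (\<lambda>p. F (?G p)) z = z"
    by (rule cover_lift_locally_id[OF diffeomorphism_compose[OF G F] z openin_topspace p]) (rule F'(3))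
  then show "cover_lift A F (cover_lift A ?G z) = z" using cover_lift_compose[OF G F z] by simp
qed

lemma cover_lift_smooth:
  assumes F: "diffeomorphism X A F"
  shows "smooth_map (cover_topology X A) (cover_atlas X A) (cover_topology X A) (cover_atlas X A) (cover_lift A F)"
proof (rule smooth_map_cover[OF cover_lift_mem(1)[OF F] cover_lift_mem(2)[OF F] diffeomorphism_inverse(1)[OF F]])
  fix z c c' assume z: "z \<in> double_cover X A" and c: "c \<in> A" "c' \<in> A" "cover_proj z \<in> chart_dom c" "F (cover_proj z) \<in> chart_dom c'"
  let ?d = "\<lambda>q. sgn (det (chart_jacobian c c' F q))"
  let ?V = "{q \<in> chart_dom c. F q \<in> chart_dom c' \<and> ?d q = ?d (cover_proj z)}"
  have "openin X ?V"
    by (rule jacobian_sign_open[OF smooth_atlas_axioms smooth_atlas_axioms diffeomorphism_inverse(1)[OF F] c(1,2)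
          diffeomorphism_det_nonzero[OF F c]])
  moreover have "snd (cover_lift A F w) c' = snd (cover_lift A F z) c'" if "w \<in> sheet X A c (snd z c) ?V" for w
    using that snd_cover_lift[OF F _ c(1,2), of w] snd_cover_lift[OF F z c] by (simp add: mem_sheet)
  ultimately show "\<exists>V. openin X V \<and> cover_proj z \<in> V \<and>
      (\<forall>w\<in>sheet X A c (snd z c) V. snd (cover_lift A F w) c' = snd (cover_lift A F z) c')"
    using c by (intro exI[of _ ?V]) simp
qed

subsection \<open>Connectedness\<close>

text \<open>The fibres meet the two halves of a separation of the cover in one of three ways, and each way
  occurs over an open set; if every fibre is split, one half is a global orientation.\<close>

lemma connected_cover:
  assumes conn: "connected_space X" and nonor: "\<not> orientable X A"
  shows "connected_space (cover_topology X A)"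
  unfolding connected_space_def topspace_cover
proof (intro notI, elim exE conjE)
  fix E1 E2 assume E: "openin (cover_topology X A) E1" "openin (cover_topology X A) E2"
    "double_cover X A \<subseteq> E1 \<union> E2" "E1 \<inter> E2 = {}" "E1 \<noteq> {}" "E2 \<noteq> {}"
  have EC: "E1 \<subseteq> double_cover X A" "E2 \<subseteq> double_cover X A"
    using openin_subset E(1,2) topspace_cover by blast+
  \<comment> \<open>Sorts the points of the surface by the halves in which the two points of their
    fibre lie. The three sets obtained from E1 and E2 are open, disjoint and cover the
    surface.\<close>
  define M :: "'a oriented_point set \<Rightarrow> 'a oriented_point set \<Rightarrow> 'a set" where "M = (\<lambda>P Q. cover_proj ` {z \<in> P. deck_involution z \<in> Q})"
  have M: "openin X (M P Q)" if "openin (cover_topology X A) P" "openin (cover_topology X A) Q" for P Q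
    unfolding M_def
    by (rule cover_proj_open, rule openin_continuous_map_preimage_gen[OF smooth_map_continuous[OF deck_smooth]]) fact+
  have cov: "topspace X \<subseteq> M E1 E1 \<union> M E2 E2 \<union> M E1 E2"
  proof
    fix p assume p: "p \<in> topspace X"
    then obtain c where c: "c \<in> A" "p \<in> chart_dom c" using obtain_chart by blast
    obtain \<omega> where \<omega>: "\<omega> \<in> orientations_at A p" using orientation_exists[OF c, of 1] by blast
    define z where "z = (p, \<omega>)"
    have z: "z \<in> double_cover X A" "cover_proj z = p" using p \<omega> by (auto simp: z_def mem_double_cover cover_proj_def)
    have "deck_involution z \<in> double_cover X A" by (rule deck_in_double_cover[OF z(1)])
    then have "z \<in> E1 \<or> z \<in> E2" "deck_involution z \<in> E1 \<or> deck_involution z \<in> E2"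
      using E(3) z(1) by blast+
    then consider "z \<in> E1" "deck_involution z \<in> E1" | "z \<in> E2" "deck_involution z \<in> E2"
      | "z \<in> E1" "deck_involution z \<in> E2" | "deck_involution z \<in> E1" "z \<in> E2"
      by blast
    moreover have MI: "p \<in> M P Q" if "w \<in> P" "deck_involution w \<in> Q" "cover_proj w = p" for w P Q
      unfolding M_def using that by blast
    ultimately show "p \<in> M E1 E1 \<union> M E2 E2 \<union> M E1 E2"
    proof cases
      case 4
      then have "p \<in> M E1 E2" by (intro MI[of "deck_involution z"]) (simp_all add: z(2))
      then show ?thesis by blast
    qed (use MI[OF _ _ z(2)] in blast)+
  qed
  have disj: "w \<in> P \<Longrightarrow> deck_involution w \<in> Q \<Longrightarrow> cover_proj w = cover_proj z \<Longrightarrow>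
      P \<subseteq> double_cover X A \<Longrightarrow> Q \<subseteq> double_cover X A \<Longrightarrow> z \<in> double_cover X A \<Longrightarrow>
      (z \<in> P \<and> deck_involution z \<in> Q) \<or> (z \<in> Q \<and> deck_involution z \<in> P)" for w z P Q
    using fibre_cases[of w z] by (metis deck_deck subsetD)
  have MD: "(z \<in> P \<and> deck_involution z \<in> Q) \<or> (z \<in> Q \<and> deck_involution z \<in> P)"
    if "cover_proj z \<in> M P Q" "P \<subseteq> double_cover X A" "Q \<subseteq> double_cover X A" "z \<in> double_cover X A" for z P Q
    using that disj[of _ P Q z] unfolding M_def by fastforce
  have lift: "\<exists>z \<in> double_cover X A. cover_proj z = p" if "p \<in> M P Q" "P \<subseteq> double_cover X A" for p P Q
    using that unfolding M_def by blast
  have "p \<notin> M E1 E1 \<or> p \<notin> M E2 E2" "p \<notin> M E1 E1 \<or> p \<notin> M E1 E2" "p \<notin> M E2 E2 \<or> p \<notin> M E1 E2" for p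
  proof -
    have *: "p \<notin> M P Q \<or> p \<notin> M P' Q'"
      if sub: "P \<subseteq> double_cover X A" "Q \<subseteq> double_cover X A" "P' \<subseteq> double_cover X A" "Q' \<subseteq> double_cover X A"
        and no: "\<And>z w. (z \<in> P \<and> w \<in> Q) \<or> (z \<in> Q \<and> w \<in> P) \<Longrightarrow> (z \<in> P' \<and> w \<in> Q') \<or> (z \<in> Q' \<and> w \<in> P') \<Longrightarrow> False"
      for P Q P' Q'
    proof (rule ccontr)
      assume "\<not> ?thesis"
      then have p: "p \<in> M P Q" "p \<in> M P' Q'" by blast+
      obtain z where z: "z \<in> double_cover X A" "cover_proj z = p" using lift[OF p(1) sub(1)] by blast
      show False
        by (rule no[OF MD[OF _ sub(1,2) z(1)] MD[OF _ sub(3,4) z(1)]]) (simp_all add: z(2) p)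
    qed
    show "p \<notin> M E1 E1 \<or> p \<notin> M E2 E2" "p \<notin> M E1 E1 \<or> p \<notin> M E1 E2" "p \<notin> M E2 E2 \<or> p \<notin> M E1 E2"
      by (rule *; use EC E(4) in blast)+
  qed
  then have dj: "M E1 E1 \<inter> (M E2 E2 \<union> M E1 E2) = {}" "M E2 E2 \<inter> (M E1 E1 \<union> M E1 E2) = {}"
    by blast+
  have sep: "U = {} \<or> V = {}" if "openin X U" "openin X V" "topspace X \<subseteq> U \<union> V" "U \<inter> V = {}" for U V
    using conn that unfolding connected_space_def by blast
  have "M E1 E1 = {} \<or> M E2 E2 \<union> M E1 E2 = {}"
    by (rule sep[OF M[OF E(1,1)] openin_Un[OF M[OF E(2,2)] M[OF E(1,2)]] _ dj(1)]) (use cov in blast)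
  moreover have "M E2 E2 = {} \<or> M E1 E1 \<union> M E1 E2 = {}"
    by (rule sep[OF M[OF E(2,2)] openin_Un[OF M[OF E(1,1)] M[OF E(1,2)]] _ dj(2)]) (use cov in blast)
  \<comment> \<open>A point of E2 prevents all fibres from lying in E1, so by connectedness none
    does. The next step is its mirror image.\<close>
  moreover have "M E2 E2 \<union> M E1 E2 \<noteq> {}"
  proof -
    obtain z where z: "z \<in> E2" using E(6) by blast
    then have zC: "z \<in> double_cover X A" using EC by blast
    then have "cover_proj z \<in> topspace X" by (simp add: mem_double_cover)
    moreover have "cover_proj z \<notin> M E1 E1" using MD[of z E1 E1] EC zC z E(4) by blast
    ultimately show ?thesis using cov by blast
  qed
  moreover have "M E1 E1 \<union> M E1 E2 \<noteq> {}"
  proof -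
    obtain z where z: "z \<in> E1" using E(5) by blast
    then have zC: "z \<in> double_cover X A" using EC by blast
    then have "cover_proj z \<in> topspace X" by (simp add: mem_double_cover)
    moreover have "cover_proj z \<notin> M E2 E2" using MD[of z E2 E2] EC zC z E(4) by blast
    ultimately show ?thesis using cov by blast
  qed
  \<comment> \<open>Only split fibres remain: E1 contains exactly one point of each and is the image
    of a section of the cover.\<close>
  ultimately have all: "topspace X \<subseteq> M E1 E2" using cov by blast
  have uniq: "\<exists>!z. z \<in> E1 \<and> cover_proj z = p" if p: "p \<in> topspace X" for p
  proof -
    obtain z where z: "z \<in> E1" "deck_involution z \<in> E2" "cover_proj z = p"
      using all p unfolding M_def by blast
    have "w = z" if w: "w \<in> E1 \<and> cover_proj w = p" for w
    proof -
      have "z \<in> double_cover X A" "w \<in> double_cover X A" "cover_proj w = cover_proj z" using z w EC by auto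
      from fibre_cases[OF this] show ?thesis using w z(2) E(4) by blast
    qed
    then show ?thesis using z(1,3) by blast
  qed
  define \<Omega> where "\<Omega> = (\<lambda>p. snd (THE z. z \<in> E1 \<and> cover_proj z = p))"
  have Om: "\<Omega> (cover_proj z) = snd z" if "z \<in> E1" for z
  proof -
    have "cover_proj z \<in> topspace X" using that EC by (auto simp: mem_double_cover)
    from the1_equality[OF uniq[OF this]] that show ?thesis by (simp add: \<Omega>_def)
  qed
  have "\<Omega> p \<in> orientations_at A p" if "p \<in> topspace X" for p
  proof -
    obtain z where z: "z \<in> E1" "cover_proj z = p" using uniq[OF \<open>p \<in> topspace X\<close>] by blast
    then show ?thesis using Om[OF z(1)] EC by (auto simp: mem_double_cover)
  qed
  moreover have "continuous_map (subtopology X (chart_dom c)) euclideanreal (\<lambda>p. \<Omega> p c)" if c: "c \<in> A" for c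
  proof (rule continuous_map_locally)
    note ch = charts[OF c]
    fix p assume "p \<in> topspace (subtopology X (chart_dom c))"
    then have p: "p \<in> topspace X" "p \<in> chart_dom c" by auto
    obtain z where z: "z \<in> E1" "cover_proj z = p" using uniq[OF p(1)] by blast
    \<comment> \<open>Over the projection of this part of E1 the section stays in one sheet, so its
      sign in the chart c is constant there.\<close>
    let ?W = "cover_proj ` (E1 \<inter> sheet X A c (snd z c) (chart_dom c))"
    have W: "openin X ?W"
      by (intro cover_proj_open openin_Int E(1) openin_sheet c chart_dom_open[OF ch] order_refl)
    have sub: "?W \<subseteq> chart_dom c" by (auto simp: mem_sheet)
    have "z \<in> sheet X A c (snd z c) (chart_dom c)" using z p EC by (auto simp: mem_sheet)
    then have pW: "p \<in> ?W" using z by blast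
    have const: "\<Omega> q c = snd z c" if q: "q \<in> ?W" for q
    proof -
      obtain w where "w \<in> E1" "w \<in> sheet X A c (snd z c) (chart_dom c)" "q = cover_proj w" using q by blast
      then show ?thesis using Om[of w] by (simp add: mem_sheet)
    qed
    have "continuous_map (subtopology (subtopology X (chart_dom c)) ?W) euclideanreal (\<lambda>p. snd z c)"
      by simp
    then have "continuous_map (subtopology (subtopology X (chart_dom c)) ?W) euclideanreal (\<lambda>p. \<Omega> p c)"
      by (rule continuous_map_eq) (use const in auto)
    moreover have "openin (subtopology X (chart_dom c)) ?W"
      using W sub openin_open_subtopology[OF chart_dom_open[OF ch]] by blast
    ultimately show "\<exists>W. openin (subtopology X (chart_dom c)) W \<and> p \<in> W \<and>
        continuous_map (subtopology (subtopology X (chart_dom c)) W) euclideanreal (\<lambda>p. \<Omega> p c)"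
      using pW by blast
  qed
  ultimately show False using nonor unfolding orientable_def by blast
qed

text \<open>This depends on dimension two: a punctured disc is connected. It therefore lies in one
  half of any separation that arises from the removal of a further point.\<close>

lemma connected_minus_finite:
  assumes conn: "connected_space X" and S: "finite S"
  shows "connectedin X (topspace X - S)"
  using S
proof (induction S rule: finite_induct)
  case empty
  then show ?case using conn by (simp add: connectedin_topspace)
next
  case (insert p S)
  define C where "C = topspace X - S"
  have "closedin X (S \<inter> topspace X)"
    using insert.hyps(1) hausdorff by (intro closedin_Hausdorff_finite) auto
  then have "openin X (topspace X - S \<inter> topspace X)" by (rule openin_diff[OF openin_topspace])
  then have C: "openin X C" by (simp add: C_def Diff_Int)
  show ?case
  proof (cases "p \<in> C")
    case False
    then have "topspace X - insert p S = topspace X - S" by (auto simp: C_def)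
    then show ?thesis using insert.IH by simp
  next
    case True
    then have "p \<in> topspace X" by (simp add: C_def)
    then obtain c where c: "c \<in> A" "p \<in> chart_dom c" using obtain_chart by blast
    note ch = charts[OF c(1)]
    define u where "u = coord c p"
    have "open (coord c ` (chart_dom c \<inter> C))"
      by (rule coord_open_image[OF ch openin_Int[OF chart_dom_open[OF ch] C]]) simp
    moreover have "u \<in> coord c ` (chart_dom c \<inter> C)" using c True by (simp add: u_def)
    ultimately obtain r where r: "r > 0" "ball u r \<subseteq> coord c ` (chart_dom c \<inter> C)"
      using open_contains_ball by metis
    have sub: "ball u r \<subseteq> coord c ` chart_dom c" using r by blast
    define V where "V = chart_inv c ` ball u r"
    define V' where "V' = chart_inv c ` (ball u r - {u})"
    have V: "openin X V"
      unfolding V_def chart_inv_image_eq[OF ch sub] by (rule coord_open_vimage[OF ch]) simp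
    have VC: "V \<subseteq> C"
    proof
      fix q assume "q \<in> V"
      then obtain w where w: "w \<in> ball u r" "q = chart_inv c w" by (auto simp: V_def)
      then obtain q' where "q' \<in> chart_dom c \<inter> C" "w = coord c q'" using r by blast
      then show "q \<in> C" using w chart_inv_coord[OF ch] by simp
    qed
    have "connected (ball u r - {u})" by (rule connected_punctured_ball) simp
    then have "connectedin (top_of_set (coord c ` chart_dom c)) (ball u r - {u})"
      using sub by (auto simp: connectedin_subtopology)
    from connectedin_continuous_map_image[OF chart_inv_continuous[OF ch] this]
    have conn': "connectedin X V'" by (simp add: V'_def)
    have "chart_inv c u = p" using chart_inv_coord[OF ch c(2)] by (simp add: u_def)
    then have V'V: "V \<subseteq> insert p V'" "V' \<subseteq> V" by (auto simp: V_def V'_def)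
    have pV: "p \<in> V" using \<open>chart_inv c u = p\<close> r by (force simp: V_def)
    have pV': "p \<notin> V'"
    proof
      assume "p \<in> V'"
      then obtain w where w: "w \<in> ball u r" "w \<noteq> u" "p = chart_inv c w" unfolding V'_def by blast
      then have "coord c p = w" using coord_chart_inv[of w c] sub by blast
      then show False using w by (simp add: u_def)
    qed
    have sp: "topspace X - insert p S = C - {p}" by (auto simp: C_def)
    show ?thesis unfolding sp connectedin
    proof (intro conjI notI; (elim exE conjE)?)
      show "C - {p} \<subseteq> topspace X" by (auto simp: C_def)
      fix E1 E2 assume E: "openin X E1" "openin X E2" "C - {p} \<subseteq> E1 \<union> E2"
        "E1 \<inter> E2 \<inter> (C - {p}) = {}" "E1 \<inter> (C - {p}) \<noteq> {}" "E2 \<inter> (C - {p}) \<noteq> {}"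
      have Cp: "openin X (C - {p})"
      proof -
        have "closedin X {p}" by (rule closedin_Hausdorff_singleton[OF hausdorff \<open>p \<in> topspace X\<close>])
        then show ?thesis using C by (rule openin_diff[rotated])
      qed
      have *: False if E: "openin X E1" "openin X E2" "C - {p} \<subseteq> E1 \<union> E2"
        "E1 \<inter> E2 \<inter> (C - {p}) = {}" "E1 \<inter> (C - {p}) \<noteq> {}" "E2 \<inter> (C - {p}) \<noteq> {}" and "V' \<subseteq> E1" for E1 E2
      proof -
        \<comment> \<open>The half containing the punctured disc is enlarged by the whole disc,
          hence by p. Together with the other half it would separate C, against the induction
          hypothesis.\<close>
        define G1 where "G1 = (E1 \<inter> (C - {p})) \<union> V"
        define G2 where "G2 = E2 \<inter> (C - {p})"
        have "openin X G1" "openin X G2" using E(1,2) Cp V by (auto simp: G1_def G2_def)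
        moreover have "C \<subseteq> G1 \<union> G2" using E(3) pV by (auto simp: G1_def G2_def)
        moreover have "G1 \<inter> G2 \<inter> C = {}"
          using E(4) V'V \<open>V' \<subseteq> E1\<close> by (auto simp: G1_def G2_def)
        moreover have "G1 \<inter> C \<noteq> {}" "G2 \<inter> C \<noteq> {}" using E(6) pV True by (auto simp: G1_def G2_def)
        ultimately show False
          using insert.IH unfolding C_def[symmetric] connectedin by blast
      qed
      have "V' \<subseteq> C - {p}" using VC V'V pV' by blast
      then have "V' \<subseteq> E1 \<union> E2" "E1 \<inter> E2 \<inter> V' = {}" using E(3,4) by blast+
      then have "E1 \<inter> V' = {} \<or> E2 \<inter> V' = {}"
        using conn' E(1,2) unfolding connectedin by blast
      then consider "V' \<subseteq> E1" | "V' \<subseteq> E2" using \<open>V' \<subseteq> E1 \<union> E2\<close> by blast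
      then show False
      proof cases
        case 1
        then show ?thesis using *[OF E] by blast
      next
        case 2
        have "C - {p} \<subseteq> E2 \<union> E1" "E2 \<inter> E1 \<inter> (C - {p}) = {}" using E by blast+
        from *[OF E(2,1) this E(6,5) 2] show ?thesis .
      qed
    qed
  qed
qed

end

section \<open>Transitivity on configurations\<close>

locale nonorientable_atlas = riemannian_atlas X A g for X :: "'a topology" and A g +
  assumes connected: "connected_space X" and nonorientable: "\<not> orientable X A"
begin

abbreviation cover where "cover \<equiv> cover_topology X A"

lemma SDiff_lift_transitive_fixing:
  assumes S: "finite S" "S \<subseteq> double_cover X A"
    and z: "z \<in> double_cover X A" "cover_proj z \<notin> cover_proj ` S"
    and w: "w \<in> double_cover X A" "cover_proj w \<notin> cover_proj ` S"
  obtains F where "F \<in> SDiff X A g" "cover_lift A F z = w" "\<And>s. s \<in> S \<Longrightarrow> cover_lift A F s = s"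
proof -
  interpret C: smooth_atlas cover "cover_atlas X A" by (rule cover_smooth_atlas)
  \<comment> \<open>Orbits of the stabilizer of the points of S. Composites and inverses in
    \<open>SDiff\<close> make this relation transitive and symmetric on the cover.\<close>
  define R where "R = (\<lambda>z w. \<exists>F \<in> SDiff X A g. cover_lift A F z = w \<and> (\<forall>s\<in>S. cover_lift A F s = s))"
  have trans: "R a c" if ab: "R a b" and bc: "R b c" and a: "a \<in> double_cover X A" for a b c
  proof -
    obtain F where F: "F \<in> SDiff X A g" "cover_lift A F a = b" "\<And>s. s \<in> S \<Longrightarrow> cover_lift A F s = s"
      using ab unfolding R_def by blast
    obtain G where G: "G \<in> SDiff X A g" "cover_lift A G b = c" "\<And>s. s \<in> S \<Longrightarrow> cover_lift A G s = s"
      using bc unfolding R_def by blast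
    note comp = cover_lift_compose[OF SDiffD(1)[OF F(1)] SDiffD(1)[OF G(1)]]
    have "cover_lift A (\<lambda>p. G (F p)) a = c" using comp[OF a] F(2) G(2) by simp
    moreover have "cover_lift A (\<lambda>p. G (F p)) s = s" if "s \<in> S" for s
      using comp[OF subsetD[OF S(2) that]] F(3)[OF that] G(3)[OF that] by simp
    ultimately show ?thesis using SDiff_compose[OF F(1) G(1)] unfolding R_def by blast
  qed
  have sym: "R b a" if ab: "R a b" and a: "a \<in> double_cover X A" for a b
  proof -
    obtain F where F: "F \<in> SDiff X A g" "cover_lift A F a = b" "\<And>s. s \<in> S \<Longrightarrow> cover_lift A F s = s"
      using ab unfolding R_def by blast
    note inv = cover_lift_inverse(1)[OF SDiffD(1)[OF F(1)]]
    have "cover_lift A (inv_into (topspace X) F) b = a" using inv[OF a] F(2) by simp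
    moreover have "cover_lift A (inv_into (topspace X) F) s = s" if "s \<in> S" for s
      using inv[OF subsetD[OF S(2) that]] F(3)[OF that] by simp
    ultimately show ?thesis using SDiff_inverse[OF F(1)] unfolding R_def by blast
  qed
  define D where "D = {z \<in> double_cover X A. cover_proj z \<notin> cover_proj ` S}"
  have pS: "cover_proj ` S \<subseteq> topspace X" using S(2) by (auto simp: mem_double_cover)
  have clS: "closedin X (cover_proj ` S)"
    using S(1) pS hausdorff by (intro closedin_Hausdorff_finite) auto
  have opD: "openin cover D"
  proof -
    have "openin cover {z \<in> topspace cover. cover_proj z \<in> topspace X - cover_proj ` S}"
      by (rule openin_continuous_map_preimage[OF cover_proj_continuous openin_diff[OF openin_topspace clS]])
    moreover have "{z \<in> topspace cover. cover_proj z \<in> topspace X - cover_proj ` S} = D"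
      by (auto simp: D_def topspace_cover mem_double_cover)
    ultimately show ?thesis by simp
  qed
  have connD: "connectedin cover D"
  proof -
    \<comment> \<open>Whole fibres have to be removed: a lift that fixes s also fixes its partner,
      as lifts commute with the involution. This is still a finite set of points.\<close>
    have "D = topspace cover - (S \<union> deck_involution ` S)"
    proof (intro equalityI subsetI)
      fix z assume "z \<in> D"
      then have "z \<in> double_cover X A" "cover_proj z \<notin> cover_proj ` S" by (auto simp: D_def)
      moreover from this have "z \<notin> S" "z \<notin> deck_involution ` S" by auto
      ultimately show "z \<in> topspace cover - (S \<union> deck_involution ` S)" by (simp add: topspace_cover)
    next
      fix z assume z: "z \<in> topspace cover - (S \<union> deck_involution ` S)"
      then have zC: "z \<in> double_cover X A" by (simp add: topspace_cover)
      have "cover_proj z \<noteq> cover_proj s" if "s \<in> S" for s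
        using fibre_cases[OF subsetD[OF S(2) that] zC] z that by blast
      then show "z \<in> D" using zC by (auto simp: D_def)
    qed
    then show ?thesis
      using C.connected_minus_finite[OF connected_cover[OF connected nonorientable], of "S \<union> deck_involution ` S"] S(1)
      by simp
  qed
  have nbhd: "\<exists>B. openin cover B \<and> a \<in> B \<and> (\<forall>b\<in>B. R a b)" if a: "a \<in> D" for a
  proof -
    have aC: "a \<in> double_cover X A" and ap: "cover_proj a \<notin> cover_proj ` S" using a by (auto simp: D_def)
    then have p: "cover_proj a \<in> topspace X" by (simp add: mem_double_cover)
    obtain c where c: "c \<in> A" "cover_proj a \<in> chart_dom c" using obtain_chart[OF p] by blast
    let ?U = "topspace X - cover_proj ` S"
    have U: "openin X ?U" "cover_proj a \<in> ?U" using clS p ap by auto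
    obtain V where V: "openin X V" "cover_proj a \<in> V" "V \<subseteq> chart_dom c"
      and mv: "\<And>q. q \<in> V \<Longrightarrow> \<exists>F K. F \<in> SDiff X A g \<and> F (cover_proj a) = q \<and> closedin X K \<and> K \<subseteq> ?U \<and>
        (\<forall>r. r \<notin> K \<longrightarrow> F r = r) \<and> det (chart_jacobian c c F (cover_proj a)) > 0"
      by (rule local_SDiff_move[OF c U]) blast
    let ?B = "sheet X A c (snd a c) V"
    have "R a b" if b: "b \<in> ?B" for b
    proof -
      have b': "b \<in> double_cover X A" "cover_proj b \<in> V" "snd b c = snd a c" using b by (auto simp: mem_sheet)
      obtain F K where F: "F \<in> SDiff X A g" "F (cover_proj a) = cover_proj b" "closedin X K" "K \<subseteq> ?U"
        "\<And>r. r \<notin> K \<Longrightarrow> F r = r" "det (chart_jacobian c c F (cover_proj a)) > 0"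
        using mv[OF b'(2)] by blast
      note d = SDiffD(1)[OF F(1)]
      have bc: "cover_proj b \<in> chart_dom c" using b'(2) V(3) by blast
      \<comment> \<open>The positive determinant preserves the sign in the chart c, so the lift
        arrives at b and not at the other point of its fibre.\<close>
      have "snd (cover_lift A F a) c = snd b c"
        using snd_cover_lift[OF d aC c(1) c(1) c(2)] F(2,6) bc b'(3) by simp
      then have "cover_lift A F a = b"
        using cover_lift_mem[OF d aC] F(2) bc by (intro cover_point_eqI[OF _ b'(1) _ c(1)]) simp_all
      \<comment> \<open>The complement of the support K is an open neighbourhood of the projection
        of s on which F is the identity.\<close>
      moreover have "cover_lift A F s = s" if "s \<in> S" for s
      proof (rule cover_lift_locally_id[OF d subsetD[OF S(2) that] openin_diff[OF openin_topspace F(3)]])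
        show "cover_proj s \<in> topspace X - K" using that pS F(4) by blast
        show "F q = q" if "q \<in> topspace X - K" for q using F(5) that by blast
      qed
      ultimately show ?thesis using F(1) unfolding R_def by blast
    qed
    moreover have "a \<in> ?B" using aC V(2) by (simp add: mem_sheet)
    ultimately show ?thesis using openin_sheet[OF c(1) V(1,3)] by blast
  qed
  have DC: "D \<subseteq> double_cover X A" by (auto simp: D_def)
  define E1 where "E1 = {b \<in> D. R z b}"
  define E2 where "E2 = {b \<in> D. \<not> R z b}"
  have zD: "z \<in> D" "w \<in> D" using z w by (auto simp: D_def)
  have "openin cover E1"
    unfolding openin_subopen[of _ E1]
  proof
    fix b assume b: "b \<in> E1"
    then obtain B where B: "openin cover B" "b \<in> B" "\<forall>b'\<in>B. R b b'" using nbhd[of b] by (auto simp: E1_def)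
    have "B \<inter> D \<subseteq> E1" using trans[of z b] B(3) b z(1) unfolding E1_def by blast
    then show "\<exists>T. openin cover T \<and> b \<in> T \<and> T \<subseteq> E1"
      using openin_Int[OF B(1) opD] B(2) b unfolding E1_def by blast
  qed
  moreover have "openin cover E2"
    unfolding openin_subopen[of _ E2]
  proof
    fix b assume b: "b \<in> E2"
    then obtain B where B: "openin cover B" "b \<in> B" "\<forall>b'\<in>B. R b b'" using nbhd[of b] by (auto simp: E2_def)
    have bC: "b \<in> double_cover X A" using b DC by (auto simp: E2_def)
    \<comment> \<open>If z could be moved to b', symmetry of R would allow it to be moved on to
      b.\<close>
    have "b' \<in> E2" if b': "b' \<in> B \<inter> D" for b'
    proof -
      have "R b' b" using sym[OF _ bC] B(3) b' by blast
      then have "\<not> R z b'" using trans[of z b' b] z(1) b unfolding E2_def by blast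
      then show ?thesis using b' unfolding E2_def by blast
    qed
    then show "\<exists>T. openin cover T \<and> b \<in> T \<and> T \<subseteq> E2"
      using openin_Int[OF B(1) opD] B(2) b unfolding E2_def by blast
  qed
  moreover have "E1 \<inter> D \<noteq> {}"
    using nbhd[OF zD(1)] zD(1) unfolding E1_def by blast
  moreover have "D \<subseteq> E1 \<union> E2" "E1 \<inter> E2 \<inter> D = {}" by (auto simp: E1_def E2_def)
  ultimately have "E2 \<inter> D = {}"
    using connD unfolding connectedin by meson
  then have "R z w" using zD(2) unfolding E2_def by blast
  then show ?thesis using that unfolding R_def by blast
qed

lemma configurations_iff:
  "y \<in> configurations X A N \<longleftrightarrow>
    y \<in> {..<N} \<rightarrow>\<^sub>E double_cover X A \<and> inj_on (\<lambda>j. cover_proj (y j)) {..<N}"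
  unfolding configurations_def very_big_diagonal_def inj_on_def by blast

lemma SDiff_lift_transitive:
  assumes y: "y \<in> configurations X A N" and y': "y' \<in> configurations X A N"
  obtains F where "F \<in> SDiff X A g" "\<And>j. j < N \<Longrightarrow> cover_lift A F (y j) = y' j"
proof -
  have yC: "y j \<in> double_cover X A" "y' j \<in> double_cover X A" if "j < N" for j
    using y y' that by (auto simp: configurations_iff)
  have inj: "i = j" if "i < N" "j < N" "cover_proj (y i) = cover_proj (y j) \<or> cover_proj (y' i) = cover_proj (y' j)" for i j
    using y y' that by (auto simp: configurations_iff dest: inj_onD)
  have "\<exists>F \<in> SDiff X A g. \<forall>j<k. cover_lift A F (y j) = y' j" if "k \<le> N" for k
    using that
  proof (induction k)
    case 0
    show ?case using SDiff_id by blast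
  next
    case (Suc k)
    then obtain F where F: "F \<in> SDiff X A g" "\<And>j. j < k \<Longrightarrow> cover_lift A F (y j) = y' j" by auto
    have k: "k < N" using Suc.prems by simp
    note d = SDiffD(1)[OF F(1)]
    let ?S = "y' ` {..<k}"
    have S: "finite ?S" "?S \<subseteq> double_cover X A" using yC k by auto
    note Fk = cover_lift_mem[OF d yC(1)[OF k]]
    \<comment> \<open>F is injective on the surface, so the k-th point cannot be carried into the
      fibre of one already placed.\<close>
    have 1: "cover_proj (cover_lift A F (y k)) \<notin> cover_proj ` ?S"
    proof
      assume "cover_proj (cover_lift A F (y k)) \<in> cover_proj ` ?S"
      then obtain j where j: "j < k" "cover_proj (y' j) = F (cover_proj (y k))" using Fk(2) by auto
      have jN: "j < N" using j k by simp
      have "F (cover_proj (y j)) = F (cover_proj (y k))"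
        using F(2)[OF j(1)] j(2) cover_lift_mem(2)[OF d yC(1)[OF jN]] by simp
      then have "cover_proj (y j) = cover_proj (y k)"
        using diffeomorphism_inverse(4)[OF d] yC(1)[OF jN] yC(1)[OF k] by (metis mem_double_cover)
      then show False using inj[OF jN k] j by simp
    qed
    have 2: "cover_proj (y' k) \<notin> cover_proj ` ?S"
    proof
      assume "cover_proj (y' k) \<in> cover_proj ` ?S"
      then obtain j where j: "j < k" "cover_proj (y' j) = cover_proj (y' k)" by auto
      then show False using inj[of j k] k by simp
    qed
    \<comment> \<open>H corrects the k-th point and fixes the lifted points that are already in
      place, so composing it with F keeps the earlier equations.\<close>
    obtain H where H: "H \<in> SDiff X A g" "cover_lift A H (cover_lift A F (y k)) = y' k"
      "\<And>s. s \<in> ?S \<Longrightarrow> cover_lift A H s = s"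
      by (rule SDiff_lift_transitive_fixing[OF S Fk(1) 1 yC(2)[OF k] 2]) blast
    note comp = cover_lift_compose[OF d SDiffD(1)[OF H(1)]]
    have "cover_lift A (\<lambda>p. H (F p)) (y j) = y' j" if j: "j < Suc k" for j
    proof (cases "j = k")
      case True
      then show ?thesis using comp[OF yC(1)[OF k]] H(2) by simp
    next
      case False
      then have "j < k" "j < N" using j k by auto
      then show ?thesis using comp[OF yC(1)] F(2) H(3) by simp
    qed
    then show ?case using SDiff_compose[OF F(1) H(1)] by blast
  qed
  then show ?thesis using that by blast
qed

end

section \<open>Vortex currents\<close>

lemma finite_separation:
  assumes "Hausdorff_space X" "finite I" "inj_on x I" "x ` I \<subseteq> topspace X"
  obtains V where "\<And>i. i \<in> I \<Longrightarrow> openin X (V i) \<and> x i \<in> V i"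
    "\<And>i j. i \<in> I \<Longrightarrow> j \<in> I \<Longrightarrow> i \<noteq> j \<Longrightarrow> V i \<inter> V j = {}"
proof -
  have "\<exists>U W. openin X U \<and> openin X W \<and> x i \<in> U \<and> x j \<in> W \<and> U \<inter> W = {}"
    if "i \<in> I" "j \<in> I" "i \<noteq> j" for i j
  proof -
    have "x i \<noteq> x j" using assms(3) that by (meson inj_onD)
    moreover have "x i \<in> topspace X" "x j \<in> topspace X" using assms(4) that by auto
    ultimately show ?thesis using assms(1) unfolding Hausdorff_space_def disjnt_def by blast
  qed
  then obtain U W where UW: "\<And>i j. i \<in> I \<Longrightarrow> j \<in> I \<Longrightarrow> i \<noteq> j \<Longrightarrow>
      openin X (U i j) \<and> openin X (W i j) \<and> x i \<in> U i j \<and> x j \<in> W i j \<and> U i j \<inter> W i j = {}"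
    by metis
  \<comment> \<open>The sets chosen for (i, j) and for (j, i) may differ, so both kinds of
    neighbourhoods of \<open>x i\<close> are intersected. The factor \<open>topspace X\<close> gives
    the right value when I has no other element and the intersection is \<open>UNIV\<close>.\<close>
  define V where "V = (\<lambda>i. topspace X \<inter> (\<Inter>j\<in>I - {i}. U i j \<inter> W j i))"
  show ?thesis
  proof (rule that[of V])
    fix i assume i: "i \<in> I"
    have "openin X (V i)"
    proof (cases "I - {i} = {}")
      case True
      then have "V i = topspace X" unfolding V_def by blast
      then show ?thesis by simp
    next
      case False
      have "openin X (\<Inter>j\<in>I - {i}. U i j \<inter> W j i)"
        using assms(2) False UW i by (intro openin_Inter) auto
      then show ?thesis unfolding V_def by (intro openin_Int openin_topspace)
    qed
    moreover have "x i \<in> V i" using assms(4) UW i by (auto simp: V_def)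
    ultimately show "openin X (V i) \<and> x i \<in> V i" ..
  next
    fix i j assume ij: "i \<in> I" "j \<in> I" "i \<noteq> j"
    have "V i \<subseteq> U i j" "V j \<subseteq> W i j" using ij by (auto simp: V_def)
    then show "V i \<inter> V j = {}" using UW[OF ij] by blast
  qed
qed

lemma sum_single:
  assumes "finite I" "k \<in> I" "\<And>i. i \<in> I \<Longrightarrow> i \<noteq> k \<Longrightarrow> f i = (0::real)"
  shows "(\<Sum>i\<in>I. f i) = f k"
proof -
  have "(\<Sum>i\<in>I. f i) = (\<Sum>i\<in>I. if i = k then f k else 0)"
    by (rule sum.cong) (use assms(3) in auto)
  then show ?thesis using assms(1,2) by simp
qed

section \<open>Twisted test functions and the detection of vortices\<close>

context smooth_atlas
begin

abbreviation twisted where "twisted \<equiv> twisted_test_functions X A"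

lemma twistedD:
  assumes "f \<in> twisted"
  shows "f \<in> test_functions (cover_topology X A) (cover_atlas X A)"
    and "z \<in> double_cover X A \<Longrightarrow> f (deck_involution z) = - f z"
  using assms by (auto simp: twisted_test_functions_def)

lemma twisted_continuous: "f \<in> twisted \<Longrightarrow> continuous_map (cover_topology X A) euclideanreal f"
  using smooth_atlas.smooth_function_continuous[OF cover_smooth_atlas] twistedD(1)
  by (auto simp: test_functions_iff)

text \<open>Makes \<open>pullback_to_cover\<close> meaningful, and supplies the odd bump functions
  that detect vortices.\<close>

lemma twisted_odd_part:
  assumes f: "f \<in> test_functions (cover_topology X A) (cover_atlas X A)"
  shows "(\<lambda>z. f z - f (deck_involution z)) \<in> twisted"
proof -
  have "f \<circ> deck_involution \<in> test_functions (cover_topology X A) (cover_atlas X A)"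
    by (rule smooth_atlas.test_function_compose[OF cover_smooth_atlas cover_smooth_atlas deck_smooth deck_smooth _ f]) simp
  from smooth_atlas.test_function_diff[OF cover_smooth_atlas f this]
  show ?thesis by (simp add: twisted_test_functions_def)
qed

text \<open>Justifies \<open>pullback_current\<close>: the transported function stays odd since
  lifts commute with the involution, and stays compactly supported since the lift has a smooth
  inverse.\<close>

lemma twisted_compose_lift:
  assumes F: "diffeomorphism X A F" and f: "f \<in> twisted"
  shows "f \<circ> cover_lift A F \<in> twisted"
proof -
  let ?G = "inv_into (topspace X) F"
  note F' = diffeomorphism_inverse[OF F]
  have G: "diffeomorphism X A ?G" by (rule diffeomorphismI[where G = F]) (use F' in auto)
  have "f \<circ> cover_lift A F \<in> test_functions (cover_topology X A) (cover_atlas X A)"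
    by (rule smooth_atlas.test_function_compose[OF cover_smooth_atlas cover_smooth_atlas
          cover_lift_smooth[OF F] cover_lift_smooth[OF G] _ twistedD(1)[OF f]])
      (simp add: topspace_cover cover_lift_inverse[OF F])
  moreover have "(f \<circ> cover_lift A F) (deck_involution z) = - (f \<circ> cover_lift A F) z"
    if "z \<in> double_cover X A" for z
    using cover_lift_deck[OF F that] twistedD(2)[OF f cover_lift_mem(1)[OF F that]] by simp
  ultimately show ?thesis by (simp add: twisted_test_functions_def)
qed

lemma vortex_current_apply:
  "f \<in> twisted \<Longrightarrow> vortex_current X A N \<Gamma> y f = (\<Sum>j<N. \<Gamma> j * f (y j))"
  by (simp add: vortex_current_def)

lemma pullback_to_cover_vortex_current:
  assumes "f \<in> test_functions (cover_topology X A) (cover_atlas X A)"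
  shows "pullback_to_cover X A (vortex_current X A N \<Gamma> y) f =
    (\<Sum>j<N. \<Gamma> j * f (y j) + (- \<Gamma> j) * f (deck_involution (y j)))"
  using assms twisted_odd_part[OF assms]
  by (simp add: pullback_to_cover_def vortex_current_apply algebra_simps)

text \<open>The pulled-back current is tested with bump functions that are not odd, each isolating a
  single point of the cover; distinct projections keep the other vortices and their partners away
  from it.\<close>

lemma vortex_strengths_vortex_current:
  assumes y: "\<And>j. j < N \<Longrightarrow> y j \<in> double_cover X A" and inj: "inj_on (\<lambda>j. cover_proj (y j)) {..<N}"
    and \<Gamma>: "\<Gamma> \<in> extensional {..<N}"
  shows "vortex_strengths X A N (vortex_current X A N \<Gamma> y) y \<Gamma>' \<longleftrightarrow> \<Gamma>' = \<Gamma>"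
proof
  let ?T = "test_functions (cover_topology X A) (cover_atlas X A)"
  assume "\<Gamma>' = \<Gamma>"
  moreover have "pullback_to_cover X A (vortex_current X A N \<Gamma> y) =
      (\<lambda>f \<in> ?T. \<Sum>j<N. \<Gamma> j * f (y j) + (- \<Gamma> j) * f (deck_involution (y j)))"
  proof
    fix f
    show "pullback_to_cover X A (vortex_current X A N \<Gamma> y) f =
        (\<lambda>f \<in> ?T. \<Sum>j<N. \<Gamma> j * f (y j) + (- \<Gamma> j) * f (deck_involution (y j))) f"
      using pullback_to_cover_vortex_current[of f N \<Gamma> y] by (cases "f \<in> ?T") (simp_all add: pullback_to_cover_def)
  qed
  ultimately show "vortex_strengths X A N (vortex_current X A N \<Gamma> y) y \<Gamma>'"
    using \<Gamma> by (simp add: vortex_strengths_def)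
next
  let ?T = "test_functions (cover_topology X A) (cover_atlas X A)"
  interpret C: smooth_atlas "cover_topology X A" "cover_atlas X A" by (rule cover_smooth_atlas)
  assume "vortex_strengths X A N (vortex_current X A N \<Gamma> y) y \<Gamma>'"
  then have ext: "\<Gamma>' \<in> extensional {..<N}" and eq: "pullback_to_cover X A (vortex_current X A N \<Gamma> y) =
      (\<lambda>f \<in> ?T. \<Sum>j<N. \<Gamma>' j * f (y j) + (- \<Gamma>' j) * f (deck_involution (y j)))"
    by (auto simp: vortex_strengths_def)
  have "\<Gamma>' k = \<Gamma> k" if k: "k < N" for k
  proof -
    let ?P = "y ` {..<N} \<union> (\<lambda>j. deck_involution (y j)) ` {..<N}"
    have "?P \<subseteq> topspace (cover_topology X A)"
      unfolding topspace_cover using y deck_in_double_cover[OF y] by blast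
    then have "closedin (cover_topology X A) (?P - {y k})"
      using C.hausdorff by (intro closedin_Hausdorff_finite) auto
    then have U: "openin (cover_topology X A) (topspace (cover_topology X A) - (?P - {y k}))"
      by (rule openin_diff[OF openin_topspace])
    have yU: "y k \<in> topspace (cover_topology X A) - (?P - {y k})" using y[OF k] by (simp add: topspace_cover)
    obtain b B where b: "b \<in> ?T" "y k \<in> B" "\<And>z. z \<in> B \<Longrightarrow> b z = 1"
      "\<And>z. b z \<noteq> 0 \<Longrightarrow> z \<in> topspace (cover_topology X A) - (?P - {y k})"
      by (rule C.bump_function[OF U yU]) blast
    have b0: "b z = 0" if "z \<in> ?P" "z \<noteq> y k" for z using b(4)[of z] that by blast
    have off: "y j \<noteq> y k" "deck_involution (y j) \<noteq> y k" if "j < N" "j \<noteq> k" for j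
    proof -
      have "cover_proj (y j) \<noteq> cover_proj (y k)" using inj_onD[OF inj, of j k] that k by auto
      then show "y j \<noteq> y k" "deck_involution (y j) \<noteq> y k" using cover_proj_deck[of "y j"] by metis+
    qed
    have *: "(\<Sum>j<N. G j * b (y j) + (- G j) * b (deck_involution (y j))) = G k" for G
    proof -
      have "(\<Sum>j<N. G j * b (y j) + (- G j) * b (deck_involution (y j))) =
          G k * b (y k) + (- G k) * b (deck_involution (y k))"
        by (rule sum_single) (use k b0 off in auto)
      \<comment> \<open>The involution has no fixed points, so the partner of \<open>y k\<close> is
        among the points where b vanishes.\<close>
      moreover have "b (deck_involution (y k)) = 0" using b0 deck_neq[OF y[OF k]] k by blast
      ultimately show ?thesis using b(3)[OF b(2)] by simp
    qed
    have "(\<Sum>j<N. \<Gamma> j * b (y j) + (- \<Gamma> j) * b (deck_involution (y j))) =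
        (\<Sum>j<N. \<Gamma>' j * b (y j) + (- \<Gamma>' j) * b (deck_involution (y j)))"
      using pullback_to_cover_vortex_current[OF b(1), of N \<Gamma> y] b(1) unfolding eq by simp
    then show ?thesis unfolding * by simp
  qed
  \<comment> \<open>Both functions take the default value \<open>undefined\<close> outside the N
    indices, so agreement on these is equality.\<close>
  then show "\<Gamma>' = \<Gamma>" using ext \<Gamma> by (intro extensionalityI) auto
qed

text \<open>A renumbering only permutes the summands, and where the other point of a fibre is taken,
  oddness of the test function compensates the opposite strength.\<close>

lemma same_vortices_current:
  assumes y: "\<And>j. j < N \<Longrightarrow> y j \<in> double_cover X A" and same: "same_vortices N \<Gamma> y y'"
  shows "vortex_current X A N \<Gamma> y = vortex_current X A N \<Gamma> y'"
proof -
  obtain s where s: "bij_betw s {..<N} {..<N}" "\<And>j. j < N \<Longrightarrow> (\<Gamma> (s j) = \<Gamma> j \<and> y' (s j) = y j) \<or>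
      (\<Gamma> (s j) = - \<Gamma> j \<and> y' (s j) = deck_involution (y j))"
    using same unfolding same_vortices_def by blast
  have "(\<Sum>j<N. \<Gamma> j * f (y j)) = (\<Sum>j<N. \<Gamma> j * f (y' j))" if f: "f \<in> twisted" for f
  proof -
    have "(\<Sum>j<N. \<Gamma> j * f (y' j)) = (\<Sum>j<N. \<Gamma> (s j) * f (y' (s j)))"
      by (rule sum.reindex_bij_betw[OF s(1), symmetric])
    also have "\<dots> = (\<Sum>j<N. \<Gamma> j * f (y j))"
    proof (rule sum.cong[OF refl])
      fix j assume "j \<in> {..<N}"
      then have j: "j < N" by simp
      show "\<Gamma> (s j) * f (y' (s j)) = \<Gamma> j * f (y j)"
        using s(2)[OF j] twistedD(2)[OF f y[OF j]] by auto
    qed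
    finally show ?thesis by simp
  qed
  then show ?thesis by (auto simp: vortex_current_def fun_eq_iff)
qed

text \<open>For each vortex take an odd bump function and a second one supported where the first is
  \<open>\<plusminus>1\<close>. The second forces every nearby current to have a vortex in each of the disjoint
  neighbourhoods, hence exactly one; the first then reads off its strength.\<close>

lemma weakly_close_configurations:
  assumes y: "\<And>j. j < N \<Longrightarrow> y j \<in> double_cover X A" and inj: "inj_on (\<lambda>j. cover_proj (y j)) {..<N}"
    and \<Gamma>: "\<And>j. j < N \<Longrightarrow> \<Gamma> j \<noteq> 0"
    and W: "\<And>j. j < N \<Longrightarrow> openin (cover_topology X A) (W j) \<and> y j \<in> W j"
  obtains \<Phi> \<epsilon> where "finite \<Phi>" "\<Phi> \<subseteq> twisted" "\<epsilon> > (0::real)"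
    "\<And>y'. (\<And>j. j < N \<Longrightarrow> y' j \<in> double_cover X A) \<Longrightarrow>
      (\<And>f. f \<in> \<Phi> \<Longrightarrow> \<bar>vortex_current X A N \<Gamma> y' f - vortex_current X A N \<Gamma> y f\<bar> < \<epsilon>) \<Longrightarrow>
      \<exists>s. bij_betw s {..<N} {..<N} \<and> (\<forall>j<N. (\<Gamma> (s j) = \<Gamma> j \<and> y' (s j) \<in> W j) \<or>
        (\<Gamma> (s j) = - \<Gamma> j \<and> deck_involution (y' (s j)) \<in> W j))"
proof -
  let ?T = "cover_topology X A"
  interpret C: smooth_atlas ?T "cover_atlas X A" by (rule cover_smooth_atlas)
  have "(\<lambda>j. cover_proj (y j)) ` {..<N} \<subseteq> topspace X" using y by (auto simp: mem_double_cover)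
  then obtain V where V: "\<And>j. j < N \<Longrightarrow> openin X (V j) \<and> cover_proj (y j) \<in> V j"
    "\<And>i j. i < N \<Longrightarrow> j < N \<Longrightarrow> i \<noteq> j \<Longrightarrow> V i \<inter> V j = {}"
    using finite_separation[OF hausdorff finite_lessThan inj] by (metis lessThan_iff)
  \<comment> \<open>One predicate for all three objects, so that they can be chosen simultaneously
    for all j.\<close>
  define R where "R = (\<lambda>j b B h. b \<in> test_functions ?T (cover_atlas X A) \<and> h \<in> test_functions ?T (cover_atlas X A) \<and>
      (\<forall>z. b z \<noteq> 0 \<longrightarrow> cover_proj z \<in> V j) \<and> (\<forall>z. h z \<noteq> 0 \<longrightarrow> z \<in> B) \<and> h (y j) = 1 \<and> y j \<in> B \<and> B \<subseteq> W j \<and>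
      (\<forall>z\<in>B. b z = 1 \<and> b (deck_involution z) = 0 \<and> cover_proj z \<in> V j))"
  have "\<exists>b B h. R j b B h" if j: "j < N" for j
  proof -
    have p: "cover_proj (y j) \<in> topspace X" using y[OF j] by (simp add: mem_double_cover)
    obtain c where c: "c \<in> A" "cover_proj (y j) \<in> chart_dom c" using obtain_chart[OF p] by blast
    have sgn: "snd (y j) c \<in> {-1, 1}"
      using y[OF j] by (intro orientation_values[OF _ c]) (simp add: mem_double_cover)
    \<comment> \<open>U lies in a single sheet, so it never contains a point together with its
      partner. Hence the odd part of b is exactly 1 on B and exactly -1 at the partners of points of
      B.\<close>
    define U where "U = W j \<inter> sheet X A c (snd (y j) c) (chart_dom c \<inter> V j)"
    have U: "openin ?T U" "y j \<in> U"
      unfolding U_def using W[OF j] V(1)[OF j] c y[OF j] chart_dom_open[OF charts[OF c(1)]]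
      by (auto intro!: openin_Int openin_sheet simp: mem_sheet)
    obtain b B where b: "b \<in> test_functions ?T (cover_atlas X A)" "openin ?T B" "y j \<in> B" "B \<subseteq> U"
      "\<And>q. q \<in> B \<Longrightarrow> b q = 1" "\<And>q. b q \<noteq> 0 \<Longrightarrow> q \<in> U"
      by (rule C.bump_function[OF U]) blast
    obtain h B' where h: "h \<in> test_functions ?T (cover_atlas X A)" "y j \<in> B'"
      "\<And>q. q \<in> B' \<Longrightarrow> h q = 1" "\<And>q. h q \<noteq> 0 \<Longrightarrow> q \<in> B"
      by (rule C.bump_function[OF b(2,3)]) blast
    have UV: "cover_proj z \<in> V j" "snd z c = snd (y j) c" "z \<in> W j" if "z \<in> U" for z
      using that by (auto simp: U_def mem_sheet)
    have "b (deck_involution z) = 0" if "z \<in> B" for z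
    proof (rule ccontr)
      assume "b (deck_involution z) \<noteq> 0"
      from UV(2)[OF b(6)[OF this]] have "- snd z c = snd (y j) c" by simp
      moreover have "snd z c = snd (y j) c" using UV(2) that b(4) by blast
      ultimately show False using sgn by auto
    qed
    then have "\<forall>z\<in>B. b z = 1 \<and> b (deck_involution z) = 0 \<and> cover_proj z \<in> V j"
      using b(4,5) UV(1) by blast
    moreover have "\<forall>z. b z \<noteq> 0 \<longrightarrow> cover_proj z \<in> V j" "B \<subseteq> W j" using b(4,6) UV(1,3) by blast+
    moreover have "\<forall>z. h z \<noteq> 0 \<longrightarrow> z \<in> B" "h (y j) = 1" using h by blast+
    ultimately show ?thesis using b(1,3) h(1) unfolding R_def by blast
  qed
  then obtain b B h where R: "\<And>j. j < N \<Longrightarrow> R j (b j) (B j) (h j)"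
    by metis
  then have bt: "\<And>j. j < N \<Longrightarrow> b j \<in> test_functions ?T (cover_atlas X A)"
    and ht: "\<And>j. j < N \<Longrightarrow> h j \<in> test_functions ?T (cover_atlas X A)"
    and bV: "\<And>j z. j < N \<Longrightarrow> b j z \<noteq> 0 \<Longrightarrow> cover_proj z \<in> V j"
    and hB: "\<And>j z. j < N \<Longrightarrow> h j z \<noteq> 0 \<Longrightarrow> z \<in> B j"
    and hy: "\<And>j. j < N \<Longrightarrow> h j (y j) = 1" and yB: "\<And>j. j < N \<Longrightarrow> y j \<in> B j" and BW: "\<And>j. j < N \<Longrightarrow> B j \<subseteq> W j"
    and bB: "\<And>j z. j < N \<Longrightarrow> z \<in> B j \<Longrightarrow> b j z = 1 \<and> b j (deck_involution z) = 0 \<and> cover_proj z \<in> V j"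
    unfolding R_def by blast+
  define f where "f = (\<lambda>j z. b j z - b j (deck_involution z))"
  define k where "k = (\<lambda>j z. h j z - h j (deck_involution z))"
  have ft: "f j \<in> twisted" "k j \<in> twisted" if "j < N" for j
    unfolding f_def k_def using twisted_odd_part bt ht that by blast+
  have fV: "f j z = 0" if "j < N" "cover_proj z \<notin> V j" for j z
  proof -
    have "b j z = 0" using bV[OF that(1)] that(2) by blast
    moreover have "b j (deck_involution z) = 0"
      using bV[OF that(1), of "deck_involution z"] that(2) by auto
    ultimately show ?thesis by (simp add: f_def)
  qed
  have kB: "z \<in> B j \<or> deck_involution z \<in> B j" if "j < N" "k j z \<noteq> 0" for j z
  proof (rule ccontr)
    assume n: "\<not> ?thesis"
    have "h j z = 0" "h j (deck_involution z) = 0" using hB[OF that(1)] n by blast+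
    then show False using that(2) by (simp add: k_def)
  qed
  have f1: "f j z = 1" if "j < N" "z \<in> B j" for j z
    using bB[OF that] by (simp add: f_def)
  have f2: "f j z = -1" if "j < N" "deck_involution z \<in> B j" for j z
    using bB[OF that] by (simp add: f_def)
  have BV: "cover_proj z \<in> V j" if "j < N" "z \<in> B j \<or> deck_involution z \<in> B j" for j z
    using bB[OF that(1), of z] bB[OF that(1), of "deck_involution z"] that(2) by auto
  have k1: "k j (y j) = 1" if j: "j < N" for j
  proof -
    have "deck_involution (y j) \<notin> B j"
      using f1[OF j, of "y j"] f2[OF j, of "y j"] yB[OF j] by auto
    then have "h j (deck_involution (y j)) = 0" using hB[OF j] by blast
    then show ?thesis using hy[OF j] by (simp add: k_def)
  qed
  have other: "f j (y i) = 0" "k j (y i) = 0" if "i < N" "j < N" "i \<noteq> j" for i j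
  proof -
    have nV: "cover_proj (y i) \<notin> V j" using V that by blast
    then show "f j (y i) = 0" using fV that by blast
    show "k j (y i) = 0" using kB[OF that(2), of "y i"] BV[OF that(2), of "y i"] nV by blast
  qed
  have at_y: "vortex_current X A N \<Gamma> y (f j) = \<Gamma> j" "vortex_current X A N \<Gamma> y (k j) = \<Gamma> j" if j: "j < N" for j
  proof -
    have "(\<Sum>i<N. \<Gamma> i * f j (y i)) = \<Gamma> j * f j (y j)" "(\<Sum>i<N. \<Gamma> i * k j (y i)) = \<Gamma> j * k j (y j)"
      by (rule sum_single; use j other in simp)+
    then show "vortex_current X A N \<Gamma> y (f j) = \<Gamma> j" "vortex_current X A N \<Gamma> y (k j) = \<Gamma> j"
      using vortex_current_apply ft[OF j] f1[OF j yB[OF j]] k1[OF j] by simp_all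
  qed
  \<comment> \<open>\<open>\<epsilon>\<close> is at most every non-zero value among the moduli,
    differences and sums of strengths, so an error below \<open>\<epsilon>\<close> determines a
    strength exactly. The element 1 keeps the set non-empty when N = 0.\<close>
  define M where "M = insert 1 ((\<lambda>j. \<bar>\<Gamma> j\<bar>) ` {..<N} \<union> (\<lambda>(i, j). \<bar>\<Gamma> i - \<Gamma> j\<bar>) ` ({..<N} \<times> {..<N}) \<union>
    (\<lambda>(i, j). \<bar>\<Gamma> i + \<Gamma> j\<bar>) ` ({..<N} \<times> {..<N})) - {0}"
  define \<epsilon> where "\<epsilon> = Min M"
  have M: "finite M" "M \<noteq> {}" "\<And>m. m \<in> M \<Longrightarrow> m > 0"
    by (auto simp: M_def)
  have e: "\<epsilon> > 0" "\<And>m. m \<in> M \<Longrightarrow> \<epsilon> \<le> m"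
    unfolding \<epsilon>_def using M by auto
  have e1: "\<epsilon> \<le> \<bar>\<Gamma> j\<bar>" if "j < N" for j
    by (rule e(2)) (use \<Gamma>[OF that] that in \<open>auto simp: M_def\<close>)
  have e2: "\<Gamma> i = \<Gamma> j" if "i < N" "j < N" "\<bar>\<Gamma> i - \<Gamma> j\<bar> < \<epsilon>" for i j
  proof (rule ccontr)
    assume "\<Gamma> i \<noteq> \<Gamma> j"
    then have "\<bar>\<Gamma> i - \<Gamma> j\<bar> \<in> M" using that by (force simp: M_def)
    then show False using e(2) that(3) by force
  qed
  have e3: "\<Gamma> i = - \<Gamma> j" if "i < N" "j < N" "\<bar>\<Gamma> i + \<Gamma> j\<bar> < \<epsilon>" for i j
  proof (rule ccontr)
    assume "\<Gamma> i \<noteq> - \<Gamma> j"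
    then have "\<bar>\<Gamma> i + \<Gamma> j\<bar> \<in> M" using that by (force simp: M_def)
    then show False using e(2) that(3) by force
  qed
  define \<Phi> where "\<Phi> = f ` {..<N} \<union> k ` {..<N}"
  show ?thesis
  proof (rule that[of \<Phi> \<epsilon>])
    show "finite \<Phi>" "\<Phi> \<subseteq> twisted" using ft by (auto simp: \<Phi>_def)
    show "\<epsilon> > 0" by (rule e(1))
    fix y'
    assume y': "\<And>j. j < N \<Longrightarrow> y' j \<in> double_cover X A"
      and close: "\<And>f. f \<in> \<Phi> \<Longrightarrow> \<bar>vortex_current X A N \<Gamma> y' f - vortex_current X A N \<Gamma> y f\<bar> < \<epsilon>"
    have closef: "\<bar>(\<Sum>i<N. \<Gamma> i * f j (y' i)) - \<Gamma> j\<bar> < \<epsilon>" and closek: "\<bar>(\<Sum>i<N. \<Gamma> i * k j (y' i)) - \<Gamma> j\<bar> < \<epsilon>"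
      if j: "j < N" for j
      using close[of "f j"] close[of "k j"] at_y[OF j] j vortex_current_apply[OF ft(1)[OF j]]
        vortex_current_apply[OF ft(2)[OF j]] by (simp_all add: \<Phi>_def)
    \<comment> \<open>Without a vortex in B j or its mirror image the value on \<open>k j\<close>
      would be 0, which is not within \<open>\<epsilon>\<close> of the non-zero strength.\<close>
    have "\<exists>i<N. y' i \<in> B j \<or> deck_involution (y' i) \<in> B j" if j: "j < N" for j
    proof (rule ccontr)
      assume "\<not> ?thesis"
      then have "k j (y' i) = 0" if "i < N" for i using kB[OF j] that by blast
      then have "(\<Sum>i<N. \<Gamma> i * k j (y' i)) = 0" by simp
      then show False using closek[OF j] e1[OF j] by simp
    qed
    then obtain s where s: "\<And>j. j < N \<Longrightarrow> s j < N" "\<And>j. j < N \<Longrightarrow> y' (s j) \<in> B j \<or> deck_involution (y' (s j)) \<in> B j"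
      by metis
    have sV: "cover_proj (y' (s j)) \<in> V j" if "j < N" for j
      using BV[OF that s(2)[OF that]] .
    \<comment> \<open>The V j are disjoint, so different j find different vortices. As there are N
      of each, every vortex is accounted for and no V j contains a second one.\<close>
    have "inj_on s {..<N}"
    proof (rule inj_onI)
      fix i j assume "i \<in> {..<N}" "j \<in> {..<N}" "s i = s j"
      then show "i = j" using sV[of i] sV[of j] V(2)[of i j] by auto
    qed
    moreover have "s ` {..<N} \<subseteq> {..<N}" using s(1) by auto
    ultimately have bij: "bij_betw s {..<N} {..<N}"
      by (simp add: bij_betw_def endo_inj_surj)
    have "(\<Gamma> (s j) = \<Gamma> j \<and> y' (s j) \<in> W j) \<or> (\<Gamma> (s j) = - \<Gamma> j \<and> deck_involution (y' (s j)) \<in> W j)"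
      if j: "j < N" for j
    proof -
      \<comment> \<open>All other vortices lie over the remaining sets V m, where \<open>f j\<close>
        vanishes.\<close>
      have "(\<Sum>i<N. \<Gamma> i * f j (y' i)) = \<Gamma> (s j) * f j (y' (s j))"
      proof (rule sum_single)
        fix i assume i: "i \<in> {..<N}" "i \<noteq> s j"
        then obtain m where m: "m < N" "i = s m" using bij by (auto simp: bij_betw_def)
        then have "m \<noteq> j" using i by auto
        then have "cover_proj (y' i) \<notin> V j" using sV[OF m(1)] V(2)[OF m(1) j] m(2) by blast
        then show "\<Gamma> i * f j (y' i) = 0" using fV[OF j] by simp
      qed (use s(1)[OF j] in auto)
      then have cl: "\<bar>\<Gamma> (s j) * f j (y' (s j)) - \<Gamma> j\<bar> < \<epsilon>" using closef[OF j] by simp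
      from s(2)[OF j] show ?thesis
      proof
        assume B: "y' (s j) \<in> B j"
        then have "\<Gamma> (s j) = \<Gamma> j" using cl f1[OF j B] e2[OF s(1)[OF j] j] by simp
        then show ?thesis using B BW[OF j] by blast
      next
        assume B: "deck_involution (y' (s j)) \<in> B j"
        have "\<bar>\<Gamma> (s j) + \<Gamma> j\<bar> < \<epsilon>" using cl f2[OF j B] by simp
        then have "\<Gamma> (s j) = - \<Gamma> j" using e3[OF s(1)[OF j] j] by simp
        then show ?thesis using B BW[OF j] by blast
      qed
    qed
    then show "\<exists>s. bij_betw s {..<N} {..<N} \<and> (\<forall>j<N. (\<Gamma> (s j) = \<Gamma> j \<and> y' (s j) \<in> W j) \<or>
        (\<Gamma> (s j) = - \<Gamma> j \<and> deck_involution (y' (s j)) \<in> W j))"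
      using bij by blast
  qed
qed

text \<open>Equal currents are close to any precision, so the neighbourhoods can be taken to exclude
  every point of \<open>y'\<close> and every partner of one, except \<open>y j\<close> itself;
  membership then means equality.\<close>

lemma vortex_current_eq_iff:
  assumes y: "\<And>j. j < N \<Longrightarrow> y j \<in> double_cover X A" and inj: "inj_on (\<lambda>j. cover_proj (y j)) {..<N}"
    and y': "\<And>j. j < N \<Longrightarrow> y' j \<in> double_cover X A" and \<Gamma>: "\<And>j. j < N \<Longrightarrow> \<Gamma> j \<noteq> 0"
  shows "vortex_current X A N \<Gamma> y = vortex_current X A N \<Gamma> y' \<longleftrightarrow> same_vortices N \<Gamma> y y'"
proof
  assume eq: "vortex_current X A N \<Gamma> y = vortex_current X A N \<Gamma> y'"
  let ?T = "cover_topology X A"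
  let ?P = "y' ` {..<N} \<union> (\<lambda>j. deck_involution (y' j)) ` {..<N}"
  define W where "W = (\<lambda>j. topspace ?T - (?P - {y j}))"
  have W: "openin ?T (W j) \<and> y j \<in> W j" if "j < N" for j
  proof -
    have "?P \<subseteq> topspace ?T"
      unfolding topspace_cover using y' deck_in_double_cover[OF y'] by blast
    then have "closedin ?T (?P - {y j})"
      using smooth_atlas.hausdorff[OF cover_smooth_atlas] by (intro closedin_Hausdorff_finite) auto
    then have "openin ?T (W j)" unfolding W_def by (rule openin_diff[OF openin_topspace])
    then show ?thesis using y[OF that] by (simp add: W_def topspace_cover)
  qed
  obtain \<Phi> \<epsilon> where "finite \<Phi>" "\<Phi> \<subseteq> twisted" "\<epsilon> > (0::real)" and close:
    "\<And>y'. (\<And>j. j < N \<Longrightarrow> y' j \<in> double_cover X A) \<Longrightarrow>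
      (\<And>f. f \<in> \<Phi> \<Longrightarrow> \<bar>vortex_current X A N \<Gamma> y' f - vortex_current X A N \<Gamma> y f\<bar> < \<epsilon>) \<Longrightarrow>
      \<exists>s. bij_betw s {..<N} {..<N} \<and> (\<forall>j<N. (\<Gamma> (s j) = \<Gamma> j \<and> y' (s j) \<in> W j) \<or>
        (\<Gamma> (s j) = - \<Gamma> j \<and> deck_involution (y' (s j)) \<in> W j))"
    by (rule weakly_close_configurations[OF y inj \<Gamma> W]) blast+
  obtain s where s: "bij_betw s {..<N} {..<N}" "\<And>j. j < N \<Longrightarrow> (\<Gamma> (s j) = \<Gamma> j \<and> y' (s j) \<in> W j) \<or>
      (\<Gamma> (s j) = - \<Gamma> j \<and> deck_involution (y' (s j)) \<in> W j)"
    using close[of y', OF y'] \<open>\<epsilon> > 0\<close> unfolding eq by auto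
  have "(\<Gamma> (s j) = \<Gamma> j \<and> y' (s j) = y j) \<or> (\<Gamma> (s j) = - \<Gamma> j \<and> y' (s j) = deck_involution (y j))"
    if j: "j < N" for j
  proof -
    have sj: "s j < N" using bij_betw_apply[OF s(1), of j] j by simp
    have "y' (s j) = y j" if "y' (s j) \<in> W j" using that sj unfolding W_def by blast
    moreover have "y' (s j) = deck_involution (y j)" if "deck_involution (y' (s j)) \<in> W j"
    proof -
      have "deck_involution (y' (s j)) = y j" using that sj unfolding W_def by blast
      then show ?thesis by (metis deck_deck)
    qed
    ultimately show ?thesis using s(2)[OF j] by blast
  qed
  then show "same_vortices N \<Gamma> y y'" unfolding same_vortices_def using s(1) by blast
qed (rule same_vortices_current[OF y])

end

section \<open>The phase space and its quotient topology\<close>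

context nonorientable_atlas
begin

lemma phase_space_eq:
  assumes y: "y \<in> configurations X A N"
  shows "phase_space X A g (vortex_current X A N \<Gamma> y) = vortex_current X A N \<Gamma> ` configurations X A N"
proof -
  have yC: "y j \<in> double_cover X A" if "j < N" for j
    using y that by (auto simp: configurations_iff)
  have inj: "inj_on (\<lambda>j. cover_proj (y j)) {..<N}" using y by (simp add: configurations_iff)
  \<comment> \<open>Pull-back by F acts on configurations by the lift of the inverse of F; off the
    twisted functions both sides are \<open>undefined\<close>.\<close>
  have pb: "pullback_current X A F (vortex_current X A N \<Gamma> y) = vortex_current X A N \<Gamma> y'"
    if F: "F \<in> SDiff X A g" and y': "\<And>j. j < N \<Longrightarrow> y' j = cover_lift A (inv_into (topspace X) F) (y j)" for F y'
  proof
    fix f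
    show "pullback_current X A F (vortex_current X A N \<Gamma> y) f = vortex_current X A N \<Gamma> y' f"
    proof (cases "f \<in> twisted")
      case True
      have "f \<circ> cover_lift A (inv_into (topspace X) F) \<in> twisted"
        by (rule twisted_compose_lift[OF SDiffD(1)[OF SDiff_inverse[OF F]] True])
      then show ?thesis
        using True y' by (simp add: pullback_current_def vortex_current_apply)
    next
      case False
      then show ?thesis by (simp add: pullback_current_def vortex_current_def)
    qed
  qed
  show ?thesis
  proof (intro equalityI subsetI)
    fix T assume "T \<in> phase_space X A g (vortex_current X A N \<Gamma> y)"
    then obtain F where F: "F \<in> SDiff X A g" and T: "T = pullback_current X A F (vortex_current X A N \<Gamma> y)"
      unfolding phase_space_def by blast
    let ?G = "inv_into (topspace X) F"
    note d = SDiffD(1)[OF SDiff_inverse[OF F]]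
    define y' where "y' = (\<lambda>j\<in>{..<N}. cover_lift A ?G (y j))"
    have y'j: "y' j = cover_lift A ?G (y j)" if "j < N" for j using that by (simp add: y'_def)
    have "y' \<in> configurations X A N"
      unfolding configurations_iff
    proof
      show "y' \<in> {..<N} \<rightarrow>\<^sub>E double_cover X A"
        unfolding y'_def using cover_lift_mem(1)[OF d yC] by auto
      show "inj_on (\<lambda>j. cover_proj (y' j)) {..<N}"
      proof (rule inj_onI)
        fix i j assume ij: "i \<in> {..<N}" "j \<in> {..<N}" "cover_proj (y' i) = cover_proj (y' j)"
        then have "?G (cover_proj (y i)) = ?G (cover_proj (y j))"
          using y'j cover_lift_mem(2)[OF d yC] by simp
        moreover have "cover_proj (y i) \<in> topspace X" "cover_proj (y j) \<in> topspace X"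
          using yC ij by (auto simp: mem_double_cover)
        ultimately have "cover_proj (y i) = cover_proj (y j)"
          using diffeomorphism_inverse(3)[OF SDiffD(1)[OF F]] by metis
        then show "i = j" using inj_onD[OF inj] ij by blast
      qed
    qed
    then show "T \<in> vortex_current X A N \<Gamma> ` configurations X A N"
      using pb[OF F y'j] T by blast
  next
    fix T assume "T \<in> vortex_current X A N \<Gamma> ` configurations X A N"
    then obtain y' where y': "y' \<in> configurations X A N" and T: "T = vortex_current X A N \<Gamma> y'" by blast
    \<comment> \<open>As pull-back moves vortices by the inverse, F has to carry the target y' back
      to y.\<close>
    obtain F where F: "F \<in> SDiff X A g" "\<And>j. j < N \<Longrightarrow> cover_lift A F (y' j) = y j"
      by (rule SDiff_lift_transitive[OF y' y]) blast
    have "y' j = cover_lift A (inv_into (topspace X) F) (y j)" if "j < N" for j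
    proof -
      have "y' j \<in> double_cover X A" using y' that by (auto simp: configurations_iff)
      then show ?thesis using cover_lift_inverse(1)[OF SDiffD(1)[OF F(1)]] F(2)[OF that] by metis
    qed
    from pb[OF F(1) this] have "T = pullback_current X A F (vortex_current X A N \<Gamma> y)" using T by simp
    then show "T \<in> phase_space X A g (vortex_current X A N \<Gamma> y)"
      unfolding phase_space_def using F(1) by blast
  qed
qed

lemma topspace_weak: "topspace (weak_topology X A) = twisted \<rightarrow>\<^sub>E UNIV"
  by (simp add: weak_topology_def topspace_product_topology)

lemma vortex_current_in_weak: "vortex_current X A N \<Gamma> y \<in> topspace (weak_topology X A)"
  unfolding topspace_weak by (simp add: vortex_current_def)

lemma topspace_configurations: "topspace (configuration_topology X A N) = configurations X A N"
proof -
  have "configurations X A N \<subseteq> {..<N} \<rightarrow>\<^sub>E double_cover X A" by (auto simp: configurations_iff)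
  then show ?thesis
    by (auto simp: configuration_topology_def topspace_product_topology topspace_cover)
qed

lemma vortex_current_continuous:
  "continuous_map (configuration_topology X A N) (weak_topology X A) (vortex_current X A N \<Gamma>)"
  unfolding weak_topology_def continuous_map_componentwise
proof (intro conjI ballI)
  show "vortex_current X A N \<Gamma> ` topspace (configuration_topology X A N) \<subseteq> extensional twisted"
    by (auto simp: vortex_current_def)
  fix f assume f: "f \<in> twisted"
  have "continuous_map (configuration_topology X A N) euclideanreal (\<lambda>y. f (y j))" if "j < N" for j
  proof -
    have "continuous_map (product_topology (\<lambda>_. cover) {..<N}) cover (\<lambda>y. y j)"
      by (rule continuous_map_product_projection) (use that in simp)
    from continuous_map_compose[OF this twisted_continuous[OF f]]
    show ?thesis unfolding configuration_topology_def
      by (intro continuous_map_from_subtopology) (simp add: o_def)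
  qed
  then have "continuous_map (configuration_topology X A N) euclideanreal (\<lambda>y. \<Sum>j<N. \<Gamma> j * f (y j))"
    by (intro continuous_map_sum continuous_map_real_mult_left) auto
  then show "continuous_map (configuration_topology X A N) euclideanreal (\<lambda>y. vortex_current X A N \<Gamma> y f)"
    by (simp add: vortex_current_apply[OF f])
qed

text \<open>The substantial direction starts from a set of currents with open preimage. A current
  close to that of y may come from a configuration far from y, but relabelling and changes within
  fibres bring it near y without changing the current.\<close>

lemma vortex_current_quotient_map:
  assumes \<Gamma>: "\<And>j. j < N \<Longrightarrow> \<Gamma> j \<noteq> 0"
  shows "quotient_map (configuration_topology X A N)
    (subtopology (weak_topology X A) (vortex_current X A N \<Gamma> ` configurations X A N)) (vortex_current X A N \<Gamma>)"
proof -
  let ?Q = "vortex_current X A N \<Gamma>" and ?C = "configurations X A N"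
  let ?Y = "subtopology (weak_topology X A) (?Q ` ?C)"
  have tY: "topspace ?Y = ?Q ` ?C" using vortex_current_in_weak by auto
  have cont: "continuous_map (configuration_topology X A N) ?Y ?Q"
    unfolding continuous_map_in_subtopology using vortex_current_continuous
    by (simp add: topspace_configurations)
  have "openin ?Y U" if U: "U \<subseteq> ?Q ` ?C" and op: "openin (configuration_topology X A N) {y \<in> ?C. ?Q y \<in> U}" for U
    unfolding openin_subopen[of _ U]
  proof
    fix T assume T: "T \<in> U"
    then obtain y where y: "y \<in> ?C" "T = ?Q y" using U by blast
    obtain P where P: "openin (product_topology (\<lambda>_. cover) {..<N}) P" "{y \<in> ?C. ?Q y \<in> U} = P \<inter> ?C"
      using op unfolding configuration_topology_def openin_subtopology by blast
    have "y \<in> P" using P(2) T y by blast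
    from bspec[OF iffD1[OF openin_product_topology_alt P(1)] this]
    obtain W where W: "\<And>j. j < N \<Longrightarrow> openin cover (W j)" "y \<in> Pi\<^sub>E {..<N} W" "Pi\<^sub>E {..<N} W \<subseteq> P"
      by blast
    have yC: "y j \<in> double_cover X A" if "j < N" for j using y(1) that by (auto simp: configurations_iff)
    have inj: "inj_on (\<lambda>j. cover_proj (y j)) {..<N}" using y(1) by (simp add: configurations_iff)
    have W': "openin cover (W j) \<and> y j \<in> W j" if "j < N" for j using W(1,2) that by auto
    obtain \<Phi> \<epsilon> where \<Phi>: "finite \<Phi>" "\<Phi> \<subseteq> twisted" "\<epsilon> > (0::real)" and close:
      "\<And>y'. (\<And>j. j < N \<Longrightarrow> y' j \<in> double_cover X A) \<Longrightarrow>
        (\<And>f. f \<in> \<Phi> \<Longrightarrow> \<bar>?Q y' f - ?Q y f\<bar> < \<epsilon>) \<Longrightarrow>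
        \<exists>s. bij_betw s {..<N} {..<N} \<and> (\<forall>j<N. (\<Gamma> (s j) = \<Gamma> j \<and> y' (s j) \<in> W j) \<or>
          (\<Gamma> (s j) = - \<Gamma> j \<and> deck_involution (y' (s j)) \<in> W j))"
      by (rule weakly_close_configurations[OF yC inj \<Gamma> W']) blast+
    \<comment> \<open>The additional intersection with the whole space covers an empty
      \<open>\<Phi>\<close>, which occurs for N = 0.\<close>
    define B where "B = topspace (weak_topology X A) \<inter> (\<Inter>f\<in>\<Phi>. {S \<in> topspace (weak_topology X A). S f \<in> ball (T f) \<epsilon>})"
    have "openin (weak_topology X A) {S \<in> topspace (weak_topology X A). S f \<in> ball (T f) \<epsilon>}" if "f \<in> \<Phi>" for f
    proof (rule openin_continuous_map_preimage)
      show "continuous_map (weak_topology X A) euclideanreal (\<lambda>S. S f)"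
        unfolding weak_topology_def by (rule continuous_map_product_projection) (use that \<Phi>(2) in blast)
    qed simp
    then have opB: "openin (weak_topology X A) B"
      unfolding B_def using \<Phi>(1) by (cases "\<Phi> = {}") (auto intro!: openin_Int openin_Inter)
    have "T \<in> B" using vortex_current_in_weak y(2) \<Phi>(3) by (auto simp: B_def)
    have "B \<inter> ?Q ` ?C \<subseteq> U"
    proof
      fix S assume "S \<in> B \<inter> ?Q ` ?C"
      then obtain y' where y': "y' \<in> ?C" "S = ?Q y'" and SB: "S \<in> B" by blast
      have y'C: "y' j \<in> double_cover X A" if "j < N" for j using y'(1) that by (auto simp: configurations_iff)
      have "\<bar>?Q y' f - ?Q y f\<bar> < \<epsilon>" if "f \<in> \<Phi>" for f
        using SB that y(2) y'(2) by (auto simp: B_def dist_real_def abs_minus_commute)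
      then obtain s where s: "bij_betw s {..<N} {..<N}" "\<And>j. j < N \<Longrightarrow> (\<Gamma> (s j) = \<Gamma> j \<and> y' (s j) \<in> W j) \<or>
          (\<Gamma> (s j) = - \<Gamma> j \<and> deck_involution (y' (s j)) \<in> W j)"
        using close[of y', OF y'C] by blast
      \<comment> \<open>The representative of the same current in the box around y: vortices
        numbered by s, with the other point of the fibre wherever the strength changes sign.\<close>
      define w where "w = (\<lambda>j\<in>{..<N}. if \<Gamma> (s j) = \<Gamma> j \<and> y' (s j) \<in> W j then y' (s j) else deck_involution (y' (s j)))"
      have sN: "s j < N" if "j < N" for j using bij_betw_apply[OF s(1), of j] that by simp
      have w: "w j \<in> W j" "w j \<in> double_cover X A" "cover_proj (w j) = cover_proj (y' (s j))"
        "(\<Gamma> (s j) = \<Gamma> j \<and> y' (s j) = w j) \<or> (\<Gamma> (s j) = - \<Gamma> j \<and> y' (s j) = deck_involution (w j))" if "j < N" for j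
        using s(2)[OF that] that y'C[OF sN[OF that]] deck_in_double_cover[OF y'C[OF sN[OF that]]]
        by (auto simp: w_def)
      have wC: "w \<in> ?C"
        unfolding configurations_iff
      proof
        show "w \<in> {..<N} \<rightarrow>\<^sub>E double_cover X A" using w(2) by (auto simp: w_def)
        show "inj_on (\<lambda>j. cover_proj (w j)) {..<N}"
        proof (rule inj_onI)
          fix i j assume ij: "i \<in> {..<N}" "j \<in> {..<N}" "cover_proj (w i) = cover_proj (w j)"
          then have "cover_proj (y' (s i)) = cover_proj (y' (s j))" using w(3) by simp
          then have "s i = s j"
            using y'(1) sN ij by (auto simp: configurations_iff dest: inj_onD)
          then show "i = j" using bij_betw_imp_inj_on[OF s(1)] ij by (auto dest: inj_onD)
        qed
      qed
      have "same_vortices N \<Gamma> w y'"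
        unfolding same_vortices_def using s(1) w(4) by blast
      then have Q: "?Q w = ?Q y'"
        by (rule same_vortices_current[where y = w, rotated]) (rule w(2))
      have "w \<in> P" using w(1) by (intro subsetD[OF W(3)] PiE_I) (auto simp: w_def)
      then have "w \<in> {y \<in> ?C. ?Q y \<in> U}" unfolding P(2) using wC by blast
      then show "S \<in> U" using Q y'(2) by simp
    qed
    moreover have "openin ?Y (B \<inter> ?Q ` ?C)" using opB by (auto simp: openin_subtopology)
    moreover have "T \<in> B \<inter> ?Q ` ?C" using \<open>T \<in> B\<close> y by (intro IntI) (simp_all only: imageI)
    ultimately show "\<exists>V. openin ?Y V \<and> T \<in> V \<and> V \<subseteq> U" by (intro exI conjI)
  qed
  moreover have "openin (configuration_topology X A N) {y \<in> ?C. ?Q y \<in> U}" if "openin ?Y U" for U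
    using openin_continuous_map_preimage[OF cont that] by (simp add: topspace_configurations)
  ultimately show ?thesis
    unfolding quotient_map_def tY topspace_configurations by blast
qed

end

theorem proposition3p2:
  fixes X :: "'a topology" and A :: "'a chart set" and g :: "'a chart \<Rightarrow> 'a \<Rightarrow> real^2^2"
    and N :: nat and x :: "nat \<Rightarrow> 'a" and l :: "nat \<Rightarrow> 'a current" and L :: "'a current"
    and xt :: "nat \<Rightarrow> 'a oriented_point"
  assumes surface: "nonorientable_riemannian_surface X A g"
    and distinct: "inj_on x {..<N}"
    and vortices: "\<And>j. j < N \<Longrightarrow> delta_two_form X A (x j) (l j)"
    and vorticity: "L = (\<lambda>f \<in> twisted_test_functions X A. \<Sum>j<N. l j f)"
    and lifts: "xt \<in> {..<N} \<rightarrow>\<^sub>E double_cover X A" "\<And>j. j < N \<Longrightarrow> cover_proj (xt j) = x j"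
  shows "(\<exists>!\<Gamma>. vortex_strengths X A N L xt \<Gamma>) \<and>
    (\<forall>\<Gamma>. vortex_strengths X A N L xt \<Gamma> \<longrightarrow>
       vortex_current X A N \<Gamma> xt = L \<and>
       parametrized_by_configurations X A N \<Gamma> (phase_space X A g L))"
proof -
  interpret nonorientable_atlas X A g
    using surface smooth_surface_imp_smooth_atlas[of X A]
    by (simp add: nonorientable_riemannian_surface_def nonorientable_atlas_def nonorientable_atlas_axioms_def
        riemannian_atlas_def riemannian_atlas_axioms_def)
  have xtC: "xt j \<in> double_cover X A" if "j < N" for j
    using lifts(1) that by auto
  have inj: "inj_on (\<lambda>j. cover_proj (xt j)) {..<N}"
    using distinct lifts(2) by (auto simp: inj_on_def)
  have xt: "xt \<in> configurations X A N"
    using lifts(1) inj by (simp add: configurations_iff)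
  \<comment> \<open>The delta form is given with respect to some orientation at x j, not necessarily
    that of the lift \<open>xt j\<close>. The two differ at most by the involution, which changes
    the sign of the strength.\<close>
  have "\<exists>G. G \<noteq> 0 \<and> (\<forall>f \<in> twisted. l j f = G * f (xt j))" if j: "j < N" for j
  proof -
    obtain z G where z: "z \<in> double_cover X A" "cover_proj z = x j" and G: "G \<noteq> 0"
      and l: "l j = (\<lambda>f \<in> twisted. G * f z)"
      using vortices[OF j] unfolding delta_two_form_def by blast
    have "z = xt j \<or> z = deck_involution (xt j)"
      by (rule fibre_cases[OF xtC[OF j] z(1)]) (simp add: z(2) lifts(2)[OF j])
    then show ?thesis
    proof
      assume "z = xt j"
      then show ?thesis using G by (intro exI[of _ G]) (simp add: l)
    next
      assume "z = deck_involution (xt j)"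
      then have "l j f = - G * f (xt j)" if "f \<in> twisted" for f
        using that twistedD(2)[OF that xtC[OF j]] by (simp add: l)
      then show ?thesis using G by (intro exI[of _ "- G"]) simp
    qed
  qed
  then obtain G where G: "\<And>j. j < N \<Longrightarrow> G j \<noteq> 0" "\<And>j f. j < N \<Longrightarrow> f \<in> twisted \<Longrightarrow> l j f = G j * f (xt j)"
    by metis
  define \<Gamma>0 where "\<Gamma>0 = restrict G {..<N}"
  have \<Gamma>0: "\<Gamma>0 j \<noteq> 0" if "j < N" for j using G(1) that by (simp add: \<Gamma>0_def)
  have ext: "\<Gamma>0 \<in> extensional {..<N}" by (simp add: \<Gamma>0_def)
  have L: "L = vortex_current X A N \<Gamma>0 xt"
    unfolding vorticity vortex_current_def
    by (rule restrict_ext, rule sum.cong) (simp_all add: G(2) \<Gamma>0_def)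
  \<comment> \<open>Once L is a vortex current over xt, this equivalence gives existence and
    uniqueness of the strengths together.\<close>
  have iff: "vortex_strengths X A N L xt \<Gamma> \<longleftrightarrow> \<Gamma> = \<Gamma>0" for \<Gamma>
    unfolding L by (rule vortex_strengths_vortex_current[OF xtC inj ext])
  have cfg: "\<And>j. j < N \<Longrightarrow> y j \<in> double_cover X A" "inj_on (\<lambda>j. cover_proj (y j)) {..<N}"
    if "y \<in> configurations X A N" for y
    using that by (auto simp: configurations_iff)
  have "parametrized_by_configurations X A N \<Gamma>0 (phase_space X A g L)"
    unfolding parametrized_by_configurations_def L phase_space_eq[OF xt]
  proof (intro conjI ballI)
    show "quotient_map (configuration_topology X A N)
        (subtopology (weak_topology X A) (vortex_current X A N \<Gamma>0 ` configurations X A N)) (vortex_current X A N \<Gamma>0)"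
      by (rule vortex_current_quotient_map[OF \<Gamma>0])
    show "vortex_strengths X A N (vortex_current X A N \<Gamma>0 y) y \<Gamma>0" if "y \<in> configurations X A N" for y
      using vortex_strengths_vortex_current[of N y \<Gamma>0 \<Gamma>0] cfg[OF that] ext by blast
    show "vortex_current X A N \<Gamma>0 y = vortex_current X A N \<Gamma>0 y' \<longleftrightarrow> same_vortices N \<Gamma>0 y y'"
      if "y \<in> configurations X A N" "y' \<in> configurations X A N" for y y'
      using vortex_current_eq_iff[of N y y' \<Gamma>0] cfg[OF that(1)] cfg(1)[OF that(2)] \<Gamma>0 by blast
  qed
  then show ?thesis
    unfolding iff using L by simp
qed

end
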